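(* Let $d\ge1$ and $n\ge3$. The set $$\boldsymbol{S}_{d,n}=\big\{\,t_1^{r_1}\cdots t_n^{r_n}\,g_{\underline{i},\underline{k}}\;\big|\;(\underline{i},\underline{k})\in\mathfrak{T}_n,\ (r_1,\dots,r_n)\in\mathcal{E}_{d,n}(\underline{i},\underline{k})\,\big\}$$ is a basis of $\mathrm{YTL}_{d,n}(u)$ as a $\mathbb{C}[u,u^{-1}]$-module (in particular it is free). Moreover, if $m$ is the weight of $(\underline{i},\underline{k})$, then $|\mathcal{E}_{d,n}(\underline{i},\underline{k})|=2^{n-m-1}d^2-(2^{n-m-1}-1)d-\delta_{m,0}(d^2-d)$.
   Context: Let $d,n\ge1$ be integers and $u$ an indeterminate. The Yokonuma–Hecke algebra $\mathrm{Y}_{d,n}(u)$ is the associative $\mathbb{C}[u,u^{-1}]$-algebra generated by $g_1,\dots,g_{n-1},t_1,\dots,t_n$ subject to: $g_ig_j=g_jg_i$ for $|i-j|>1$; $g_ig_{i+1}g_i=g_{i+1}g_ig_{i+1}$ for $1\le i\le n-2$; $t_it_j=t_jt_i$ for all $i,j$; $t_jg_i=g_it_{s_i(j)}$ for all $i,j$, where $s_i$ is the transposition $(i,i+1)$; $t_j^d=1$ for all $j$; and $g_i^2=1+(u-1)e_i+(u-1)e_ig_i$, where $e_i=\frac1d\sum_{s=0}^{d-1}t_i^st_{i+1}^{-s}$. For $n\ge3$, the Yokonuma–Temperley–Lieb algebra $\mathrm{YTL}_{d,n}(u)$ is the quotient of $\mathrm{Y}_{d,n}(u)$ by the two-sided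 ideal generated by the elements $g_ig_{i+1}g_i+g_ig_{i+1}+g_{i+1}g_i+g_i+g_{i+1}+1$, $1\le i\le n-2$; images of the generators in the quotient are denoted by the same letters. Index set: $\mathfrak{T}_n$ is the set of pairs $(\underline{i},\underline{k})$ of $p$-tuples of non-negative integers $\underline{i}=(i_1,\dots,i_p)$, $\underline{k}=(k_1,\dots,k_p)$, $0\le p\le n-1$, with $1\le i_1<i_2<\dots<i_p\le n-1$ and $1\le i_1-k_1<i_2-k_2<\dots<i_p-k_p\le n-1$. Set $g_{\underline{i},\underline{k}}=\prod_{j=1}^p(g_{i_j}g_{i_j-1}\cdots g_{i_j-k_j})$ (product in increasing order of $j$), with $g_{\emptyset,\emptyset}=1$. Let $\mathcal{I}(\underline{i},\underline{k})=\bigcup_{j=1}^p\{i_j-k_j,\dots,i_j\}$; the weight of $(\underline{i},\underline{k})$ is $m=|\mathcal{I}(\underline{i},\underline{k})|$. Exponent sets: identify a tuple $(r_1,\dots,r_n)\in\{0,\dots,d-1\}^n$ with the monomial $x_1^{r_1}\cdots x_n^{r_n}$ in commuting variables $x_1,\dots,x_n$ with exponents in $\{0,\dots,d-1\}$. For $(\underline{i},\underline{k})=(\emptyset,\emptyset)$, $\mathcal{E}_{d,n}(\emptyset,\emptyset)$ consists of the exponent tuples of the monomials $x_i^ax_{i+1}^b\prod_{j=i+2}^n x_j^{\epsilon_j}$ with $1\le i<n$, $1\le a<d$, $0\le b<d$, $\epsilon_j\in\{0,1\}$, together with those of $x_n^b$, $0\le b<d$. For $p\ge1$, let $L(1)=\min\{1\le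 L\le p\mid i_L+1\notin\mathcal{I}(\underline{i},\underline{k})\}$, $N=n-m+1$, and set $\tilde x_1=x_{i_1}$, $\tilde x_2=x_{i_{L(1)}+1}$, and let $\tilde x_3,\dots,\tilde x_N$ be the variables $x_s$ with $s\in\{1,\dots,n\}\setminus\mathcal{I}(\underline{i},\underline{k})$, $s\ne i_{L(1)}+1$, listed in a fixed order (e.g. increasing $s$). Then $\mathcal{E}_{d,n}(\underline{i},\underline{k})$ consists of the exponent tuples (in the $x$'s) of the monomials $\tilde x_i^a\tilde x_{i+1}^b\prod_{j=i+2}^N\tilde x_j^{\epsilon_j}$ with $2\le i<N$, $1\le a<d$, $0\le b<d$, $\epsilon_j\in\{0,1\}$; of $\tilde x_N^b$ with $0\le b<d$; and of $\tilde x_1^a\tilde x_2^b$ with $1\le a<d$, $0\le b<d$. *)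

theory Defs
  imports Complex_Main "HOL-Library.Poly_Mapping"
begin

text \<open>The group algebra of (int,+) over the complex numbers, i.e. finitely supported
  functions int to complex with convolution product, is exactly C[u,u^-1].\<close>
type_synonym laurent = "int \<Rightarrow>\<^sub>0 complex"

definition uu :: laurent where "uu = Poly_Mapping.single 1 1"

definition cst :: "complex \<Rightarrow> laurent" where "cst c = Poly_Mapping.single 0 c"

datatype gen = G nat | T nat

definition gens :: "nat \<Rightarrow> gen set" where
  "gens n = {G i | i. 1 \<le> i \<and> i \<le> n - 1} \<union> {T j | j. 1 \<le> j \<and> j \<le> n}"

text \<open>Elements: coefficient functions on words; the free algebra consists of the finitely
  supported ones whose support lies in words over the alphabet.\<close>
type_synonym elt = "gen list \<Rightarrow> laurent"

definition freealg :: "nat \<Rightarrow> elt set" where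
  "freealg n = {f. finite {w. f w \<noteq> 0} \<and> (\<forall>w. f w \<noteq> 0 \<longrightarrow> set w \<subseteq> gens n)}"

definition mono :: "gen list \<Rightarrow> elt" where "mono w = (\<lambda>v. if v = w then 1 else 0)"
definition ncadd :: "elt \<Rightarrow> elt \<Rightarrow> elt" where "ncadd f g = (\<lambda>w. f w + g w)"
definition ncsmult :: "laurent \<Rightarrow> elt \<Rightarrow> elt" where "ncsmult c f = (\<lambda>w. c * f w)"
definition ncmult :: "elt \<Rightarrow> elt \<Rightarrow> elt" where
  "ncmult f g = (\<lambda>w. \<Sum>k\<in>{0..length w}. f (take k w) * g (drop k w))"
definition ncsum :: "('i \<Rightarrow> elt) \<Rightarrow> 'i set \<Rightarrow> elt" where
  "ncsum F J = (\<lambda>w. \<Sum>j\<in>J. F j w)"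

inductive_set ideal_gen :: "elt set \<Rightarrow> elt set \<Rightarrow> elt set" for A Rs where
  gen: "r \<in> Rs \<Longrightarrow> r \<in> ideal_gen A Rs"
| zero: "(\<lambda>_. 0) \<in> ideal_gen A Rs"
| add: "x \<in> ideal_gen A Rs \<Longrightarrow> y \<in> ideal_gen A Rs \<Longrightarrow> ncadd x y \<in> ideal_gen A Rs"
| lmult: "x \<in> ideal_gen A Rs \<Longrightarrow> p \<in> A \<Longrightarrow> ncmult p x \<in> ideal_gen A Rs"
| rmult: "x \<in> ideal_gen A Rs \<Longrightarrow> p \<in> A \<Longrightarrow> ncmult x p \<in> ideal_gen A Rs"

definition wd :: "gen list \<Rightarrow> elt" where "wd = mono"

definition ncsub :: "elt \<Rightarrow> elt \<Rightarrow> elt" where "ncsub f g = (\<lambda>w. f w - g w)"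

definition sw :: "nat \<Rightarrow> nat \<Rightarrow> nat" where
  "sw i j = (if j = i then i + 1 else if j = i + 1 then i else j)"

text \<open>e_i = (1/d) sum_s t_i^s t_(i+1)^(-s); since t^d = 1, t_(i+1)^(-s) = t_(i+1)^((d-s) mod d).\<close>
definition e_el :: "nat \<Rightarrow> nat \<Rightarrow> elt" where
  "e_el d i = ncsmult (cst (1 / of_nat d))
     (ncsum (\<lambda>s. wd (replicate s (T i) @ replicate ((d - s) mod d) (T (i+1)))) {0..<d})"

definition Y_rels :: "nat \<Rightarrow> nat \<Rightarrow> elt set" where
  "Y_rels d n =
     {ncsub (wd [G i, G j]) (wd [G j, G i]) | i j.
        1 \<le> i \<and> i \<le> n - 1 \<and> 1 \<le> j \<and> j \<le> n - 1 \<and> (i + 1 < j \<or> j + 1 < i)}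
   \<union> {ncsub (wd [G i, G (i+1), G i]) (wd [G (i+1), G i, G (i+1)]) | i. 1 \<le> i \<and> i + 2 \<le> n}
   \<union> {ncsub (wd [T i, T j]) (wd [T j, T i]) | i j. 1 \<le> i \<and> i \<le> n \<and> 1 \<le> j \<and> j \<le> n}
   \<union> {ncsub (wd [T j, G i]) (wd [G i, T (sw i j)]) | i j.
        1 \<le> i \<and> i \<le> n - 1 \<and> 1 \<le> j \<and> j \<le> n}
   \<union> {ncsub (wd (replicate d (T j))) (wd []) | j. 1 \<le> j \<and> j \<le> n}
   \<union> {ncsub (wd [G i, G i])
         (ncadd (wd [])
           (ncadd (ncsmult (uu - 1) (e_el d i))
                  (ncsmult (uu - 1) (ncmult (e_el d i) (wd [G i]))))) | i. 1 \<le> i \<and> i \<le> n - 1}"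

definition TL_rels :: "nat \<Rightarrow> elt set" where
  "TL_rels n = {ncsum wd {[G i, G (i+1), G i], [G i, G (i+1)], [G (i+1), G i], [G i], [G (i+1)], []}
                | i. 1 \<le> i \<and> i + 2 \<le> n}"

definition YTL_ideal :: "nat \<Rightarrow> nat \<Rightarrow> elt set" where
  "YTL_ideal d n = ideal_gen (freealg n) (Y_rels d n \<union> TL_rels n)"

definition is_quot_basis :: "elt set \<Rightarrow> elt set \<Rightarrow> 'i set \<Rightarrow> ('i \<Rightarrow> elt) \<Rightarrow> bool" where
  "is_quot_basis A I J v \<longleftrightarrow> finite J \<and>
     (\<forall>p\<in>A. \<exists>c. ncsub p (ncsum (\<lambda>j. ncsmult (c j) (v j)) J) \<in> I) \<and>
     (\<forall>c. ncsum (\<lambda>j. ncsmult (c j) (v j)) J \<in> I \<longrightarrow> (\<forall>j\<in>J. c j = 0))"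

definition Tn :: "nat \<Rightarrow> (nat list \<times> nat list) set" where
  "Tn n = {(is, ks). length is = length ks \<and> length is \<le> n - 1 \<and>
      sorted_wrt (<) is \<and> sorted_wrt (<) (map2 (-) is ks) \<and>
      (\<forall>j < length is. 1 \<le> is ! j \<and> is ! j \<le> n - 1 \<and> ks ! j < is ! j)}"

definition gword :: "nat list \<times> nat list \<Rightarrow> gen list" where
  "gword ik = (case ik of (is, ks) \<Rightarrow>
     concat (map (\<lambda>j. map G (rev [is ! j - ks ! j ..< is ! j + 1])) [0..<length is]))"

text \<open>Exponent tuple r = (r_1,...,r_n) stored as a list, r ! (j-1) = r_j.\<close>
definition tword :: "nat \<Rightarrow> nat list \<Rightarrow> gen list" where
  "tword n r = concat (map (\<lambda>j. replicate (r ! (j - 1)) (T j)) [1..<n + 1])"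

definition Iset :: "nat list \<times> nat list \<Rightarrow> nat set" where
  "Iset ik = (case ik of (is, ks) \<Rightarrow> (\<Union>j<length is. {is ! j - ks ! j .. is ! j}))"

definition weight :: "nat list \<times> nat list \<Rightarrow> nat" where
  "weight ik = card (Iset ik)"

text \<open>Exponent functions e on the renamed variables x~_1..x~_N (e j = exponent of x~_j).\<close>
definition chain_fam :: "nat \<Rightarrow> nat \<Rightarrow> nat \<Rightarrow> (nat \<Rightarrow> nat) set" where
  "chain_fam d N lo =
     {e. \<exists>i a b \<epsilon>. lo \<le> i \<and> i < N \<and> 1 \<le> a \<and> a < d \<and> b < d \<and> (\<forall>j. \<epsilon> j \<le> (1::nat)) \<and>
          e = (\<lambda>j. if j = i then a else if j = i + 1 then b
                    else if i + 2 \<le> j \<and> j \<le> N then \<epsilon> j else 0)}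
   \<union> {e. \<exists>b. b < d \<and> e = (\<lambda>j. if j = N then b else 0)}"

text \<open>Translate exponents of x~_1..x~_N (x~_j = x_(vt j)) into an exponent tuple in x_1..x_n.\<close>
definition to_tuple :: "nat \<Rightarrow> nat \<Rightarrow> (nat \<Rightarrow> nat) \<Rightarrow> (nat \<Rightarrow> nat) \<Rightarrow> nat list" where
  "to_tuple n N vt e = map (\<lambda>s. \<Sum>j\<in>{1..N}. if vt j = s then e j else 0) [1..<n + 1]"

definition L1 :: "nat list \<times> nat list \<Rightarrow> nat" where
  "L1 ik = (case ik of (is, ks) \<Rightarrow>
     (LEAST L. 1 \<le> L \<and> L \<le> length is \<and> is ! (L - 1) + 1 \<notin> Iset ik))"

definition vtilde :: "nat \<Rightarrow> nat list \<times> nat list \<Rightarrow> nat \<Rightarrow> nat" where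
  "vtilde n ik j = (case ik of (is, ks) \<Rightarrow>
     (if j = 1 then is ! 0
      else if j = 2 then is ! (L1 ik - 1) + 1
      else sorted_list_of_set ({1..n} - Iset ik - {is ! (L1 ik - 1) + 1}) ! (j - 3)))"

definition Eset :: "nat \<Rightarrow> nat \<Rightarrow> nat list \<times> nat list \<Rightarrow> nat list set" where
  "Eset d n ik =
    (if fst ik = [] then to_tuple n n id ` chain_fam d n 1
     else (let N = n - weight ik + 1 in
       to_tuple n N (vtilde n ik) `
         (chain_fam d N 2 \<union>
          {e. \<exists>a b. 1 \<le> a \<and> a < d \<and> b < d \<and>
                 e = (\<lambda>j. if j = 1 then a else if j = 2 then b else 0)})))"

definition Sidx :: "nat \<Rightarrow> nat \<Rightarrow> ((nat list \<times> nat list) \<times> nat list) set" where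
  "Sidx d n = {(ik, r). ik \<in> Tn n \<and> r \<in> Eset d n ik}"

definition Svec :: "nat \<Rightarrow> (nat list \<times> nat list) \<times> nat list \<Rightarrow> elt" where
  "Svec n x = (case x of (ik, r) \<Rightarrow> mono (tword n r @ gword ik))"

end

theory Submission
  imports Defs "HOL-Library.Multiset" "HOL-Library.FuncSet" "HOL-Computational_Algebra.Polynomial"
begin

text \<open>The commuting \<open>t\<close>'s decompose the algebra by their joint eigenvalues
  \<open>\<chi>\<close>, with idempotents \<open>E\<^sub>\<chi>\<close>. Sandwiching the
  Temperley--Lieb relation between two copies of \<open>E\<^sub>\<chi>\<close> gives
  \<open>E\<^sub>\<chi> = 0\<close> when \<open>\<chi>\<close> takes three values, and
  \<open>E\<^sub>\<chi> g\<^sub>i = - E\<^sub>\<chi>\<close> when \<open>\<chi>\<close> is not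
  constant and agrees at \<open>i\<close> and \<open>i + 1\<close>. Hence, modulo shorter words,
  \<open>E\<^sub>\<chi> g\<^sub>w\<close> is needed for a normal form word \<open>w\<close> only if
  \<open>\<chi>\<close> is constant or is a two-colouring for which every letter of \<open>w\<close>
  exchanges two different colours. The proper colourings of \<open>w\<close> are obtained by
  colouring the blocks of \<open>w\<close> independently, and the monomials of the exponent set of
  \<open>w\<close> form a basis of the functions on these points: this gives spanning.

   Conversely, for two eigenvalues \<open>\<alpha>, \<beta>\<close> the algebra acts on functions of
  two-coloured states, the \<open>g\<^sub>i\<close> acting by the Hecke action on tensor space with
  parameter \<open>u\<close> if \<open>\<alpha> = \<beta>\<close> and \<open>1\<close> otherwise. A
  proper two-colouring \<open>y\<close> of \<open>w\<close> is moved by \<open>w\<close> to a state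
  that no other normal form word of at most the same length reaches from \<open>y\<close>; so these
  matrix coefficients are triangular with respect to the length, and linear independence follows
  from that of the monomials.\<close>

subsection \<open>Two-coloured states and words of transpositions\<close>

text \<open>Both halves rest on one statement: the monomials of the exponent set of a word satisfy
  no nontrivial relation on the points given by its proper two-colourings. Over the Laurent ring
  this yields independence. Over the complex numbers, where division is possible, it combines with
  the count of the points and yields interpolation; the coefficients that isolate one idempotent are
  thus complex constants, and the lack of division in the ground ring does no harm. The obstacle to
  independence is that a letter acts by a swap plus a multiple of the identity, so different words
  may share matrix coefficients. The number of second colours among the first s positions separates
  them: only the letter s changes it, by at most one, and along a normal form with a proper
  colouring all changes at s have the same sign. A word that reaches the same state must contain
  every letter at least as often.\<close>

definition flip :: "nat \<Rightarrow> (nat \<Rightarrow> 'c) \<Rightarrow> nat \<Rightarrow> 'c" where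
  "flip a y = (\<lambda>s. y (sw a s))"

lemma flip_apply:
  "flip a y s = (if s = a then y (Suc a) else if s = Suc a then y a else y s)"
  by (simp add: flip_def sw_def)

text \<open>Letters act from left to right. The colours have an arbitrary type because the same
  action serves two-coloured states and the joint eigenvalues of the t_j.\<close>

primrec run :: "(nat \<Rightarrow> 'c) \<Rightarrow> nat list \<Rightarrow> nat \<Rightarrow> 'c" where
  "run y [] = y"
| "run y (a # w) = run (flip a y) w"

primrec proper :: "(nat \<Rightarrow> 'c) \<Rightarrow> nat list \<Rightarrow> bool" where
  "proper y [] = True"
| "proper y (a # w) = (y a \<noteq> y (Suc a) \<and> proper (flip a y) w)"

lemma run_append: "run y (u @ v) = run (run y u) v"
  by (induction u arbitrary: y) auto

lemma proper_append: "proper y (u @ v) \<longleftrightarrow> proper y u \<and> proper (run y u) v"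
  by (induction u arbitrary: y) auto

lemma flip_flip [simp]: "flip a (flip a y) = y"
  by (auto simp: flip_apply fun_eq_iff)

lemma flip_same: "y a = y (Suc a) \<Longrightarrow> flip a y = y"
  by (auto simp: flip_apply fun_eq_iff)

lemma upt_rev_Suc: "b \<le> i \<Longrightarrow> rev [b..<Suc i] = i # rev [b..<i]"
  by simp

text \<open>The first letter of a descending run brings the colour at its far end one step down, and
  the remaining run carries that same colour on to \<open>b\<close>; so one colour travels and those
  it passes shift up.\<close>

lemma run_cycle:
  assumes "b \<le> i"
  shows "run y (rev [b..<Suc i]) =
    (\<lambda>s. if s = b then y (Suc i) else if b < s \<and> s \<le> Suc i then y (s - 1) else y s)"
  using assms
proof (induction i arbitrary: y rule: dec_induct)
  case base
  then show ?case by (auto simp: flip_apply fun_eq_iff)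
next
  case (step i)
  have "run y (rev [b..<Suc (Suc i)]) = run (flip (Suc i) y) (rev [b..<Suc i])"
    using step.hyps by (subst upt_rev_Suc) auto
  also have "\<dots> = (\<lambda>s. if s = b then (flip (Suc i) y) (Suc i)
      else if b < s \<and> s \<le> Suc i then (flip (Suc i) y) (s - 1) else (flip (Suc i) y) s)"
    by (rule step.IH)
  also have "\<dots> = (\<lambda>s. if s = b then y (Suc (Suc i))
      else if b < s \<and> s \<le> Suc (Suc i) then y (s - 1) else y s)"
    using step.hyps by (auto simp: flip_apply fun_eq_iff)
  finally show ?case .
qed

text \<open>The travelling colour meets each position of \<open>b..i\<close> once, so it is compared
  with all of them, and they are never compared among themselves.\<close>

lemma proper_cycle:
  assumes "b \<le> i"
  shows "proper y (rev [b..<Suc i]) \<longleftrightarrow> (\<forall>s\<in>{b..i}. y s \<noteq> y (Suc i))"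
  using assms
proof (induction i arbitrary: y rule: dec_induct)
  case base
  then show ?case by auto
next
  case (step i)
  have "proper y (rev [b..<Suc (Suc i)]) \<longleftrightarrow>
     y (Suc i) \<noteq> y (Suc (Suc i)) \<and> proper (flip (Suc i) y) (rev [b..<Suc i])"
    using step.hyps by (subst upt_rev_Suc) auto
  also have "\<dots> \<longleftrightarrow> y (Suc i) \<noteq> y (Suc (Suc i)) \<and>
     (\<forall>s\<in>{b..i}. (flip (Suc i) y) s \<noteq> (flip (Suc i) y) (Suc i))"
    by (simp only: step.IH)
  also have "\<dots> \<longleftrightarrow> (\<forall>s\<in>{b..Suc i}. y s \<noteq> y (Suc (Suc i)))"
    using step.hyps by (auto simp: flip_apply atLeastAtMostSuc_conv)
  finally show ?case .
qed

section \<open>Heights: counting the second colour on initial segments\<close>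

definition height :: "(nat \<Rightarrow> bool) \<Rightarrow> nat \<Rightarrow> int" where
  "height y s = (\<Sum>j = 1..s. of_bool (y j))"

lemma height_0 [simp]: "height y 0 = 0"
  by (simp add: height_def)

lemma height_Suc [simp]: "height y (Suc s) = height y s + of_bool (y (Suc s))"
  by (simp add: height_def)

lemma height_cong: "(\<And>j. 1 \<le> j \<Longrightarrow> j \<le> s \<Longrightarrow> y j = z j)
    \<Longrightarrow> height y s = height z s"
  unfolding height_def by (rule sum.cong) auto

text \<open>A transposition of \<open>a\<close> and \<open>Suc a\<close> permutes every initial
  segment within itself except the one that ends at \<open>a\<close>; so the letter \<open>a\<close>
  is visible only in the height at \<open>a\<close>.\<close>

lemma height_flip:
  assumes "1 \<le> a"
  shows "height (flip a y) s =
    height y s + (if s = a then of_bool (y (Suc a)) - of_bool (y a) else 0)"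
proof (induction s)
  case 0
  then show ?case using assms by simp
next
  case (Suc s)
  have *: "height (flip a y) s = height y s" if "s < a"
    using that by (intro height_cong) (auto simp: flip_apply)
  have f: "flip a y (Suc s) =
      (if Suc s = a then y (Suc a) else if s = a then y a else y (Suc s))"
    by (simp add: flip_apply)
  consider "Suc s < a" | "Suc s = a" | "s = a" | "s > a" by linarith
  then show ?case
    unfolding height_Suc f using Suc by cases (use * in auto)
qed

lemma height_cycle:
  assumes "1 \<le> b" "b \<le> i"
  shows "height (run y (rev [b..<Suc i])) s =
    height y s + (if b \<le> s \<and> s \<le> i then of_bool (y (Suc i)) - of_bool (y s) else 0)"
proof (induction s)
  case 0
  then show ?case using assms by simp
next
  case (Suc s)
  consider "Suc s < b" | "Suc s = b" | "b \<le> s" "s < i" | "s = i" | "s > i" by linarith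
  then show ?case
    using Suc assms unfolding height_Suc run_cycle[OF assms(2)] by cases auto
qed

subsection \<open>Jones normal forms\<close>

text \<open>A pair \<open>(b, i)\<close> stands for the descending run \<open>i, i - 1, \<dots>,
    b\<close>; so \<open>b\<close> is the
  number \<open>i\<^sub>j - k\<^sub>j\<close> of the index set.\<close>

definition nfword :: "(nat \<times> nat) list \<Rightarrow> nat list" where
  "nfword cs = concat (map (\<lambda>(b, i). rev [b..<Suc i]) cs)"

definition nf :: "(nat \<times> nat) list \<Rightarrow> bool" where
  "nf cs \<longleftrightarrow> sorted_wrt (\<lambda>(b, i) (b', i'). b < b' \<and> i < i') cs \<and>
      (\<forall>(b, i)\<in>set cs. 1 \<le> b \<and> b \<le> i)"

definition letters :: "(nat \<times> nat) list \<Rightarrow> nat set" where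
  "letters cs = (\<Union>(b, i)\<in>set cs. {b..i})"

text \<open>The positions whose colour is carried to the left. In a normal form tops and bottoms
  increase together, so the colour at \<open>Suc i\<close> is still in place when its run starts and
  rests at \<open>b\<close> afterwards.\<close>

definition exc :: "(nat \<times> nat) list \<Rightarrow> nat \<Rightarrow> bool" where
  "exc cs s \<longleftrightarrow> s \<in> Suc ` snd ` set cs"

lemma nf_Nil [simp]: "nf []"
  by (simp add: nf_def)

lemma nf_Cons: "nf ((b, i) # cs) \<longleftrightarrow>
    1 \<le> b \<and> b \<le> i \<and> (\<forall>(b', i')\<in>set cs. b < b' \<and> i < i') \<and> nf cs"
  by (auto simp: nf_def)

lemma nfword_Nil [simp]: "nfword [] = []"
  by (simp add: nfword_def)

lemma nfword_Cons: "nfword ((b, i) # cs) = rev [b..<Suc i] @ nfword cs"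
  by (simp add: nfword_def)

lemma letters_Nil [simp]: "letters [] = {}"
  by (simp add: letters_def)

lemma letters_Cons: "letters ((b, i) # cs) = {b..i} \<union> letters cs"
  by (simp add: letters_def)

lemma exc_Nil [simp]: "exc [] s = False"
  by (simp add: exc_def)

lemma exc_Cons: "exc ((b, i) # cs) s \<longleftrightarrow> s = Suc i \<or> exc cs s"
  by (auto simp: exc_def)

lemma finite_letters [simp]: "finite (letters cs)"
  by (auto simp: letters_def)

lemma set_nfword: "set (nfword cs) = letters cs"
  by (induction cs) (auto simp: nfword_Cons letters_Cons)

lemma letters_pos: "nf cs \<Longrightarrow> s \<in> letters cs \<Longrightarrow> 1 \<le> s"
  by (fastforce simp: nf_def letters_def)

lemma exc_predecessor: "nf cs \<Longrightarrow> exc cs s \<Longrightarrow> s - 1 \<in> letters cs \<and> 1 < s"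
  by (fastforce simp: nf_def exc_def letters_def)

text \<open>A left-moving colour must differ from everything it passes, and what it passes is
  right-moving. So on each stretch of consecutive letters a proper colouring follows
  \<open>exc\<close> or its negation, one binary choice per stretch.\<close>

theorem proper_nfword_iff:
  fixes y :: "nat \<Rightarrow> bool"
  assumes "nf cs"
  shows "proper y (nfword cs) \<longleftrightarrow>
    (\<forall>s\<in>letters cs. (y s = y (Suc s)) = (exc cs s = exc cs (Suc s)))"
  using assms
proof (induction cs arbitrary: y)
  case Nil
  then show ?case by simp
next
  case (Cons c cs)
  obtain b i where c: "c = (b, i)" by (cases c)
  have bi: "1 \<le> b" "b \<le> i" and nf: "nf cs"
    and gt: "\<And>b' i'. (b', i') \<in> set cs \<Longrightarrow> b < b' \<and> i < i'"
    using Cons.prems by (auto simp: c nf_Cons)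
  let ?y = "run y (rev [b..<Suc i])"
  have exc_gt: "Suc i < s" if "exc cs s" for s
    using that gt by (auto simp: exc_def)
  have letters_gt: "b < s" if "s \<in> letters cs" for s
    using that gt by (fastforce simp: letters_def)
  have first: "(\<forall>s\<in>{b..i}. y s \<noteq> y (Suc i)) \<longleftrightarrow>
    (\<forall>s\<in>{b..i}. (y s = y (Suc s)) = (exc (c # cs) s = exc (c # cs) (Suc s)))" (is "?L = ?R")
  proof
    assume L: ?L
    show ?R
    proof
      fix s assume s: "s \<in> {b..i}"
      have "\<not> exc (c # cs) s" using s exc_gt[of s] by (auto simp: c exc_Cons)
      moreover have "exc (c # cs) (Suc s) \<longleftrightarrow> s = i"
        using s exc_gt[of "Suc s"] by (auto simp: c exc_Cons)
      ultimately show "(y s = y (Suc s)) = (exc (c # cs) s = exc (c # cs) (Suc s))"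
        using L[rule_format, of s] L[rule_format, of "Suc s"] s by (cases "s = i") auto
    qed
  next
    assume R: ?R
    have e: "exc (c # cs) s \<longleftrightarrow> s = Suc i" if "s \<le> Suc i" for s
      using that exc_gt[of s] by (auto simp: c exc_Cons)
    \<comment> \<open>Descend from \<open>i\<close>: no position of \<open>b..i\<close> is in
      \<open>exc\<close>, so neighbouring colours there agree, and the colour at \<open>i\<close>
      differs from that at \<open>Suc i\<close>.\<close>
    have K: "y (i - k) \<noteq> y (Suc i)" if "k \<le> i - b" for k
      using that
    proof (induction k)
      case 0
      then show ?case using R[rule_format, of i] bi e[of i] e[of "Suc i"] by simp
    next
      case (Suc k)
      have "i - Suc k \<in> {b..i}" "Suc (i - Suc k) = i - k" using Suc.prems bi by auto
      with R[rule_format, of "i - Suc k"] have "(y (i - Suc k) = y (i - k)) =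
          (exc (c # cs) (i - Suc k) = exc (c # cs) (i - k))" by simp
      moreover have "\<not> exc (c # cs) (i - Suc k)" "\<not> exc (c # cs) (i - k)"
        using e[of "i - Suc k"] e[of "i - k"] by simp_all
      moreover have "y (i - k) \<noteq> y (Suc i)" using Suc.IH Suc.prems by simp
      ultimately show ?case by simp
    qed
    have "y s \<noteq> y (Suc i)" if "s \<in> {b..i}" for s
      using that K[of "i - s"] by (simp add: diff_le_mono2)
    then show ?L by blast
  qed
  \<comment> \<open>The first run shifts colours but keeps the conditions at later letters
    equivalent. Up to \<open>i\<close> all shifted colours differ from the travelling one, and both
    sides hold; at \<open>Suc i\<close> the shift puts the opposite colour while \<open>exc\<close>
    changes its value too, and the two changes cancel.\<close>
  have rest: "(?y s = ?y (Suc s)) = (exc cs s = exc cs (Suc s)) \<longleftrightarrow>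
     (y s = y (Suc s)) = (exc (c # cs) s = exc (c # cs) (Suc s))"
    if L: "\<forall>s\<in>{b..i}. y s \<noteq> y (Suc i)" and s: "s \<in> letters cs" for s
  proof -
    have bs: "b < s" "b \<le> s - Suc 0" using letters_gt[OF s] by auto
    consider "s < i" | "s = i" | "s = Suc i" | "Suc i < s" by linarith
    then show ?thesis
    proof cases
      case 1
      then have "\<not> exc cs s" "\<not> exc cs (Suc s)" using exc_gt[of s] exc_gt[of "Suc s"] by auto
      moreover have "y (s - Suc 0) \<noteq> y (Suc i)" "y s \<noteq> y (Suc i)" "y (Suc s) \<noteq> y (Suc i)"
        using L[rule_format, of "s - Suc 0"] L[rule_format, of s] L[rule_format, of "Suc s"] 1 bs by auto
      ultimately show ?thesis using 1 bs bi(2) unfolding run_cycle[OF bi(2)] by (auto simp: c exc_Cons)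
    next
      case 2
      then have "\<not> exc cs s" "\<not> exc cs (Suc s)" using exc_gt[of s] exc_gt[of "Suc s"] by auto
      moreover have "y (s - Suc 0) \<noteq> y (Suc i)" "y s \<noteq> y (Suc i)"
        using L[rule_format, of "s - Suc 0"] L[rule_format, of s] 2 bs by auto
      ultimately show ?thesis using 2 bs bi(2) unfolding run_cycle[OF bi(2)] by (auto simp: c exc_Cons)
    next
      case 3
      then have "\<not> exc cs s" using exc_gt[of s] by auto
      moreover have "y i \<noteq> y (Suc i)" using L bi by auto
      ultimately show ?thesis using 3 bs bi(2) unfolding run_cycle[OF bi(2)] by (auto simp: c exc_Cons)
    next
      case 4
      then show ?thesis using bs bi(2) unfolding run_cycle[OF bi(2)] by (auto simp: c exc_Cons)
    qed
  qed
  have "proper y (nfword (c # cs)) \<longleftrightarrow> (\<forall>s\<in>{b..i}. y s \<noteq> y (Suc i)) \<and>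
      (\<forall>s\<in>letters cs. (?y s = ?y (Suc s)) = (exc cs s = exc cs (Suc s)))"
    using Cons.IH[OF nf] bi(2) by (simp only: c nfword_Cons proper_append proper_cycle)
  also have "\<dots> \<longleftrightarrow> (\<forall>s\<in>{b..i}. y s \<noteq> y (Suc i)) \<and>
      (\<forall>s\<in>letters cs. (y s = y (Suc s)) = (exc (c # cs) s = exc (c # cs) (Suc s)))"
    using rest by (intro conj_cong ball_cong refl) simp_all
  also have "\<dots> \<longleftrightarrow> (\<forall>s\<in>letters (c # cs). (y s = y (Suc s)) = (exc (c
      # cs) s = exc (c # cs) (Suc s)))"
    unfolding first by (simp only: c letters_Cons ball_Un)
  finally show ?case .
qed

lemma count_cycle: "count (mset (rev [b..<Suc i])) s = of_bool (b \<le> s \<and> s \<le> i)"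
proof -
  have "\<forall>a. count (mset (rev [b..<Suc i])) a = (if a \<in> set (rev [b..<Suc i]) then 1 else 0)"
    by (subst distinct_count_atmost_1[symmetric]) (simp del: upt_Suc)
  then show ?thesis by (simp del: upt_Suc mset_rev add: less_Suc_eq_le)
qed

text \<open>Each occurrence of a letter \<open>s\<close> exchanges a left-moving with a right-moving
  colour, and properness fixes which of them is the second colour. So the contributions at
  \<open>s\<close> never cancel, and the displacement has the multiplicity of \<open>s\<close> as
  its absolute value.\<close>

lemma height_nfword:
  fixes y :: "nat \<Rightarrow> bool"
  assumes "nf cs" "proper y (nfword cs)"
  shows "height (run y (nfword cs)) s =
    height y s + (if y s = exc cs s then 1 else - 1) * int (count (mset (nfword cs)) s)"
  using assms
proof (induction cs arbitrary: y)
  case Nil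
  then show ?case by simp
next
  case (Cons c cs)
  obtain b i where c: "c = (b, i)" by (cases c)
  have bi: "1 \<le> b" "b \<le> i" and nf: "nf cs"
    and gt: "\<And>b' i'. (b', i') \<in> set cs \<Longrightarrow> b < b' \<and> i < i'"
    using Cons.prems by (auto simp: c nf_Cons)
  let ?y = "run y (rev [b..<Suc i])"
  have exc_gt: "Suc i < s" if "exc cs s" for s
    using that gt by (auto simp: exc_def)
  have letters_gt: "b < s" if "s \<in> letters cs" for s
    using that gt by (fastforce simp: letters_def)
  have pr: "\<forall>s\<in>{b..i}. y s \<noteq> y (Suc i)" "proper ?y (nfword cs)"
    using Cons.prems(2) bi by (auto simp only: c nfword_Cons proper_append proper_cycle)
  have yeq: "(?y s = exc cs s) = (y s = exc (c # cs) s)" if "s \<in> letters cs"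
  proof -
    have bs: "b < s" "b \<le> s - Suc 0" using letters_gt[OF that] by auto
    consider "s \<le> i" | "s = Suc i" | "Suc i < s" by linarith
    then show ?thesis
    proof cases
      case 1
      then have "y (s - Suc 0) \<noteq> y (Suc i)" "y s \<noteq> y (Suc i)" using pr(1)[rule_format, of
          "s - Suc 0"] pr(1)[rule_format, of s] bs by auto
      then show ?thesis using 1 bs bi unfolding run_cycle[OF bi(2)] by (auto simp: c exc_Cons)
    next
      case 2
      moreover have "y i \<noteq> y (Suc i)" using pr(1) bi by auto
      ultimately show ?thesis using bs bi exc_gt[of s] unfolding run_cycle[OF bi(2)] by (auto simp: c exc_Cons)
    next
      case 3
      then show ?thesis using bs bi unfolding run_cycle[OF bi(2)] by (auto simp: c exc_Cons)
    qed
  qed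
  have cnt0: "count (mset (nfword cs)) s = 0" if "s \<notin> letters cs"
    using that set_nfword[of cs] by (metis count_mset_0_iff)
  have cyc: "(if b \<le> s \<and> s \<le> i then of_bool (y (Suc i)) - of_bool (y s) else 0) =
      (if y s = exc (c # cs) s then 1 else - 1) * int (of_bool (b \<le> s \<and> s \<le> i))"
  proof (cases "b \<le> s \<and> s \<le> i")
    case True
    then have "y s \<noteq> y (Suc i)" "\<not> exc (c # cs) s"
      using pr(1) exc_gt[of s] by (auto simp: c exc_Cons)
    then show ?thesis using True by auto
  qed simp
  have "height (run y (nfword (c # cs))) s = height ?y s +
      (if ?y s = exc cs s then 1 else - 1) * int (count (mset (nfword cs)) s)"
    using Cons.IH[OF nf pr(2)] by (simp only: c nfword_Cons run_append)
  also have "(if ?y s = exc cs s then 1 else - 1) * int (count (mset (nfword cs)) s) =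
      (if y s = exc (c # cs) s then 1 else - 1) * int (count (mset (nfword cs)) s)"
    using yeq cnt0 by (cases "s \<in> letters cs") auto
  also have "height ?y s = height y s +
      (if y s = exc (c # cs) s then 1 else - 1) * int (of_bool (b \<le> s \<and> s \<le> i))"
    unfolding height_cycle[OF bi] cyc ..
  finally show ?case
    by (simp only: c nfword_Cons mset_append count_union count_cycle of_nat_add
        distrib_left add.assoc)
qed

text \<open>The paths that contribute to a matrix coefficient of a word.\<close>

inductive reach :: "(nat \<Rightarrow> bool) \<Rightarrow> nat list \<Rightarrow> (nat \<Rightarrow>
    bool) \<Rightarrow> bool" where
  reach_Nil: "reach y [] y"
| reach_swap: "reach (flip a y) w x \<Longrightarrow> reach y (a # w) x"
| reach_stay: "reach y w x \<Longrightarrow> reach y (a # w) x"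

text \<open>A swap at \<open>a\<close> changes only the height at \<open>a\<close>, by at most one,
  and a stay changes nothing. The letter zero is excluded because heights count from position
  one.\<close>

lemma height_reach_le:
  assumes "reach y w x" "0 \<notin> set w"
  shows "\<bar>height x s - height y s\<bar> \<le> int (count (mset w) s)"
  using assms
proof induction
  case (reach_swap a y w x)
  then have "1 \<le> a" by (auto simp: Suc_le_eq)
  then have "height (flip a y) s =
      height y s + (if s = a then of_bool (y (Suc a)) - of_bool (y a) else 0)"
    by (rule height_flip)
  moreover have "\<bar>height x s - height (flip a y) s\<bar> \<le> int (count (mset w) s)"
    using reach_swap by simp
  ultimately show ?case
    by (cases "s = a") (auto simp: of_bool_def split: if_splits)
qed auto

text \<open>A skipped letter, or a swap of two equal colours, leaves the height at that letter one
  step short; equality everywhere therefore forces every letter to swap distinct colours.\<close>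

lemma reach_extremal:
  assumes "reach y w x" "0 \<notin> set w" "\<forall>s. \<bar>height x s - height y s\<bar> = int (count
      (mset w) s)"
  shows "proper y w \<and> x = run y w"
  using assms
proof induction
  case (reach_Nil y)
  show ?case by simp
next
  case (reach_swap a y w x)
  then have a: "1 \<le> a" and w: "0 \<notin> set w" by (auto simp: Suc_le_eq)
  have le: "\<bar>height x s - height (flip a y) s\<bar> \<le> int (count (mset w) s)" for s
    by (rule height_reach_le[OF reach_swap.hyps w])
  have eq: "\<bar>height x s - height y s\<bar> = int (count (mset (a # w)) s)" for s
    using reach_swap.prems(2) by blast
  have ne: "y a \<noteq> y (Suc a)"
  proof
    assume "y a = y (Suc a)"
    then have "flip a y = y" by (rule flip_same)
    then show False using le[of a] eq[of a] by simp
  qed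
  have "\<bar>height x s - height (flip a y) s\<bar> = int (count (mset w) s)" for s
    using le[of s] eq[of s] height_flip[OF a, of y s]
    by (cases "s = a") (auto simp: of_bool_def split: if_splits)
  then have "proper (flip a y) w \<and> x = run (flip a y) w"
    by (intro reach_swap.IH[OF w]) blast
  then show ?case using ne by simp
next
  case (reach_stay y w x a)
  then have "\<bar>height x a - height y a\<bar> \<le> int (count (mset w) a)"
    using height_reach_le[of y w x a] by auto
  moreover have "\<bar>height x a - height y a\<bar> = int (count (mset (a # w)) a)"
    using reach_stay.prems(2) by blast
  ultimately show ?case by simp
qed

section \<open>Recovering a normal form from its letters\<close>

lemma count_nfword:
  "count (mset (nfword cs)) s = length (filter (\<lambda>(b, i). b \<le> s \<and> s \<le> i) cs)"
proof (induction cs)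
  case (Cons c cs)
  obtain b i where c: "c = (b, i)" by (cases c)
  have "count (mset (nfword (c # cs))) s = of_bool (b \<le> s \<and> s \<le> i) + count (mset (nfword cs)) s"
    by (simp only: c nfword_Cons mset_append count_union count_cycle)
  then show ?case using Cons by (simp add: c)
qed simp

lemma nf_distinct:
  assumes "nf cs"
  shows "distinct (map fst cs)" "distinct (map snd cs)"
    "sorted_wrt (<) (map fst cs)" "sorted_wrt (<) (map snd cs)"
proof -
  have s: "sorted_wrt (\<lambda>(b, i) (b', i'). b < b' \<and> i < i') cs"
    using assms by (simp add: nf_def)
  show "sorted_wrt (<) (map fst cs)" "sorted_wrt (<) (map snd cs)"
    unfolding sorted_wrt_map by (rule sorted_wrt_mono_rel[OF _ s]; force)+
  then show "distinct (map fst cs)" "distinct (map snd cs)"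
    using strict_sorted_iff by blast+
qed

lemma strict_sorted_list_eqI:
  fixes xs ys :: "nat list"
  assumes "sorted_wrt (<) xs" "sorted_wrt (<) ys" "set xs = set ys"
  shows "xs = ys"
  using assms by (simp add: strict_sorted_equal)

text \<open>The tops are read off from \<open>exc\<close>. The number of bottoms up to
  \<open>s\<close> is the number of runs containing \<open>s\<close> plus the number of tops below
  \<open>s\<close>, so it is determined too, and the bottoms are the places where this counting
  function jumps.\<close>

lemma nf_eqI:
  assumes "nf cs" "nf ds" and e: "\<And>s. exc cs s = exc ds s"
    and c: "\<And>s. count (mset (nfword cs)) s = count (mset (nfword ds)) s"
  shows "cs = ds"
proof -
  have "Suc ` set (map snd cs) = Suc ` set (map snd ds)"
    using e unfolding exc_def set_map by (rule set_eqI)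
  then have "set (map snd cs) = set (map snd ds)" by (simp add: inj_image_eq_iff)
  then have snd: "map snd cs = map snd ds"
    using nf_distinct assms by (intro strict_sorted_list_eqI) auto
  have low: "length (filter (\<lambda>b. b \<le> s) (map fst xs)) =
      count (mset (nfword xs)) s + length (filter (\<lambda>i. i < s) (map snd xs))" if "nf xs" for xs s
    using that by (induction xs) (auto simp: count_nfword nf_Cons)
  have len: "length (filter (\<lambda>b. b \<le> s) (map fst cs)) = length (filter (\<lambda>b. b \<le>
      s) (map fst ds))" for s
    unfolding low[OF assms(1)] low[OF assms(2)] snd c ..
  have mem: "b \<in> set (map fst xs) \<longleftrightarrow> length (filter (\<lambda>a. a \<le> b) (map
      fst xs)) \<noteq>
      length (filter (\<lambda>a. a \<le> b - 1) (map fst xs))" if "nf xs" "1 \<le> b" for xs b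
  proof -
    have d: "distinct (map fst xs)" using nf_distinct that by blast
    have l: "length (filter P (map fst xs)) = card {a \<in> set (map fst xs). P a}" for P
      using distinct_card[of "filter P (map fst xs)"] d by simp
    show ?thesis
    proof
      assume b: "b \<in> set (map fst xs)"
      have "{a \<in> set (map fst xs). a \<le> b - 1} \<subset> {a \<in> set (map fst xs). a \<le> b}"
        using b \<open>1 \<le> b\<close> by force
      then have "card {a \<in> set (map fst xs). a \<le> b - 1} < card {a \<in> set (map fst xs). a \<le> b}"
        by (intro psubset_card_mono) auto
      then show "length (filter (\<lambda>a. a \<le> b) (map fst xs)) \<noteq>
        length (filter (\<lambda>a. a \<le> b - 1) (map fst xs))" unfolding l by simp
    next
      assume ne: "length (filter (\<lambda>a. a \<le> b) (map fst xs)) \<noteq>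
        length (filter (\<lambda>a. a \<le> b - 1) (map fst xs))"
      show "b \<in> set (map fst xs)"
      proof (rule ccontr)
        assume "b \<notin> set (map fst xs)"
        then have "{a \<in> set (map fst xs). a \<le> b} = {a \<in> set (map fst xs). a \<le> b - 1}"
        proof (intro Collect_cong conj_cong refl)
          fix a assume "a \<in> set (map fst xs)"
          then have "a \<noteq> b" using \<open>b \<notin> _\<close> by metis
          then show "(a \<le> b) = (a \<le> b - 1)" using that(2) by linarith
        qed
        then show False using ne unfolding l by simp
      qed
    qed
  qed
  have pos: "1 \<le> b" if "nf xs" "b \<in> set (map fst xs)" for xs b
    using that by (fastforce simp: nf_def)
  have "set (map fst cs) = set (map fst ds)"
  proof (rule set_eqI)
    fix b
    show "b \<in> set (map fst cs) \<longleftrightarrow> b \<in> set (map fst ds)"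
    proof (cases "1 \<le> b")
      case True
      then show ?thesis by (simp only: mem[OF assms(1) True] mem[OF assms(2) True] len)
    next
      case False
      then show ?thesis using pos[OF assms(1)] pos[OF assms(2)] by blast
    qed
  qed
  then have "map fst cs = map fst ds"
    using nf_distinct assms by (intro strict_sorted_list_eqI) auto
  with snd show ?thesis by (metis zip_map_fst_snd)
qed

text \<open>The end state of \<open>cs\<close> displaces the height at \<open>s\<close> by the full
  multiplicity of \<open>s\<close>. A path along \<open>ds\<close> achieves this only if
  \<open>ds\<close> has every letter at least as often; the length bound then forces equal
  multisets, the path is extremal, and \<open>ds\<close> is proper for the same colouring.\<close>

theorem nf_unique:
  assumes cs: "nf cs" "proper y (nfword cs)"
    and ds: "nf ds" "reach y (nfword ds) (run y (nfword cs))"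
    and len: "length (nfword ds) \<le> length (nfword cs)"
  shows "ds = cs"
proof -
  let ?x = "run y (nfword cs)"
  have pos: "0 \<notin> set (nfword xs)" if "nf xs" for xs
    using letters_pos[OF that] by (force simp: set_nfword)
  have h: "\<bar>height ?x s - height y s\<bar> = int (count (mset (nfword cs)) s)" for s
    using height_nfword[OF cs, of s] by auto
  have "mset (nfword cs) \<subseteq># mset (nfword ds)"
    using height_reach_le[OF ds(2) pos[OF ds(1)]] h by (auto intro!: mset_subset_eqI)
  then have "mset (nfword cs) = mset (nfword ds)"
    using len by (metis mset_subset_size not_less size_mset subset_mset.le_neq_trans)
  then have c: "count (mset (nfword cs)) s = count (mset (nfword ds)) s" for s by simp
  then have prd: "proper y (nfword ds)"
    using reach_extremal[OF ds(2) pos[OF ds(1)]] h by auto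
  have lt: "letters cs = letters ds"
    using \<open>mset (nfword cs) = mset (nfword ds)\<close> set_nfword by (metis mset_eq_setD)
  \<comment> \<open>Propagate from left to right: at a letter the common colouring decides whether
    \<open>exc\<close> changes, and after a non-letter \<open>exc\<close> is false for both.\<close>
  have "exc cs s = exc ds s" for s
  proof (induction s)
    case 0
    then show ?case by (auto simp: exc_def)
  next
    case (Suc s)
    show ?case
    proof (cases "s \<in> letters cs")
      case True
      then show ?thesis
        using cs(2) prd Suc lt unfolding proper_nfword_iff[OF cs(1)] proper_nfword_iff[OF ds(1)]
        by blast
    next
      case False
      then show ?thesis
        using exc_predecessor[OF cs(1), of "Suc s"] exc_predecessor[OF ds(1), of "Suc s"] lt by auto
    qed
  qed
  then show ?thesis using nf_eqI[OF ds(1) cs(1)] c by simp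
qed

subsection \<open>Proper colourings of a normal form\<close>

text \<open>A block is a maximal interval of letters together with the position after it; a
  non-letter that follows no letter is a block of its own. The end is the only non-letter of its
  block and serves as its representative.\<close>

definition block_end :: "(nat \<times> nat) list \<Rightarrow> nat \<Rightarrow> nat" where
  "block_end cs s = (LEAST e. s \<le> e \<and> e \<notin> letters cs)"

lemma block_end: "s \<le> block_end cs s" "block_end cs s \<notin> letters cs"
proof -
  have "\<exists>e. s \<le> e \<and> e \<notin> letters cs"
    using finite_letters[of cs] by (meson finite_nat_set_iff_bounded_le nat_le_linear not_less_eq_eq)
  from LeastI_ex[OF this] show "s \<le> block_end cs s" "block_end cs s \<notin> letters cs"
    unfolding block_end_def by auto
qed

lemma block_end_le: "s \<le> (e::nat) \<Longrightarrow> e \<notin> letters cs \<Longrightarrow> block_end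
    cs s \<le> e"
  unfolding block_end_def by (rule Least_le) auto

lemma block_end_self: "s \<notin> letters cs \<Longrightarrow> block_end cs s = s"
  using block_end(1)[of s cs] block_end_le[of s s cs] by auto

lemma block_end_Suc: "s \<in> letters cs \<Longrightarrow> block_end cs s = block_end cs (Suc s)"
proof -
  assume s: "s \<in> letters cs"
  have "Suc s \<le> block_end cs s" using block_end(1)[of s cs] block_end(2)[of cs s] s by (metis
      le_neq_implies_less Suc_leI)
  then show ?thesis
    using block_end_le[of "Suc s" "block_end cs s" cs] block_end_le[of s "block_end cs (Suc s)" cs]
      block_end(1)[of s cs] block_end(1)[of "Suc s" cs]
      block_end(2)[of cs s] block_end(2)[of cs "Suc s"] by force
qed

text \<open>The set \<open>V\<close> holds the block ends that receive the second colour; inside a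
  block the colour changes exactly where \<open>exc\<close> does.\<close>

definition colouring :: "(nat \<times> nat) list \<Rightarrow> nat set \<Rightarrow> nat \<Rightarrow>
    bool" where
  "colouring cs V s \<longleftrightarrow> (block_end cs s \<in> V) = (exc cs s = exc cs (block_end cs s))"

lemma proper_colouring: "nf cs \<Longrightarrow> proper (colouring cs V) (nfword cs)"
  by (subst proper_nfword_iff) (auto simp: colouring_def block_end_Suc)

lemma colouring_end: "s \<notin> letters cs \<Longrightarrow> colouring cs V s \<longleftrightarrow> s \<in> V"
  by (simp add: colouring_def block_end_self)

text \<open>Going left from the block end, each letter ties the colour at \<open>s\<close> to that
  at \<open>Suc s\<close>, so the colours of the ends determine all others.\<close>

lemma proper_eq_colouring:
  assumes "nf cs" "proper y (nfword cs)"
  shows "y s = colouring cs {e. y e} s"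
proof (induction "block_end cs s - s" arbitrary: s)
  case 0
  then have "block_end cs s = s" using block_end(1)[of s cs] by simp
  then show ?case by (simp add: colouring_def)
next
  case (Suc k)
  then have s: "s \<in> letters cs" using block_end_self by force
  have "y (Suc s) = colouring cs {e. y e} (Suc s)"
    using Suc block_end_Suc[OF s] by (intro Suc) auto
  moreover have "(y s = y (Suc s)) = (exc cs s = exc cs (Suc s))"
    using assms s proper_nfword_iff by blast
  ultimately show ?case
    using block_end_Suc[OF s] by (auto simp: colouring_def)
qed

subsection \<open>The index set as normal forms\<close>

definition cyc :: "nat list \<times> nat list \<Rightarrow> (nat \<times> nat) list" where
  "cyc ik = (case ik of (is, ks) \<Rightarrow> zip (map2 (-) is ks) is)"

lemma length_cyc: "ik \<in> Tn n \<Longrightarrow> length (cyc ik) = length (fst ik)"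
  by (auto simp: cyc_def Tn_def)

lemma nth_cyc:
  "(is, ks) \<in> Tn n \<Longrightarrow> j < length is \<Longrightarrow> cyc (is, ks) ! j = (is ! j - ks
      ! j, is ! j)"
  by (auto simp: cyc_def Tn_def)

lemma cyc_eq_Nil: "ik \<in> Tn n \<Longrightarrow> cyc ik = [] \<longleftrightarrow> fst ik = []"
  using length_cyc by fastforce

lemma map_snd_cyc: "(is, ks) \<in> Tn n \<Longrightarrow> map snd (cyc (is, ks)) = is"
  by (auto simp: cyc_def Tn_def)

lemma nf_cyc:
  assumes "ik \<in> Tn n"
  shows "nf (cyc ik)" "letters (cyc ik) \<subseteq> {1..n - 1}"
proof -
  obtain "is" ks where ik: "ik = (is, ks)" by (cases ik)
  have T: "length is = length ks" "sorted_wrt (<) is" "sorted_wrt (<) (map2 (-) is ks)"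
    "\<And>j. j < length is \<Longrightarrow> 1 \<le> is ! j \<and> is ! j \<le> n - 1 \<and> ks ! j < is ! j"
    using assms by (auto simp: ik Tn_def)
  have len: "length (cyc ik) = length is" using length_cyc[OF assms] ik by simp
  have nth: "cyc ik ! j = (is ! j - ks ! j, is ! j)" if "j < length is" for j
    using nth_cyc assms that by (simp add: ik)
  show "nf (cyc ik)"
    unfolding nf_def
  proof
    show "sorted_wrt (\<lambda>(b, i) (b', i'). b < b' \<and> i < i') (cyc ik)"
      using T(1-3) by (auto simp: sorted_wrt_iff_nth_less len nth)
    show "\<forall>(b, i)\<in>set (cyc ik). 1 \<le> b \<and> b \<le> i"
      using T(4) by (fastforce simp: in_set_conv_nth len nth)
  qed
  show "letters (cyc ik) \<subseteq> {1..n - 1}"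
    using T(4) by (fastforce simp: letters_def in_set_conv_nth len nth)
qed

lemma letters_cyc: "ik \<in> Tn n \<Longrightarrow> letters (cyc ik) = Iset ik"
proof -
  assume T: "ik \<in> Tn n"
  obtain "is" ks where ik: "ik = (is, ks)" by (cases ik)
  have "set (cyc ik) = (\<lambda>j. cyc ik ! j) ` {..<length (cyc ik)}"
    by (auto simp: set_conv_nth)
  then have "letters (cyc ik) = (\<Union>j<length (cyc ik). case cyc ik ! j of (b, i) \<Rightarrow> {b..i})"
    unfolding letters_def by (simp only: image_image)
  also have "\<dots> = Iset ik"
    using T length_cyc[OF T] nth_cyc[of "is" ks n] by (auto simp: ik Iset_def)
  finally show ?thesis .
qed

lemma gword_cyc: "ik \<in> Tn n \<Longrightarrow> gword ik = map G (nfword (cyc ik))"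
proof -
  assume T: "ik \<in> Tn n"
  obtain "is" ks where ik: "ik = (is, ks)" by (cases ik)
  have "map (\<lambda>j. map G (rev [is ! j - ks ! j ..< is ! j + 1])) [0..<length is] =
     map (map G \<circ> (\<lambda>(b, i). rev [b..<Suc i])) (cyc ik)"
    using T length_cyc[OF T] nth_cyc[of "is" ks n] by (intro nth_equalityI) (auto simp: ik)
  then show ?thesis
    by (simp add: gword_def nfword_def ik map_concat)
qed

lemma inj_on_cyc: "inj_on cyc (Tn n)"
proof (rule inj_on_inverseI)
  fix ik assume T: "ik \<in> Tn n"
  obtain "is" ks where ik: "ik = (is, ks)" by (cases ik)
  have "map (\<lambda>(b, i). i - b) (cyc ik) = ks"
  proof (rule nth_equalityI)
    show "length (map (\<lambda>(b, i). i - b) (cyc ik)) = length ks"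
      using T length_cyc[OF T] by (simp add: ik Tn_def)
    fix j assume "j < length (map (\<lambda>(b, i). i - b) (cyc ik))"
    then have j: "j < length is" using length_cyc[OF T] by (simp add: ik)
    \<comment> \<open>This keeps the subtraction from truncating, so that \<open>i - (i - k)\<close>
      is \<open>k\<close> again.\<close>
    moreover have "ks ! j < is ! j" using T j by (simp add: ik Tn_def)
    ultimately show "map (\<lambda>(b, i). i - b) (cyc ik) ! j = ks ! j"
      using T length_cyc[OF T] nth_cyc[of "is" ks n j] by (simp add: ik)
  qed
  then show "(\<lambda>cs. (map snd cs, map (\<lambda>(b, i). i - b) cs)) (cyc ik) = ik"
    using map_snd_cyc T by (simp add: ik)
qed

lemma cyc_surj:
  assumes "nf cs" "letters cs \<subseteq> {1..n - 1}"
  obtains ik where "ik \<in> Tn n" "cyc ik = cs"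
proof
  let ?ik = "(map snd cs, map (\<lambda>(b, i). i - b) cs)"
  have mem: "1 \<le> b \<and> b \<le> i \<and> i \<le> n - 1" if "(b, i) \<in> set cs" for b i
  proof -
    have "1 \<le> b" "b \<le> i" using assms(1) that by (auto simp: nf_def)
    then have "i \<in> letters cs" using that by (force simp: letters_def)
    then show ?thesis using assms(2) \<open>1 \<le> b\<close> \<open>b \<le> i\<close> by auto
  qed
  have "map2 (-) (map snd xs) (map (\<lambda>(b, i). i - b) xs) = map fst xs"
    if "\<And>b i. (b, i) \<in> set xs \<Longrightarrow> b \<le> i" for xs :: "(nat \<times> nat) list"
    using that by (induction xs) auto
  then have m2: "map2 (-) (map snd cs) (map (\<lambda>(b, i). i - b) cs) = map fst cs"
    using mem by blast
  show "?ik \<in> Tn n"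
    unfolding Tn_def mem_Collect_eq case_prod_conv m2
  proof (intro conjI allI impI)
    have "set (map snd cs) \<subseteq> {1..n - 1}" using mem by fastforce
    then have "card (set (map snd cs)) \<le> n - 1"
      using card_mono[of "{1..n - 1}"] by fastforce
    then show "length (map snd cs) \<le> n - 1"
      using nf_distinct(2)[OF assms(1)] by (metis distinct_card)
    fix j assume "j < length (map snd cs)"
    then have "(fst (cs ! j), snd (cs ! j)) \<in> set cs" by simp
    from mem[OF this] \<open>j < _\<close>
    show "1 \<le> map snd cs ! j" "map snd cs ! j \<le> n - 1"
      "map (\<lambda>(b, i). i - b) cs ! j < map snd cs ! j"
      by (auto simp: split_beta)
  qed (use nf_distinct[OF assms(1)] in auto)
  show "cyc ?ik = cs"
    unfolding cyc_def case_prod_conv m2 by (simp add: zip_map_fst_snd)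
qed

lemma finite_Tn: "finite (Tn n)"
proof -
  have "Tn n \<subseteq> {xs. set xs \<subseteq> {..n - 1} \<and> length xs \<le> n - 1} \<times> {xs.
      set xs \<subseteq> {..n - 1} \<and> length xs \<le> n - 1}"
  proof (clarify, intro conjI SigmaI CollectI)
    fix "is" ks assume T: "(is, ks) \<in> Tn n"
    show "set is \<subseteq> {..n - 1}" "length is \<le> n - 1" "length ks \<le> n - 1"
      using T by (auto simp: Tn_def in_set_conv_nth)
    have "ks ! j \<le> n - 1" if "j < length ks" for j
      using T that unfolding Tn_def by fastforce
    then show "set ks \<subseteq> {..n - 1}" by (auto simp: in_set_conv_nth)
  qed
  then show ?thesis
    by (rule finite_subset) (simp add: finite_lists_length_le)
qed

section \<open>Weights, block ends and the renamed variables\<close>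

lemma Iset_bounds:
  assumes "ik \<in> Tn n" "1 \<le> n"
  shows "Iset ik \<subseteq> {1..n - 1}" "weight ik \<le> n - 1" "weight ik = 0 \<longleftrightarrow> fst
      ik = []"
    "card ({1..n} - Iset ik) = n - weight ik"
proof -
  show sub: "Iset ik \<subseteq> {1..n - 1}"
    using nf_cyc(2)[OF assms(1)] letters_cyc[OF assms(1)] by simp
  then show "weight ik \<le> n - 1"
    unfolding weight_def using card_mono[of "{1..n - 1}" "Iset ik"] by simp
  have fin: "finite (Iset ik)" using sub by (rule finite_subset) simp
  have "Iset ik = {} \<longleftrightarrow> fst ik = []"
  proof -
    obtain "is" ks where ik: "ik = (is, ks)" by (cases ik)
    have "is ! 0 \<in> Iset ik" if "is \<noteq> []"
      using that unfolding ik Iset_def case_prod_conv by (intro UN_I[of 0]) auto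
    then show ?thesis by (auto simp: ik Iset_def)
  qed
  then show "weight ik = 0 \<longleftrightarrow> fst ik = []"
    unfolding weight_def using fin by simp
  have "Iset ik \<subseteq> {1..n}" by (rule order_trans[OF sub]) auto
  then show "card ({1..n} - Iset ik) = n - weight ik"
    unfolding weight_def using fin by (subst card_Diff_subset) auto
qed

text \<open>\<open>L1\<close> picks the first top whose successor is no letter, so the second
  renamed variable sits at the end of the block containing the first. The smallest top is not in
  \<open>exc\<close>, while the block end is one past a top: a proper colouring gives these two
  variables opposite colours.\<close>

lemma first_block_end:
  assumes T: "ik \<in> Tn n" and ne: "fst ik \<noteq> []"
  shows "fst ik ! (L1 ik - 1) + 1 = block_end (cyc ik) (fst ik ! 0)"
    "exc (cyc ik) (fst ik ! (L1 ik - 1) + 1)" "\<not> exc (cyc ik) (fst ik ! 0)"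
    "fst ik ! 0 \<in> Iset ik" "fst ik ! (L1 ik - 1) + 1 \<le> n"
proof -
  obtain "is" ks where ik: "ik = (is, ks)" by (cases ik)
  have T': "length is = length ks" "sorted_wrt (<) is"
    "\<And>j. j < length is \<Longrightarrow> 1 \<le> is ! j \<and> is ! j \<le> n - 1 \<and> ks ! j < is ! j"
    using T by (auto simp: ik Tn_def)
  have ne': "is \<noteq> []" using ne ik by simp
  let ?P = "\<lambda>L. 1 \<le> L \<and> L \<le> length is \<and> is ! (L - 1) + 1 \<notin> Iset ik"
  have lt: "is ! a < is ! b" if "a < b" "b < length is" for a b
    using T'(2) that by (simp add: sorted_wrt_iff_nth_less)
  have top: "s \<le> last is" if s: "s \<in> Iset ik" for s
  proof -
    obtain j where j: "j < length is" "s \<le> is ! j" using s by (auto simp: ik Iset_def)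
    have "is ! j \<le> is ! (length is - 1)"
      using lt[of j "length is - 1"] j by (cases "j < length is - 1") (auto simp: not_less le_less)
    then show ?thesis using j ne' by (simp add: last_conv_nth)
  qed
  \<comment> \<open>The successor of the largest top is never a letter, so the minimum that defines
    \<open>L1\<close> is attained.\<close>
  have "last is + 1 \<notin> Iset ik" using top[of "last is + 1"] by auto
  then have "?P (length is)" using ne' by (auto simp: last_conv_nth Suc_le_eq)
  then have L: "?P (L1 ik)"
    unfolding L1_def ik case_prod_conv by (rule LeastI)
  have Ll: "L1 ik - 1 < length is" using L by linarith
  have least: "L1 ik \<le> L" if "?P L" for L
    using that unfolding L1_def ik case_prod_conv by (rule Least_le)
  have mem: "is ! j \<in> Iset ik" if "j < length is" for j
    using that by (auto simp: ik Iset_def intro!: bexI[of _ j])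
  show exc1: "exc (cyc ik) (fst ik ! (L1 ik - 1) + 1)"
  proof -
    have "is ! (L1 ik - 1) \<in> set is" using L by auto
    moreover have "snd ` set (cyc ik) = set is"
      using map_snd_cyc[of "is" ks n] T ik by (metis list.set_map)
    ultimately show ?thesis by (simp add: exc_def ik)
  qed
  show "fst ik ! 0 \<in> Iset ik" using mem[of 0] ne' ik by simp
  show "fst ik ! (L1 ik - 1) + 1 \<le> n" using T'(3)[OF Ll] unfolding ik fst_conv by linarith
  show "\<not> exc (cyc ik) (fst ik ! 0)"
  proof
    assume "exc (cyc ik) (fst ik ! 0)"
    then obtain i where "i \<in> snd ` set (cyc ik)" "is ! 0 = Suc i" by (auto simp: exc_def ik)
    moreover have "snd ` set (cyc ik) = set is"
      using map_snd_cyc[of "is" ks n] T ik by (metis list.set_map)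
    ultimately obtain j where "j < length is" "is ! j < is ! 0" by (auto simp: in_set_conv_nth)
    then show False using lt[of 0 j] by (cases "j = 0") auto
  qed
  define e where "e = block_end (cyc ik) (is ! 0)"
  have e: "is ! 0 \<le> e" "e \<notin> Iset ik"
    unfolding e_def using block_end letters_cyc[OF T] by metis+
  have le: "e \<le> s" if "is ! 0 \<le> s" "s \<notin> Iset ik" for s
    unfolding e_def using block_end_le that letters_cyc[OF T] by metis
  have "is ! 0 \<le> is ! (L1 ik - 1)"
    using lt[of 0 "L1 ik - 1"] Ll by (cases "L1 ik - 1 = 0") auto
  then have le1: "e \<le> is ! (L1 ik - 1) + 1"
    using L by (intro le) auto
  have "e \<noteq> is ! 0" using e(2) mem[of 0] ne' by auto
  then have pos: "is ! 0 \<le> e - 1" "e - 1 < e" using e(1) by linarith+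
  \<comment> \<open>By minimality of the block end its predecessor is a letter; the run containing
    that letter must stop there, so the end is one past a top.\<close>
  have "e - 1 \<in> Iset ik"
    using le[OF pos(1)] pos(2) by linarith
  then obtain j where j: "j < length is" "is ! j - ks ! j \<le> e - 1" "e - 1 \<le> is ! j"
    by (auto simp: ik Iset_def)
  have "e > is ! j"
  proof (rule ccontr)
    assume "\<not> e > is ! j"
    then have "e \<in> {is ! j - ks ! j..is ! j}" using j(2) pos(2) by auto
    then have "e \<in> Iset ik" using j(1) unfolding ik Iset_def by blast
    then show False using e by simp
  qed
  then have ej: "e = is ! j + 1" using j(3) by linarith
  then have "L1 ik \<le> j + 1" using least[of "j + 1"] j(1) e(2) by simp
  then have "L1 ik - 1 \<le> j" by linarith
  then have "is ! (L1 ik - 1) \<le> is ! j"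
    using lt[of "L1 ik - 1" j] j(1) by (cases "L1 ik - 1 = j") auto
  then have "is ! (L1 ik - 1) + 1 = e" using ej le1 by linarith
  then show "fst ik ! (L1 ik - 1) + 1 = block_end (cyc ik) (fst ik ! 0)"
    by (simp add: ik e_def)
qed

text \<open>From the second index on, the renamed variables enumerate the non-letters, each once,
  and injectivity follows by counting; only the first variable sits at a letter, which keeps it
  apart from the rest.\<close>

lemma vtilde_props:
  assumes T: "ik \<in> Tn n" and ne: "fst ik \<noteq> []" and n: "1 \<le> n"
  defines "N \<equiv> n - weight ik + 1"
  shows "2 \<le> N" "inj_on (vtilde n ik) {1..N}" "vtilde n ik ` {1..N} \<subseteq> {1..n}"
    "vtilde n ik ` {2..N} = {1..n} - Iset ik"
    "vtilde n ik 1 = fst ik ! 0" "vtilde n ik 2 = block_end (cyc ik) (fst ik ! 0)"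
proof -
  note b = Iset_bounds[OF T n]
  let ?e = "block_end (cyc ik) (fst ik ! 0)"
  let ?R = "{1..n} - Iset ik - {?e}"
  note f = first_block_end[OF T ne]
  show N2: "2 \<le> N" unfolding N_def using b(2) n by linarith
  have e: "?e \<in> {1..n} - Iset ik"
    using f block_end(2)[of "cyc ik" "fst ik ! 0"] letters_cyc[OF T] by auto
  have cR: "card ?R = N - 2"
    using e b(4) b(2) n by (simp add: N_def)
  have v1: "vtilde n ik 1 = fst ik ! 0" by (simp add: vtilde_def split: prod.splits)
  have v2: "vtilde n ik 2 = ?e" using f(1) by (cases ik) (simp add: vtilde_def)
  have v3: "vtilde n ik j = sorted_list_of_set ?R ! (j - 3)" if "3 \<le> j" for j
    using f(1) that by (cases ik) (simp add: vtilde_def)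
  have len: "length (sorted_list_of_set ?R) = N - 2" using cR by simp
  have im3: "vtilde n ik ` {3..N} = ?R"
  proof -
    have "vtilde n ik ` {3..N} = (\<lambda>j. sorted_list_of_set ?R ! j) ` (\<lambda>j. j - 3) ` {3..N}"
      unfolding image_image by (intro image_cong refl) (simp add: v3)
    also have "(\<lambda>j. j - 3) ` {3..N} = {..<N - 2}"
    proof -
      have "x \<in> (\<lambda>j. j - 3) ` {3..N}" if "x < N - 2" for x
        using that by (intro image_eqI[of _ _ "x + 3"]) auto
      then show ?thesis by auto
    qed
    also have "(\<lambda>j. sorted_list_of_set ?R ! j) ` {..<N - 2} = set (sorted_list_of_set ?R)"
      using len by (auto simp: set_conv_nth)
    finally show ?thesis by simp
  qed
  have "{2..N} = insert 2 {3..N}" using N2 by auto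
  then have "vtilde n ik ` {2..N} = insert ?e ?R" by (simp only: image_insert im3 v2)
  then show im2: "vtilde n ik ` {2..N} = {1..n} - Iset ik"
    by (simp only: insert_Diff[OF e])
  have s1: "{1..N} = insert 1 {2..N}" using N2 by auto
  have "inj_on (vtilde n ik) {2..N}"
    by (rule eq_card_imp_inj_on) (simp, simp only: im2 b(4), simp add: N_def)
  moreover have "vtilde n ik 1 \<notin> vtilde n ik ` {2..N}" using im2 v1 f(4) by simp
  ultimately show "inj_on (vtilde n ik) {1..N}"
    unfolding s1 by (simp add: inj_on_insert)
  have "vtilde n ik 1 \<in> {1..n}" using v1 f(4) b(1) by fastforce
  then show "vtilde n ik ` {1..N} \<subseteq> {1..n}"
    unfolding s1 image_insert im2 by blast
  show "vtilde n ik 1 = fst ik ! 0" "vtilde n ik 2 = ?e" by fact+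
qed

subsection \<open>Polynomials with exponents in a chain family\<close>

text \<open>A polynomial of degree below \<open>d\<close> over a domain that has \<open>d\<close>
  zeros is zero.\<close>

lemma power_sum_vanish:
  fixes c :: "nat \<Rightarrow> 'k::idom"
  assumes "finite U" "d \<le> card U" "\<And>x. x \<in> U \<Longrightarrow> (\<Sum>a<d. c a * x ^ a) = 0"
      "a < d"
  shows "c a = 0"
proof -
  let ?p = "\<Sum>a<d. monom (c a) a"
  have p: "poly ?p x = (\<Sum>a<d. c a * x ^ a)" for x
    by (simp add: poly_sum poly_monom)
  have "degree ?p < d"
    using assms(4) by (intro degree_sum_less) (auto intro: le_less_trans[OF degree_monom_le])
  then have "?p = 0"
    using assms p by (intro poly_eqI_degree[of U]) auto
  then have "coeff ?p a = 0" by simp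
  then show ?thesis using assms(4) by (simp add: coeff_sum sum.delta')
qed

text \<open>Freeze all variables but one: an affine function over a domain that vanishes at two
  distinct points is zero, and the induction runs over the remaining variables.\<close>

lemma multiaffine_vanish:
  fixes C :: "nat set \<Rightarrow> 'k::idom"
  assumes "finite J" "\<alpha> \<noteq> \<beta>"
    "\<And>S. S \<subseteq> J \<Longrightarrow> (\<Sum>E\<in>Pow J. C E * (\<Prod>j\<in>E. if j \<in> S
        then \<alpha> else \<beta>)) = 0" "E \<subseteq> J"
  shows "C E = 0"
  using assms(1,3,4)
proof (induction J arbitrary: C E rule: finite_induct)
  case empty
  then show ?case by simp
next
  case (insert i J)
  have split: "(\<Sum>E\<in>Pow (insert i J). f E) = (\<Sum>E\<in>Pow J. f E + f (insert i E))" for f ::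
      "nat set \<Rightarrow> 'k"
  proof -
    have "inj_on (insert i) (Pow J)" using insert.hyps by (auto simp: inj_on_def)
    moreover have "Pow J \<inter> insert i ` Pow J = {}" using insert.hyps by auto
    ultimately show ?thesis
      using insert.hyps by (simp add: Pow_insert sum.union_disjoint sum.reindex sum.distrib)
  qed
  have *: "C E + C (insert i E) * x = 0" if x: "x = \<alpha> \<or> x = \<beta>" and E: "E \<subseteq> J" for x E
  proof (rule insert.IH[OF _ E])
    fix S assume S: "S \<subseteq> J"
    define S' where "S' = (if x = \<alpha> then insert i S else S)"
    have S': "S' \<subseteq> insert i J" "(if i \<in> S' then \<alpha> else \<beta>) = x"
      "\<And>j. j \<in> J \<Longrightarrow> j \<in> S' \<longleftrightarrow> j \<in> S"
      using S x insert.hyps by (auto simp: S'_def)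
    have "(\<Sum>E\<in>Pow J. (C E + C (insert i E) * x) * (\<Prod>j\<in>E. if j \<in> S then \<alpha>
        else \<beta>)) =
       (\<Sum>E\<in>Pow J. C E * (\<Prod>j\<in>E. if j \<in> S' then \<alpha> else \<beta>) +
          C (insert i E) * (\<Prod>j\<in>insert i E. if j \<in> S' then \<alpha> else \<beta>))"
    proof (rule sum.cong[OF refl])
      fix E assume "E \<in> Pow J"
      then have E: "E \<subseteq> J" "finite E" "i \<notin> E" using insert.hyps finite_subset by auto
      have "(\<Prod>j\<in>E. if j \<in> S then \<alpha> else \<beta>) = (\<Prod>j\<in>E. if j \<in> S'
          then \<alpha> else \<beta>)"
        using E S'(3) by (intro prod.cong) auto
      then show "(C E + C (insert i E) * x) * (\<Prod>j\<in>E. if j \<in> S then \<alpha> else \<beta>) =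
         C E * (\<Prod>j\<in>E. if j \<in> S' then \<alpha> else \<beta>) +
          C (insert i E) * (\<Prod>j\<in>insert i E. if j \<in> S' then \<alpha> else \<beta>)"
        using E S'(2) by (simp add: algebra_simps)
    qed
    also have "\<dots> = 0" using insert.prems(1)[OF S'(1)] unfolding split .
    finally show "(\<Sum>E\<in>Pow J. (C E + C (insert i E) * x) * (\<Prod>j\<in>E. if j \<in> S then
        \<alpha> else \<beta>)) = 0" .
  qed
  have both: "C E = 0 \<and> C (insert i E) = 0" if "E \<subseteq> J" for E
  proof -
    have "C E + C (insert i E) * \<alpha> = 0" "C E + C (insert i E) * \<beta> = 0"
      using *[of \<alpha> E] *[of \<beta> E] that by auto
    moreover have "C (insert i E) * (\<alpha> - \<beta>) =
        (C E + C (insert i E) * \<alpha>) - (C E + C (insert i E) * \<beta>)"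
      by (simp add: algebra_simps)
    ultimately have "C (insert i E) * (\<alpha> - \<beta>) = 0" by simp
    then have "C (insert i E) = 0" using assms(2) by simp
    then show ?thesis using \<open>C E + C (insert i E) * \<alpha> = 0\<close> by simp
  qed
  show ?case
  proof (cases "i \<in> E")
    case True
    then have "E = insert i (E - {i})" "E - {i} \<subseteq> J" using insert.prems(2) by auto
    then show ?thesis using both by metis
  next
    case False
    then show ?thesis using both insert.prems(2) by blast
  qed
qed

section \<open>Splitting off the monomials with a given leading variable\<close>

definition chain_head :: "nat \<Rightarrow> nat \<times> nat \<times> nat set \<Rightarrow> nat
    \<Rightarrow> nat" where
  "chain_head i = (\<lambda>(a, b, E) j. if j = i then a else if j = Suc i then b else of_bool (j \<in> E))"

definition chain_params :: "nat \<Rightarrow> nat \<Rightarrow> nat \<Rightarrow> (nat \<times> nat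
    \<times> nat set) set" where
  "chain_params d N i = {1..<d} \<times> {..<d} \<times> Pow {i + 2..N}"

lemma finite_chain_params [simp]: "finite (chain_params d N i)"
  by (simp add: chain_params_def)

lemma chain_head_image:
  "chain_head i ` chain_params d N i =
    {e. \<exists>a b \<epsilon>. 1 \<le> a \<and> a < d \<and> b < d \<and> (\<forall>j. \<epsilon> j
        \<le> (1::nat)) \<and>
      e = (\<lambda>j. if j = i then a else if j = i + 1 then b
                else if i + 2 \<le> j \<and> j \<le> N then \<epsilon> j else 0)}" (is "?L = ?R")
proof (rule set_eqI, rule iffI)
  fix e assume "e \<in> ?L"
  then obtain a b E where ab: "1 \<le> a" "a < d" "b < d" "E \<subseteq> {i + 2..N}"
    and e: "e = chain_head i (a, b, E)"
    by (auto simp: chain_params_def)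
  have "e = (\<lambda>j. if j = i then a else if j = i + 1 then b
      else if i + 2 \<le> j \<and> j \<le> N then of_bool (j \<in> E) else 0)"
    using ab(4) by (auto simp: e chain_head_def fun_eq_iff)
  with ab(1-3) show "e \<in> ?R"
    by (intro CollectI exI[of _ a] exI[of _ b] exI[of _ "\<lambda>j. of_bool (j \<in> E)"] conjI) simp_all
next
  fix e assume "e \<in> ?R"
  then obtain a b \<epsilon> where a: "1 \<le> a" "a < d" "b < d" "\<And>j. \<epsilon> j \<le> (1::nat)"
    and e: "e = (\<lambda>j. if j = i then a else if j = i + 1 then b
      else if i + 2 \<le> j \<and> j \<le> N then \<epsilon> j else 0)" by blast
  let ?E = "{j \<in> {i + 2..N}. \<epsilon> j = 1}"
  have "\<epsilon> j = of_bool (\<epsilon> j = 1)" for j using a(4)[of j] by (cases "\<epsilon> j") auto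
  then have "e = chain_head i (a, b, ?E)"
    unfolding e by (auto simp: chain_head_def fun_eq_iff simp del: One_nat_def)
  moreover have "(a, b, ?E) \<in> chain_params d N i"
    using a by (auto simp: chain_params_def)
  ultimately show "e \<in> ?L" by blast
qed

lemma chain_fam_alt:
  "chain_fam d N lo = (\<Union>i\<in>{lo..<N}. chain_head i ` chain_params d N i) \<union>
     (\<lambda>b j. if j = N then b else 0) ` {..<d}"
proof -
  have "{e. \<exists>i a b \<epsilon>. lo \<le> i \<and> i < N \<and> Q i a b \<epsilon> e} =
      (\<Union>i\<in>{lo..<N}. {e. \<exists>a b \<epsilon>. Q i a b \<epsilon> e})"
    for Q :: "nat \<Rightarrow> nat \<Rightarrow> nat \<Rightarrow> (nat \<Rightarrow> nat) \<Rightarrow>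
        (nat \<Rightarrow> nat) \<Rightarrow> bool"
    by fastforce
  moreover have "{e. \<exists>b. b < d \<and> e = f b} = f ` {..<d}" for f :: "nat \<Rightarrow> nat
      \<Rightarrow> nat"
    by auto
  ultimately show ?thesis
    unfolding chain_head_image chain_fam_def by (intro arg_cong2[of _ _ _ _ "(\<union>)"])
qed

lemma chain_fam_last: "chain_fam d N N = (\<lambda>b j. if j = N then b else 0) ` {..<d}"
  by (simp add: chain_fam_alt)

lemma chain_fam_step:
  assumes "lo < N"
  shows "chain_fam d N lo = chain_head lo ` chain_params d N lo \<union> chain_fam d N (Suc lo)"
proof -
  have "{lo..<N} = insert lo {Suc lo..<N}" using assms by auto
  then show ?thesis unfolding chain_fam_alt by (simp add: Un_assoc)
qed

lemma chain_fam_support: "e \<in> chain_fam d N lo \<Longrightarrow> lo \<le> N \<Longrightarrow> j < lo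
    \<or> N < j \<Longrightarrow> e j = 0"
  by (auto simp: chain_fam_def)

lemma inj_on_chain_head: "inj_on (chain_head i) (chain_params d N i)"
proof (rule inj_onI)
  fix p q assume p: "p \<in> chain_params d N i" and q: "q \<in> chain_params d N i"
    and eq: "chain_head i p = chain_head i q"
  obtain a b E where p': "p = (a, b, E)" by (cases p)
  obtain a' b' E' where q': "q = (a', b', E')" by (cases q)
  have pt: "chain_head i p j = chain_head i q j" for j using eq by simp
  have "a = a'" using pt[of i] by (simp add: chain_head_def p' q')
  moreover have "b = b'" using pt[of "Suc i"] by (simp add: chain_head_def p' q')
  moreover have "j \<in> E \<longleftrightarrow> j \<in> E'" for j
  proof (cases "j \<in> {i + 2..N}")
    case True
    then show ?thesis
      using pt[of j] by (cases "j \<in> E"; cases "j \<in> E'") (auto simp: chain_head_def p' q')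
  next
    case False
    then show ?thesis using p q by (auto simp: chain_params_def p' q')
  qed
  ultimately show "p = q" by (auto simp: p' q')
qed

lemma chain_fam_disjoint:
  "lo < N \<Longrightarrow> chain_head lo ` chain_params d N lo \<inter> chain_fam d N (Suc lo) = {}"
proof -
  assume lo: "lo < N"
  have "chain_head lo p lo \<noteq> 0" if "p \<in> chain_params d N lo" for p
    using that by (auto simp: chain_head_def chain_params_def)
  moreover have "e lo = 0" if "e \<in> chain_fam d N (Suc lo)" for e
    using chain_fam_support[OF that, of lo] lo by simp
  ultimately show ?thesis by fastforce
qed

lemma finite_chain_fam: "lo \<le> N \<Longrightarrow> finite (chain_fam d N lo)"
proof (induction lo rule: inc_induct)
  case base
  then show ?case by (simp add: chain_fam_last)
next
  case (step lo)
  then show ?case by (simp add: chain_fam_step)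
qed

text \<open>Lowering the leading index by one doubles the choices of the 0/1 exponents, so the heads
  form a geometric series; the summand \<open>d\<close> counts the powers of the last
  variable.\<close>

lemma card_chain_fam:
  assumes "lo \<le> N"
  shows "card (chain_fam d N lo) = (d - 1) * d * (2 ^ (N - lo) - 1) + d"
  using assms
proof (induction lo rule: inc_induct)
  case base
  have "inj_on (\<lambda>b j. if j = N then b else 0 :: nat) {..<d}"
    by (auto simp: inj_on_def fun_eq_iff)
  then show ?case by (simp add: chain_fam_last card_image)
next
  case (step lo)
  have c: "card (chain_head lo ` chain_params d N lo) = (d - 1) * d * 2 ^ (N - Suc lo)"
    unfolding card_image[OF inj_on_chain_head]
    by (simp add: chain_params_def card_cartesian_product card_Pow)
  have "card (chain_fam d N lo) = (d - 1) * d * 2 ^ (N - Suc lo) + card (chain_fam d N (Suc lo))"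
    unfolding chain_fam_step[OF step.hyps(2)]
    by (subst card_Un_disjoint) (use step.hyps chain_fam_disjoint finite_chain_fam c in auto)
  also have "\<dots> = (d - 1) * d * (2 ^ (N - Suc lo) + (2 ^ (N - Suc lo) - 1)) + d"
    by (simp only: step.IH distrib_left add.assoc)
  also have "2 ^ (N - Suc lo) + (2 ^ (N - Suc lo) - 1) = (2 ^ (N - lo) - 1 :: nat)"
  proof -
    have "N - lo = Suc (N - Suc lo)" using step.hyps by simp
    then have "2 ^ (N - lo) = 2 * (2 ^ (N - Suc lo) :: nat)" by simp
    moreover have "(1::nat) \<le> 2 ^ (N - Suc lo)" by simp
    ultimately show ?thesis by linarith
  qed
  finally show ?case .
qed

lemma sum_chain_fam:
  assumes "lo < N"
  shows "(\<Sum>e\<in>chain_fam d N lo. f e) =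
    (\<Sum>p\<in>chain_params d N lo. f (chain_head lo p)) + (\<Sum>e\<in>chain_fam d N (Suc lo). f e)"
proof -
  have "(\<Sum>e\<in>chain_fam d N lo. f e) =
      (\<Sum>e\<in>chain_head lo ` chain_params d N lo. f e) + (\<Sum>e\<in>chain_fam d N (Suc lo). f e)"
    unfolding chain_fam_step[OF assms]
    by (rule sum.union_disjoint)
       (use assms chain_fam_disjoint[OF assms] finite_chain_fam[of "Suc lo" N d] in simp_all)
  then show ?thesis by (simp only: sum.reindex[OF inj_on_chain_head] comp_def)
qed

lemma prod_chain_head:
  fixes z :: "nat \<Rightarrow> 'k::idom"
  assumes "lo < N" "E \<subseteq> {lo + 2..N}"
  shows "(\<Prod>j = lo..N. z j ^ chain_head lo (a, b, E) j) = z lo ^ a * z (Suc lo) ^ b *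
      (\<Prod>j\<in>E. z j)"
proof -
  have "{lo..N} = insert lo (insert (Suc lo) {lo + 2..N})" using assms by auto
  then have "(\<Prod>j = lo..N. z j ^ chain_head lo (a, b, E) j) = z lo ^ a * (z (Suc lo) ^ b *
      (\<Prod>j\<in>{lo + 2..N}. z j ^ chain_head lo (a, b, E) j))"
    by (simp add: chain_head_def)
  also have "(\<Prod>j\<in>{lo + 2..N}. z j ^ chain_head lo (a, b, E) j) = (\<Prod>j\<in>{lo + 2..N}. if
      j \<in> E then z j else 1)"
    by (intro prod.cong) (auto simp: chain_head_def)
  also have "\<dots> = (\<Prod>j\<in>E. z j)"
    using assms(2) by (subst prod.mono_neutral_right[of "{lo + 2..N}" E]) auto
  finally show ?thesis by (simp add: mult.assoc)
qed

text \<open>At a two-valued point, moving the first coordinate onto the second one leaves the part of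
  the polynomial without the first variable unchanged; the difference of the two values is
  multiaffine in the coordinates from the third one on.\<close>

lemma chain_fam_vanish:
  fixes c :: "(nat \<Rightarrow> nat) \<Rightarrow> 'k::idom"
  assumes U: "finite U" "d \<le> card U" and "lo \<le> N"
    and "\<And>z \<alpha> \<beta>. \<lbrakk>\<alpha> \<in> U; \<beta> \<in> U; \<And>j. z j = \<alpha>
        \<or> z j = \<beta>\<rbrakk> \<Longrightarrow>
      (\<Sum>e\<in>chain_fam d N lo. c e * (\<Prod>j = lo..N. z j ^ e j)) = 0"
    and "e \<in> chain_fam d N lo"
  shows "c e = 0"
  using assms(3-5)
proof (induction lo arbitrary: e rule: inc_induct)
  case base
  have inj: "inj_on (\<lambda>b j. if j = N then b else 0 :: nat) {..<d}"
    by (auto simp: inj_on_def fun_eq_iff)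
  have s: "(\<Sum>b<d. c (\<lambda>j. if j = N then b else 0) * x ^ b) = 0" if "x \<in> U" for x
    using base(1)[of x x "\<lambda>_. x"] that
    by (simp add: chain_fam_last sum.reindex[OF inj])
  obtain b where "b < d" "e = (\<lambda>j. if j = N then b else 0)"
    using base(2) by (auto simp: chain_fam_last)
  then show ?case
    using power_sum_vanish[OF U, of "\<lambda>b. c (\<lambda>j. if j = N then b else 0)" b] s by auto
next
  case (step lo)
  let ?P = "chain_params d N lo" and ?J = "{lo + 2..N}"
  have rest: "(\<Prod>j = lo..N. z j ^ e j) = (\<Prod>j = Suc lo..N. z j ^ e j)"
    if "e \<in> chain_fam d N (Suc lo)" for z :: "nat \<Rightarrow> 'k" and e
    using step.hyps that by (subst prod.atLeast_Suc_atMost) (auto simp: chain_fam_support)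
  have val: "(\<Sum>(a, b, E)\<in>?P. c (chain_head lo (a, b, E)) * (z lo ^ a * z (Suc lo) ^ b *
      (\<Prod>j\<in>E. z j))) +
      (\<Sum>e\<in>chain_fam d N (Suc lo). c e * (\<Prod>j = Suc lo..N. z j ^ e j)) = 0"
    if z: "\<alpha> \<in> U" "\<beta> \<in> U" "\<And>j. z j = \<alpha> \<or> z j = \<beta>" for z
        \<alpha> \<beta>
  proof -
    have "0 = (\<Sum>e\<in>chain_fam d N lo. c e * (\<Prod>j = lo..N. z j ^ e j))"
      using step.prems(1)[OF z] by simp
    also have "\<dots> = (\<Sum>p\<in>?P. c (chain_head lo p) * (\<Prod>j = lo..N. z j ^ chain_head lo p j)) +
        (\<Sum>e\<in>chain_fam d N (Suc lo). c e * (\<Prod>j = lo..N. z j ^ e j))"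
      by (rule sum_chain_fam[OF step.hyps(2)])
    also have "(\<Sum>p\<in>?P. c (chain_head lo p) * (\<Prod>j = lo..N. z j ^ chain_head lo p j)) =
        (\<Sum>(a, b, E)\<in>?P. c (chain_head lo (a, b, E)) * (z lo ^ a * z (Suc lo) ^ b *
            (\<Prod>j\<in>E. z j)))"
      by (intro sum.cong) (auto simp: chain_params_def prod_chain_head[OF step.hyps(2)])
    also have "(\<Sum>e\<in>chain_fam d N (Suc lo). c e * (\<Prod>j = lo..N. z j ^ e j)) =
        (\<Sum>e\<in>chain_fam d N (Suc lo). c e * (\<Prod>j = Suc lo..N. z j ^ e j))"
      by (intro sum.cong) (auto simp: rest)
    finally show ?thesis by simp
  qed
  have diff: "(\<Sum>a\<in>{1..<d}. \<Sum>b<d. c (chain_head lo (a, b, E)) * ((\<alpha> ^ a - \<beta> ^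
      a) * \<beta> ^ b)) = 0"
    if ab: "\<alpha> \<in> U" "\<beta> \<in> U" and E: "E \<subseteq> ?J" for \<alpha> \<beta> E
  proof (cases "\<alpha> = \<beta>")
    case False
    let ?C = "\<lambda>E. \<Sum>a\<in>{1..<d}. \<Sum>b<d. c (chain_head lo (a, b, E)) * ((\<alpha> ^ a -
        \<beta> ^ a) * \<beta> ^ b)"
    show ?thesis
    proof (rule multiaffine_vanish[OF _ False _ E, of ?C])
      fix S assume S: "S \<subseteq> ?J"
      define w where "w j = (if j \<in> S then \<alpha> else \<beta>)" for j
      define z1 z2 where "z1 = w(lo := \<alpha>)" and "z2 = w(lo := \<beta>)"
      have nS: "lo \<notin> S" "Suc lo \<notin> S" using S by auto
      have e: "(\<Prod>j\<in>E. z1 j) = (\<Prod>j\<in>E. w j)" "(\<Prod>j\<in>E. z2 j) = (\<Prod>j\<in>E.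
          w j)" if "E \<subseteq> ?J" for E
        using that by (intro prod.cong refl; force simp: z1_def z2_def)+
      have r: "(\<Prod>j = Suc lo..N. z1 j ^ e j) = (\<Prod>j = Suc lo..N. z2 j ^ e j)" for e
        by (intro prod.cong) (auto simp: z1_def z2_def)
      have v: "z1 lo = \<alpha>" "z2 lo = \<beta>" "z1 (Suc lo) = \<beta>" "z2 (Suc lo) = \<beta>"
        using nS by (auto simp: z1_def z2_def w_def)
      have "(\<Sum>(a, b, E)\<in>?P. c (chain_head lo (a, b, E)) * (z1 lo ^ a * z1 (Suc lo) ^ b *
          (\<Prod>j\<in>E. z1 j))) =
          (\<Sum>(a, b, E)\<in>?P. c (chain_head lo (a, b, E)) * (z2 lo ^ a * z2 (Suc lo) ^ b *
              (\<Prod>j\<in>E. z2 j)))"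
        (is "?s1 = ?s2")
      proof -
        have zz: "z1 j = \<alpha> \<or> z1 j = \<beta>" "z2 j = \<alpha> \<or> z2 j = \<beta>" for j
          by (auto simp: z1_def z2_def w_def)
        let ?r = "\<lambda>z. \<Sum>e\<in>chain_fam d N (Suc lo). c e * (\<Prod>j = Suc lo..N. z j ^ e j)"
        have "?r z1 = ?r z2" by (simp only: r)
        moreover have "?s1 + ?r z1 = ?s2 + ?r z2"
          unfolding val[where z = z1, OF ab zz(1)] val[where z = z2, OF ab zz(2)] ..
        ultimately show ?thesis by (simp only: add_right_cancel)
      qed
      then have "0 = (\<Sum>p\<in>?P. case p of (a, b, E) \<Rightarrow> c (chain_head lo (a, b, E)) *
          (z1 lo ^ a * z1 (Suc lo) ^ b * (\<Prod>j\<in>E. z1 j)) - c (chain_head lo (a, b, E)) *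
          (z2 lo ^ a * z2 (Suc lo) ^ b * (\<Prod>j\<in>E. z2 j)))"
        by (simp add: sum_subtractf split_beta)
      also have "\<dots> = (\<Sum>(a, b, E)\<in>{1..<d} \<times> {..<d} \<times> Pow ?J.
          c (chain_head lo (a, b, E)) * ((\<alpha> ^ a - \<beta> ^ a) * \<beta> ^ b) * (\<Prod>j\<in>E. w j))"
        unfolding chain_params_def
      proof (intro sum.cong refl, clarify)
        fix a b E assume "E \<subseteq> ?J"
        then show "c (chain_head lo (a, b, E)) * (z1 lo ^ a * z1 (Suc lo) ^ b * (\<Prod>j\<in>E. z1 j)) -
            c (chain_head lo (a, b, E)) * (z2 lo ^ a * z2 (Suc lo) ^ b * (\<Prod>j\<in>E. z2 j)) =
          c (chain_head lo (a, b, E)) * ((\<alpha> ^ a - \<beta> ^ a) * \<beta> ^ b) * (\<Prod>j\<in>E. w j)"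
          by (simp only: v e) (simp only: algebra_simps)
      qed
      also have "\<dots> = (\<Sum>E\<in>Pow ?J. \<Sum>a\<in>{1..<d}. \<Sum>b<d.
          c (chain_head lo (a, b, E)) * ((\<alpha> ^ a - \<beta> ^ a) * \<beta> ^ b) * (\<Prod>j\<in>E. w j))"
      proof -
        have "(\<Sum>(a, b, E)\<in>A \<times> B \<times> C. f a b E) = (\<Sum>E\<in>C. \<Sum>a\<in>A.
            \<Sum>b\<in>B. f a b E)"
          for A B :: "nat set" and C :: "nat set set" and f :: "nat \<Rightarrow> nat \<Rightarrow> nat
              set \<Rightarrow> 'k"
        proof -
          have "(\<Sum>(a, b, E)\<in>A \<times> B \<times> C. f a b E) = (\<Sum>a\<in>A. \<Sum>b\<in>B.
              \<Sum>E\<in>C. f a b E)"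
            by (simp add: sum.cartesian_product)
          also have "\<dots> = (\<Sum>a\<in>A. \<Sum>E\<in>C. \<Sum>b\<in>B. f a b E)"
            by (intro sum.cong refl sum.swap)
          also have "\<dots> = (\<Sum>E\<in>C. \<Sum>a\<in>A. \<Sum>b\<in>B. f a b E)" by (rule sum.swap)
          finally show ?thesis .
        qed
        then show ?thesis .
      qed
      finally show "(\<Sum>E\<in>Pow ?J. ?C E * (\<Prod>j\<in>E. if j \<in> S then \<alpha> else \<beta>)) = 0"
        by (simp add: w_def sum_distrib_right)
    qed simp
  qed simp
  have heads: "c (chain_head lo (a, b, E)) = 0" if "a \<in> {1..<d}" "b < d" "E \<subseteq> ?J" for a b E
  proof -
    have "(\<Sum>b<d. c (chain_head lo (a, b, E)) * \<beta> ^ b) = 0" if \<beta>: "\<beta> \<in> U" for \<beta>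
    proof -
      \<comment> \<open>For fixed \<beta>, \<open>diff\<close> says that the polynomial in \<alpha>
        with coefficients \<open>D a\<close> takes the same value at \<alpha> and at \<beta>; the
        constant term of \<open>D'\<close> subtracts that value, which makes every element of
        \<open>U\<close> a zero.\<close>
      define D where "D a = (\<Sum>b<d. c (chain_head lo (a, b, E)) * \<beta> ^ b)" for a
      define D' where "D' a = (if a = 0 then - (\<Sum>a\<in>{1..<d}. \<beta> ^ a * D a) else D a)" for a
      have "(\<Sum>a<d. D' a * \<alpha> ^ a) = 0" if \<alpha>: "\<alpha> \<in> U" for \<alpha>
      proof -
        have "(\<Sum>a\<in>{1..<d}. (\<alpha> ^ a - \<beta> ^ a) * D a) = 0"
          using diff[OF \<alpha> \<beta> \<open>E \<subseteq> ?J\<close>] by (simp add: D_def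
              sum_distrib_left algebra_simps)
        moreover have "{..<d} = insert 0 {1..<d}" using \<open>b < d\<close> by auto
        ultimately show ?thesis
          by (simp add: D'_def left_diff_distrib right_diff_distrib sum_subtractf mult.commute)
      qed
      then have "D' a = 0"
        using power_sum_vanish[OF U, of D' a] \<open>a \<in> {1..<d}\<close> by auto
      then show ?thesis using \<open>a \<in> {1..<d}\<close> by (simp add: D'_def D_def)
    qed
    then show ?thesis
      using power_sum_vanish[OF U, of "\<lambda>b. c (chain_head lo (a, b, E))" b] \<open>b < d\<close> by auto
  qed
  show ?case
  proof (cases "e \<in> chain_fam d N (Suc lo)")
    case True
    show ?thesis
    proof (rule step.IH[OF _ True])
      fix z :: "nat \<Rightarrow> 'k" and \<alpha> \<beta> assume z: "\<alpha> \<in> U" "\<beta> \<in> U"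
          "\<And>j. z j = \<alpha> \<or> z j = \<beta>"
      have "(\<Sum>(a, b, E)\<in>?P. c (chain_head lo (a, b, E)) * (z lo ^ a * z (Suc lo) ^ b *
          (\<Prod>j\<in>E. z j))) = 0"
        by (intro sum.neutral) (auto simp: chain_params_def heads)
      then show "(\<Sum>e\<in>chain_fam d N (Suc lo). c e * (\<Prod>j = Suc lo..N. z j ^ e j)) = 0"
        using val[where z = z, OF z] by simp
    qed
  next
    case False
    then show ?thesis
      using step.prems(2) heads unfolding chain_fam_step[OF step.hyps(2)]
      by (auto simp: chain_params_def)
  qed
qed

subsection \<open>The exponent sets and the points they separate\<close>

text \<open>The scalars \<open>q\<close> are complex roots of unity in the spanning argument and
  their images in the Laurent ring in the independence argument.\<close>

definition monom_at :: "(nat \<Rightarrow> 'k::comm_monoid_mult) \<Rightarrow> nat \<Rightarrow> nat list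
    \<Rightarrow> (nat \<Rightarrow> nat) \<Rightarrow> 'k" where
  "monom_at q n r \<chi> = (\<Prod>s = 1..n. q (\<chi> s) ^ (r ! (s - 1)))"

lemma nth_to_tuple:
  "s \<in> {1..n} \<Longrightarrow> to_tuple n N vt e ! (s - 1) = (\<Sum>j\<in>{1..N}. if vt j = s then e
      j else 0)"
  unfolding to_tuple_def by (subst nth_map) (auto simp del: upt_Suc)

lemma monom_at_to_tuple:
  fixes q :: "nat \<Rightarrow> 'k::comm_monoid_mult"
  assumes "vt ` {1..N} \<subseteq> {1..n}"
  shows "monom_at q n (to_tuple n N vt e) \<chi> = (\<Prod>j = 1..N. q (\<chi> (vt j)) ^ e j)"
proof -
  have "monom_at q n (to_tuple n N vt e) \<chi> =
      (\<Prod>s = 1..n. \<Prod>j = 1..N. q (\<chi> s) ^ (if vt j = s then e j else 0))"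
    unfolding monom_at_def by (intro prod.cong refl) (simp only: nth_to_tuple power_sum)
  also have "\<dots> = (\<Prod>j = 1..N. \<Prod>s = 1..n. q (\<chi> s) ^ (if vt j = s then e j else 0))"
    by (rule prod.swap)
  also have "\<dots> = (\<Prod>j = 1..N. q (\<chi> (vt j)) ^ e j)"
  proof (intro prod.cong refl)
    fix j assume "j \<in> {1..N}"
    then have "vt j \<in> {1..n}" using assms by blast
    moreover have "(\<Prod>s = 1..n. q (\<chi> s) ^ (if vt j = s then e j else 0)) =
        (\<Prod>s = 1..n. if vt j = s then q (\<chi> s) ^ e j else 1)"
      by (intro prod.cong) auto
    ultimately show "(\<Prod>s = 1..n. q (\<chi> s) ^ (if vt j = s then e j else 0)) = q (\<chi> (vt j)) ^ e j"
      by (simp only: prod.delta' finite_atLeastAtMost if_True)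
  qed
  finally show ?thesis .
qed

lemma inj_on_to_tuple:
  assumes "inj_on vt {1..N}" "vt ` {1..N} \<subseteq> {1..n}"
    and "\<And>e j. e \<in> F \<Longrightarrow> j \<notin> {1..N} \<Longrightarrow> e j = 0"
  shows "inj_on (to_tuple n N vt) F"
proof (rule inj_onI, rule ext)
  fix e e' j assume F: "e \<in> F" "e' \<in> F" and eq: "to_tuple n N vt e = to_tuple n N vt e'"
  show "e j = e' j"
  proof (cases "j \<in> {1..N}")
    case True
    then have vj: "vt j \<in> {1..n}" using assms(2) by blast
    have "(\<Sum>i\<in>{1..N}. if vt i = vt j then x i else 0) = x j" for x :: "nat \<Rightarrow> nat"
    proof -
      have "(\<Sum>i\<in>{1..N}. if vt i = vt j then x i else 0) = (\<Sum>i\<in>{1..N}. if i = j then x i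
          else 0)"
        using assms(1) True by (intro sum.cong refl if_cong) (simp_all only: inj_on_eq_iff)
      then show ?thesis using True by (simp only: sum.delta finite_atLeastAtMost if_True)
    qed
    then have "to_tuple n N vt x ! (vt j - 1) = x j" for x
      unfolding nth_to_tuple[OF vj] .
    then show ?thesis using eq by metis
  next
    case False
    then show ?thesis using assms(3)[OF F(1) False] assms(3)[OF F(2) False] by simp
  qed
qed

section \<open>The two shapes of an exponent set and their sizes\<close>

definition pair_exp :: "nat \<times> nat \<Rightarrow> nat \<Rightarrow> nat" where
  "pair_exp = (\<lambda>(a, b) j. if j = 1 then a else if j = 2 then b else 0)"

definition pair_fam :: "nat \<Rightarrow> (nat \<Rightarrow> nat) set" where
  "pair_fam d = pair_exp ` ({1..<d} \<times> {..<d})"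

lemma pair_fam_alt: "{e. \<exists>a b. 1 \<le> a \<and> a < d \<and> b < d \<and>
    e = (\<lambda>j. if j = 1 then a else if j = 2 then b else 0)} = pair_fam d"
  unfolding pair_fam_def pair_exp_def by (auto simp: image_iff Bex_def)

lemma inj_on_pair_exp: "inj_on pair_exp A"
proof (rule inj_onI)
  fix p q assume "pair_exp p = pair_exp q"
  then have "pair_exp p 1 = pair_exp q 1" "pair_exp p 2 = pair_exp q 2" by simp_all
  then show "p = q" by (simp add: pair_exp_def split: prod.splits)
qed

lemma pair_fam_disjoint:
  assumes "2 \<le> N"
  shows "pair_fam d \<inter> chain_fam d N 2 = {}"
proof -
  have "e 1 \<noteq> 0" if "e \<in> pair_fam d" for e
    using that by (auto simp: pair_fam_def pair_exp_def)
  moreover have "e 1 = 0" if "e \<in> chain_fam d N 2" for e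
    using chain_fam_support[OF that assms, of 1] by simp
  ultimately show ?thesis by blast
qed

lemma finite_pair_fam: "finite (pair_fam d)"
  by (simp add: pair_fam_def)

lemma Eset_Nil: "fst ik = [] \<Longrightarrow> Eset d n ik = to_tuple n n id ` chain_fam d n 1"
  by (simp add: Eset_def)

lemma inj_Eset_Nil: "1 \<le> n \<Longrightarrow> inj_on (to_tuple n n id) (chain_fam d n 1)"
  by (rule inj_on_to_tuple) (auto simp: chain_fam_support)

lemma Eset_Cons:
  "fst ik \<noteq> [] \<Longrightarrow> Eset d n ik = to_tuple n (n - weight ik + 1) (vtilde n ik) `
     (pair_fam d \<union> chain_fam d (n - weight ik + 1) 2)"
  unfolding Eset_def Let_def pair_fam_alt by (simp only: if_False Un_commute)

lemma inj_Eset_Cons: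
  assumes "ik \<in> Tn n" "fst ik \<noteq> []" "1 \<le> n"
  shows "inj_on (to_tuple n (n - weight ik + 1) (vtilde n ik))
    (pair_fam d \<union> chain_fam d (n - weight ik + 1) 2)"
proof (rule inj_on_to_tuple)
  note v = vtilde_props[OF assms]
  show "inj_on (vtilde n ik) {1..n - weight ik + 1}" "vtilde n ik ` {1..n - weight ik + 1} \<subseteq> {1..n}"
    by (fact v(2), fact v(3))
  fix e j assume e: "e \<in> pair_fam d \<union> chain_fam d (n - weight ik + 1) 2"
    and j: "j \<notin> {1..n - weight ik + 1}"
  from e show "e j = 0"
  proof
    assume "e \<in> pair_fam d"
    then show ?thesis using j v(1) by (auto simp: pair_fam_def pair_exp_def)
  next
    assume "e \<in> chain_fam d (n - weight ik + 1) 2"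
    then show ?thesis using chain_fam_support[OF _ v(1), of e d j] j by auto
  qed
qed

lemma finite_Eset:
  assumes "ik \<in> Tn n" "1 \<le> n"
  shows "finite (Eset d n ik)"
proof (cases "fst ik = []")
  case True
  then show ?thesis using assms by (simp add: Eset_Nil finite_chain_fam)
next
  case False
  then show ?thesis
    unfolding Eset_Cons[OF False]
    by (intro finite_imageI finite_UnI finite_pair_fam finite_chain_fam
        vtilde_props(1)[OF assms(1) False assms(2)])
qed

text \<open>This shape of the count matches the points: \<open>d * (d - 1)\<close> ordered pairs of
  distinct colours times the choices of a colouring, plus the \<open>d\<close> constants.\<close>

lemma card_Eset_nat:
  assumes "ik \<in> Tn n" "1 \<le> n" "1 \<le> d"
  shows "card (Eset d n ik) =
    (if fst ik = [] then d * (d - 1) * (2 ^ (n - 1) - 1) + d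
     else d * (d - 1) * 2 ^ (n - weight ik - 1) + d)"
proof (cases "fst ik = []")
  case True
  then show ?thesis
    unfolding Eset_Nil[OF True] card_image[OF inj_Eset_Nil[OF assms(2)]] card_chain_fam[OF assms(2)]
    by simp
next
  case False
  note v = vtilde_props[OF assms(1) False assms(2)]
  have "card (Eset d n ik) = card (pair_fam d \<union> chain_fam d (n - weight ik + 1) 2)"
    unfolding Eset_Cons[OF False] by (rule card_image[OF inj_Eset_Cons[OF assms(1) False assms(2)]])
  also have "\<dots> = card (pair_fam d) + card (chain_fam d (n - weight ik + 1) 2)"
    using v(1) by (intro card_Un_disjoint finite_pair_fam finite_chain_fam pair_fam_disjoint)
  also have "card (pair_fam d) = (d - 1) * d"
    unfolding pair_fam_def by (simp add: card_image[OF inj_on_pair_exp])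
  also have "card (chain_fam d (n - weight ik + 1) 2) = (d - 1) * d * (2 ^ (n - weight ik + 1 - 2) - 1) + d"
    by (rule card_chain_fam[OF v(1)])
  also have "n - weight ik + 1 - 2 = n - weight ik - 1" by simp
  also have "(d - 1) * d + ((d - 1) * d * (2 ^ (n - weight ik - 1) - 1) + d) =
      d * (d - 1) * (1 + (2 ^ (n - weight ik - 1) - 1)) + d"
    by (simp only: distrib_left mult_1_right add.assoc mult.commute[of d])
  also have "1 + (2 ^ (n - weight ik - 1) - 1) = (2 ^ (n - weight ik - 1) :: nat)" by simp
  finally show ?thesis using False by simp
qed

lemma card_Eset:
  assumes "ik \<in> Tn n" "1 \<le> n" "1 \<le> d"
  shows "int (card (Eset d n ik)) =
        2 ^ (n - weight ik - 1) * int d ^ 2 - (2 ^ (n - weight ik - 1) - 1) * int d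
        - (if weight ik = 0 then int d ^ 2 - int d else 0)"
proof -
  have d: "int (d - 1) = int d - 1" using assms(3) by simp
  have p: "int (2 ^ k - 1) = 2 ^ k - 1" for k :: nat by (simp add: of_nat_diff)
  show ?thesis
  proof (cases "fst ik = []")
    case True
    then have w: "weight ik = 0" using Iset_bounds(3)[OF assms(1,2)] by simp
    have "card (Eset d n ik) = d * (d - 1) * (2 ^ (n - 1) - 1) + d"
      using card_Eset_nat[OF assms] True by simp
    then have "int (card (Eset d n ik)) = int d * (int d - 1) * (2 ^ (n - 1) - 1) + int d"
      by (simp only: of_nat_add of_nat_mult d p)
    then show ?thesis using w by (simp add: algebra_simps power2_eq_square)
  next
    case False
    then have w: "weight ik \<noteq> 0" using Iset_bounds(3)[OF assms(1,2)] by simp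
    have "card (Eset d n ik) = d * (d - 1) * 2 ^ (n - weight ik - 1) + d"
      using card_Eset_nat[OF assms] False by simp
    then have "int (card (Eset d n ik)) = int d * (int d - 1) * 2 ^ (n - weight ik - 1) + int d"
      by (simp only: of_nat_add of_nat_mult d of_nat_power of_nat_numeral)
    then show ?thesis using w by (simp add: algebra_simps power2_eq_square)
  qed
qed

section \<open>The points separated by the monomials\<close>

definition two_point :: "nat \<Rightarrow> nat \<Rightarrow> nat \<Rightarrow> (nat \<Rightarrow> bool)
    \<Rightarrow> nat \<Rightarrow> nat" where
  "two_point n \<alpha> \<beta> y = (\<lambda>j\<in>{1..n}. if y j then \<beta> else \<alpha>)"

text \<open>Equal colours are allowed, so the constants are included. As restricted functions,
  points that agree on \<open>1..n\<close> are equal, so they can be counted.\<close>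

definition Zset :: "nat \<Rightarrow> nat \<Rightarrow> (nat \<times> nat) list \<Rightarrow> (nat
    \<Rightarrow> nat) set" where
  "Zset d n cs = {two_point n \<alpha> \<beta> y | \<alpha> \<beta> y. \<alpha> < d \<and> \<beta> < d
      \<and> proper y (nfword cs)}"

lemma two_point_apply: "j \<in> {1..n} \<Longrightarrow> two_point n \<alpha> \<beta> y j = (if y j then
    \<beta> else \<alpha>)"
  by (simp add: two_point_def)

lemma Zset_I: "\<alpha> < d \<Longrightarrow> \<beta> < d \<Longrightarrow> proper y (nfword cs)
    \<Longrightarrow> two_point n \<alpha> \<beta> y \<in> Zset d n cs"
  unfolding Zset_def by blast

text \<open>The points of \<open>Zset\<close> are the constants together with, for every ordered pair of
    distinct
  colours, the colourings in which a chosen block end \<open>e\<^sub>0\<close> carries the second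
      colour.\<close>

lemma card_Zset_le:
  assumes T: "ik \<in> Tn n" and n: "1 \<le> n" and d: "1 \<le> d"
  shows "finite (Zset d n (cyc ik)) \<and> card (Zset d n (cyc ik)) \<le> card (Eset d n ik)"
proof -
  let ?cs = "cyc ik"
  let ?E = "{1..n} - Iset ik"
  let ?col = "colouring ?cs"
  note nf = nf_cyc(1)[OF T]
  have lets: "letters ?cs = Iset ik" by (rule letters_cyc[OF T])
  have "card ?E \<noteq> 0" using Iset_bounds[OF T n] n by linarith
  then obtain e0 where e0: "e0 \<in> ?E" by (metis card.empty ex_in_conv)
  \<comment> \<open>Exchanging the two colours complements the set of chosen block ends, so
    \<open>e0\<close> may be assumed chosen. Without letters the full set gives a constant point
    again and is removed.\<close>
  define Vs where "Vs = (if fst ik = [] then insert e0 ` Pow (?E - {e0}) - {?E} else insert e0 ` Pow (?E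
      - {e0}))"
  define OD where "OD = {(\<alpha>, \<beta>). \<alpha> < d \<and> \<beta> < d \<and> \<alpha> \<noteq> \<beta>}"
  define K where "K = (\<lambda>c. two_point n c c (\<lambda>_. True)) ` {..<d} \<union>
     (\<lambda>((\<alpha>, \<beta>), V). two_point n \<alpha> \<beta> (?col V)) ` (OD \<times> Vs)"
  have be: "block_end ?cs s \<in> ?E" if "s \<in> {1..n}" for s
  proof -
    have "n \<notin> letters ?cs" using Iset_bounds(1)[OF T n] n lets by auto
    then have "block_end ?cs s \<le> n" using that by (intro block_end_le) auto
    moreover have "1 \<le> block_end ?cs s" using block_end(1)[of s ?cs] that by simp
    ultimately show ?thesis using block_end(2)[of ?cs s] lets by simp
  qed
  have colV: "two_point n \<alpha> \<beta> (?col V) = two_point n \<alpha> \<beta> (?col (V \<inter>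
      ?E))" for \<alpha> \<beta> V
    unfolding two_point_def
  proof (rule restrict_ext)
    fix s assume "s \<in> {1..n}"
    from be[OF this] show "(if ?col V s then \<beta> else \<alpha>) = (if ?col (V \<inter> ?E) s then
        \<beta> else \<alpha>)"
      unfolding colouring_def by simp
  qed
  have flipV: "two_point n \<alpha> \<beta> (?col V) = two_point n \<beta> \<alpha> (?col (- V))" for
      \<alpha> \<beta> V
    unfolding two_point_def by (rule restrict_ext) (auto simp: colouring_def)
  have main: "two_point n \<alpha> \<beta> (?col V) \<in> K" if ab: "\<alpha> < d" "\<beta> < d" "e0
      \<in> V" for \<alpha> \<beta> V
  proof (cases "\<alpha> = \<beta>")
    case True
    then have "two_point n \<alpha> \<beta> (?col V) = two_point n \<alpha> \<alpha> (\<lambda>_. True)"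
        by (simp add: two_point_def)
    then show ?thesis
      unfolding K_def by (intro UnI1 image_eqI[of _ _ \<alpha>]) (simp_all add: ab)
  next
    case False
    let ?V = "V \<inter> ?E"
    have ins: "?V \<in> insert e0 ` Pow (?E - {e0})"
    proof
      show "?V = insert e0 (?V - {e0})" using ab(3) e0 by blast
    qed blast
    show ?thesis
    proof (cases "fst ik = [] \<and> ?V = ?E")
      case True
      then have "Iset ik = {}" using Iset_bounds(3)[OF T n] Iset_bounds(1)[OF T n] finite_subset
        unfolding weight_def by fastforce
      then have "two_point n \<alpha> \<beta> (?col ?V) = two_point n \<beta> \<beta> (\<lambda>_. True)"
        using True lets unfolding two_point_def
        by (intro restrict_ext) (simp add: colouring_end)
      then have "two_point n \<alpha> \<beta> (?col V) = two_point n \<beta> \<beta> (\<lambda>_. True)"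
        using colV[of \<alpha> \<beta> V] by simp
      then show ?thesis
        unfolding K_def by (intro UnI1 image_eqI[of _ _ \<beta>]) (simp_all add: ab)
    next
      case nc: False
      then have "?V \<in> Vs" using ins by (auto simp: Vs_def)
      then have "((\<alpha>, \<beta>), ?V) \<in> OD \<times> Vs" using ab False by (simp add: OD_def)
      then show ?thesis
        unfolding colV[of \<alpha> \<beta> V] K_def
        by (intro UnI2 image_eqI[of _ _ "((\<alpha>, \<beta>), ?V)"]) simp_all
    qed
  qed
  have sub: "Zset d n ?cs \<subseteq> K"
  proof
    fix \<chi> assume "\<chi> \<in> Zset d n ?cs"
    then obtain \<alpha> \<beta> y where ab: "\<alpha> < d" "\<beta> < d" "proper y (nfword ?cs)" and
        \<chi>: "\<chi> = two_point n \<alpha> \<beta> y"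
      by (auto simp: Zset_def)
    have "y = ?col {e. y e}" using proper_eq_colouring[OF nf ab(3)] by (rule ext)
    then have \<chi>': "\<chi> = two_point n \<alpha> \<beta> (?col {e. y e})" using \<chi> by simp
    show "\<chi> \<in> K"
    proof (cases "e0 \<in> {e. y e}")
      case True
      then show ?thesis unfolding \<chi>' by (intro main ab)
    next
      case False
      then show ?thesis unfolding \<chi>' flipV[of \<alpha>] by (intro main ab) simp
    qed
  qed
  have finVs: "finite Vs" by (simp add: Vs_def)
  have finOD: "finite OD"
    by (rule finite_subset[of _ "{..<d} \<times> {..<d}"]) (auto simp: OD_def)
  have finK: "finite K" unfolding K_def using finVs finOD by simp
  have cE: "card (?E - {e0}) = n - weight ik - 1"
    using e0 Iset_bounds(4)[OF T n] by simp
  have inj: "inj_on (insert e0) (Pow (?E - {e0}))" by (auto simp: inj_on_def)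
  have cI: "card (insert e0 ` Pow (?E - {e0})) = 2 ^ (n - weight ik - 1)"
    unfolding card_image[OF inj] using cE by (simp add: card_Pow)
  have cVs: "card Vs = (if fst ik = [] then 2 ^ (n - 1) - 1 else 2 ^ (n - weight ik - 1))"
  proof (cases "fst ik = []")
    case True
    have "?E \<in> insert e0 ` Pow (?E - {e0})"
    proof
      show "?E = insert e0 (?E - {e0})" using e0 by blast
    qed blast
    then show ?thesis
      using True cI Iset_bounds(3)[OF T n] by (simp add: Vs_def)
  next
    case False
    then show ?thesis using cI by (simp add: Vs_def)
  qed
  have cOD: "card OD = d * (d - 1)"
  proof -
    have "OD = (SIGMA \<alpha>:{..<d}. {..<d} - {\<alpha>})" by (auto simp: OD_def)
    then show ?thesis by (simp add: card_SigmaI)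
  qed
  have "card K \<le> d + d * (d - 1) * card Vs"
  proof -
    have "card K \<le> card ((\<lambda>c. two_point n c c (\<lambda>_. True)) ` {..<d}) +
      card ((\<lambda>((\<alpha>, \<beta>), V). two_point n \<alpha> \<beta> (?col V)) ` (OD \<times> Vs))"
      unfolding K_def by (rule card_Un_le)
    moreover have "card ((\<lambda>c. two_point n c c (\<lambda>_. True)) ` {..<d}) \<le> d"
      using card_image_le[of "{..<d}"] by simp
    moreover have "card ((\<lambda>((\<alpha>, \<beta>), V). two_point n \<alpha> \<beta> (?col V)) ` (OD
        \<times> Vs)) \<le> d * (d - 1) * card Vs"
      using card_image_le[of "OD \<times> Vs"] finOD finVs by (simp add: card_cartesian_product cOD)
    ultimately show ?thesis by linarith
  qed
  also have "\<dots> = card (Eset d n ik)"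
    unfolding cVs card_Eset_nat[OF T n d] by simp
  finally have "card K \<le> card (Eset d n ik)" .
  then show ?thesis
    using finite_subset[OF sub finK] card_mono[OF finK sub] by simp
qed

text \<open>For a nonempty word the first variable is opposite to the second. Giving all block ends
  the colour \<beta> leaves a polynomial in the value of the first variable, whose nonconstant
  coefficients come from the pair terms; these vanish. What remains involves only block ends, which
  are coloured freely, so the chain argument applies. For the empty word every colouring is proper
  and it applies at once.\<close>

theorem Eset_vanish:
  fixes q :: "nat \<Rightarrow> 'k::idom" and c :: "nat list \<Rightarrow> 'k"
  assumes T: "ik \<in> Tn n" and n: "1 \<le> n" and q: "inj_on q {..<d}"
    and van: "\<And>\<chi>. \<chi> \<in> Zset d n (cyc ik) \<Longrightarrow> (\<Sum>r\<in>Eset d n ik. c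
        r * monom_at q n r \<chi>) = 0"
    and r: "r \<in> Eset d n ik"
  shows "c r = 0"
proof -
  let ?U = "q ` {..<d}" and ?cs = "cyc ik"
  have U: "finite ?U" "d \<le> card ?U" using q by (simp_all add: card_image)
  note nf = nf_cyc(1)[OF T]
  show ?thesis
  proof (cases "fst ik = []")
    case True
    then have cs: "?cs = []" using cyc_eq_Nil[OF T] by simp
    let ?t = "to_tuple n n id"
    obtain e where e: "e \<in> chain_fam d n 1" "r = ?t e" using r Eset_Nil[OF True] by blast
    have "c (?t e) = 0"
    proof (rule chain_fam_vanish[OF U n _ e(1), of "\<lambda>e. c (?t e)"])
      fix z :: "nat \<Rightarrow> 'k" and \<alpha>' \<beta>' assume z: "\<alpha>' \<in> ?U" "\<beta>'
          \<in> ?U" "\<And>j. z j = \<alpha>' \<or> z j = \<beta>'"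
      obtain \<alpha> \<beta> where ab: "\<alpha> < d" "\<beta> < d" "\<alpha>' = q \<alpha>" "\<beta>' =
          q \<beta>" using z(1,2) by blast
      define \<chi> where "\<chi> = two_point n \<alpha> \<beta> (\<lambda>j. z j = \<beta>')"
      have "\<chi> \<in> Zset d n ?cs" unfolding \<chi>_def using ab by (intro Zset_I) (simp_all add: cs)
      from van[OF this]
      have "(\<Sum>e\<in>chain_fam d n 1. c (?t e) * monom_at q n (?t e) \<chi>) = 0"
        by (simp only: Eset_Nil[OF True] sum.reindex[OF inj_Eset_Nil[OF n]] comp_def)
      moreover have "monom_at q n (?t e) \<chi> = (\<Prod>j = 1..n. z j ^ e j)" for e
      proof -
        have "q (\<chi> j) = z j" if "j \<in> {1..n}" for j
          using z(3)[of j] ab that by (auto simp: \<chi>_def two_point_apply)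
        then show ?thesis by (simp add: monom_at_to_tuple)
      qed
      ultimately show "(\<Sum>e\<in>chain_fam d n 1. c (?t e) * (\<Prod>j = 1..n. z j ^ e j)) = 0" by simp
    qed
    then show ?thesis using e by simp
  next
    case False
    define N where "N = n - weight ik + 1"
    define vt where "vt = vtilde n ik"
    note v = vtilde_props[OF T False n, folded N_def vt_def]
    note f = first_block_end[OF T False]
    let ?t = "to_tuple n N vt"
    have inj: "inj_on ?t (pair_fam d \<union> chain_fam d N 2)"
      using inj_Eset_Cons[OF T False n, of d] by (simp only: N_def vt_def)
    have E: "Eset d n ik = ?t ` (pair_fam d \<union> chain_fam d N 2)"
      using Eset_Cons[OF False] by (simp only: N_def vt_def)
    have lets: "letters ?cs = Iset ik" by (rule letters_cyc[OF T])
    have vin: "vt j \<in> {1..n}" if "j \<in> {1..N}" for j using v(3) that by blast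
    have vend: "vt j \<notin> letters ?cs" if "j \<in> {2..N}" for j using v(4) that lets by blast
    have s1: "{1..N} = insert 1 {2..N}" using v(1) by auto
    have split: "(\<Sum>a\<in>{1..<d}. \<Sum>b<d. c (?t (pair_exp (a, b))) * (z 1 ^ a * z 2 ^ b)) +
        (\<Sum>e\<in>chain_fam d N 2. c (?t e) * (\<Prod>j = 2..N. z j ^ e j)) = 0"
      if \<chi>: "\<chi> \<in> Zset d n ?cs" and z: "\<And>j. j \<in> {1..N} \<Longrightarrow> q (\<chi>
          (vt j)) = z j" for \<chi> z
    proof -
      have ev: "monom_at q n (?t e) \<chi> = (\<Prod>j = 1..N. z j ^ e j)" for e
        using z by (simp add: monom_at_to_tuple[OF v(3)])
      have "0 = (\<Sum>e\<in>pair_fam d \<union> chain_fam d N 2. c (?t e) * (\<Prod>j = 1..N. z j ^ e j))"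
        using van[OF \<chi>] by (simp only: E sum.reindex[OF inj] ev comp_def)
      also have "\<dots> = (\<Sum>e\<in>pair_fam d. c (?t e) * (\<Prod>j = 1..N. z j ^ e j)) +
          (\<Sum>e\<in>chain_fam d N 2. c (?t e) * (\<Prod>j = 1..N. z j ^ e j))"
        by (rule sum.union_disjoint) (simp_all add: finite_pair_fam finite_chain_fam pair_fam_disjoint v(1))
      also have "(\<Sum>e\<in>pair_fam d. c (?t e) * (\<Prod>j = 1..N. z j ^ e j)) =
          (\<Sum>p\<in>{1..<d} \<times> {..<d}. c (?t (pair_exp p)) * (\<Prod>j = 1..N. z j ^ pair_exp p j))"
        unfolding pair_fam_def by (simp only: sum.reindex[OF inj_on_pair_exp] comp_def)
      also have "\<dots> = (\<Sum>(a, b)\<in>{1..<d} \<times> {..<d}. c (?t (pair_exp (a, b))) * (z 1 ^ a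
          * z 2 ^ b))"
      proof (intro sum.cong refl, clarify)
        fix a b
        have "{1..N} = insert 1 (insert 2 {3..N})" using v(1) by auto
        then have "(\<Prod>j = 1..N. z j ^ pair_exp (a, b) j) = z 1 ^ a * (z 2 ^ b * (\<Prod>j = 3..N. z
            j ^ pair_exp (a, b) j))"
          by (simp add: pair_exp_def)
        also have "(\<Prod>j = 3..N. z j ^ pair_exp (a, b) j) = 1"
          by (intro prod.neutral) (simp add: pair_exp_def)
        finally show "c (?t (pair_exp (a, b))) * (\<Prod>j = 1..N. z j ^ pair_exp (a, b) j) =
            c (?t (pair_exp (a, b))) * (z 1 ^ a * z 2 ^ b)" by simp
      qed
      also have "\<dots> = (\<Sum>a\<in>{1..<d}. \<Sum>b<d. c (?t (pair_exp (a, b))) * (z 1 ^ a * z 2 ^ b))"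
        by (simp only: sum.cartesian_product)
      also have "(\<Sum>e\<in>chain_fam d N 2. c (?t e) * (\<Prod>j = 1..N. z j ^ e j)) =
          (\<Sum>e\<in>chain_fam d N 2. c (?t e) * (\<Prod>j = 2..N. z j ^ e j))"
      proof (intro sum.cong refl)
        fix e assume "e \<in> chain_fam d N 2"
        then have "e 1 = 0" using chain_fam_support[OF _ v(1), of e d 1] by simp
        then show "c (?t e) * (\<Prod>j = 1..N. z j ^ e j) = c (?t e) * (\<Prod>j = 2..N. z j ^ e j)"
          unfolding s1 by simp
      qed
      finally show ?thesis by simp
    qed
    have col1: "colouring ?cs V (vt 1) \<longleftrightarrow> \<not> vt 2 \<in> V" for V
      unfolding colouring_def v(5) v(6) using f(2,3) unfolding f(1) by simp
    have pairs: "c (?t (pair_exp (a, b))) = 0" if "a \<in> {1..<d}" "b < d" for a b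
    proof -
      have z1: "(\<Sum>a\<in>{1..<d}. (\<Sum>b<d. c (?t (pair_exp (a, b))) * q \<beta> ^ b) * q \<alpha> ^ a) +
          (\<Sum>e\<in>chain_fam d N 2. c (?t e) * (\<Prod>j = 2..N. q \<beta> ^ e j)) = 0"
        if ab: "\<alpha> < d" "\<beta> < d" for \<alpha> \<beta>
      proof -
        define z where "z j = (if j = 1 then q \<alpha> else q \<beta>)" for j :: nat
        let ?\<chi> = "two_point n \<alpha> \<beta> (colouring ?cs UNIV)"
        have "?\<chi> \<in> Zset d n ?cs" using ab proper_colouring[OF nf] by (intro Zset_I)
        moreover have "q (?\<chi> (vt j)) = z j" if j: "j \<in> {1..N}" for j
        proof (cases "j = 1")
          case True
          then show ?thesis using vin[OF j] col1[of UNIV] by (simp add: two_point_apply z_def)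
        next
          case False
          then have "colouring ?cs UNIV (vt j)" using j vend[of j] by (simp add: colouring_end)
          then show ?thesis using False vin[OF j] by (simp add: two_point_apply z_def)
        qed
        ultimately have "(\<Sum>a\<in>{1..<d}. \<Sum>b<d. c (?t (pair_exp (a, b))) * (z 1 ^ a * z 2 ^ b)) +
            (\<Sum>e\<in>chain_fam d N 2. c (?t e) * (\<Prod>j = 2..N. z j ^ e j)) = 0"
          by (intro split)
        moreover have "(\<Prod>j = 2..N. z j ^ e j) = (\<Prod>j = 2..N. q \<beta> ^ e j)" for e
          by (intro prod.cong) (auto simp: z_def)
        moreover have "z 1 = q \<alpha>" "z 2 = q \<beta>" by (simp_all add: z_def)
        ultimately show ?thesis by (simp add: sum_distrib_left sum_distrib_right mult_ac)
      qed
      have "(\<Sum>b<d. c (?t (pair_exp (a, b))) * x ^ b) = 0" if x: "x \<in> ?U" for x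
      proof -
        obtain \<beta> where \<beta>: "\<beta> < d" "x = q \<beta>" using x by blast
        \<comment> \<open>The chain terms do not contain the first variable, so here they form the
          constant coefficient of the polynomial in its value.\<close>
        define D where "D a = (if a = 0 then (\<Sum>e\<in>chain_fam d N 2. c (?t e) * (\<Prod>j = 2..N. q
            \<beta> ^ e j))
          else (\<Sum>b<d. c (?t (pair_exp (a, b))) * q \<beta> ^ b))" for a
        have "(\<Sum>a<d. D a * x' ^ a) = 0" if "x' \<in> ?U" for x'
        proof -
          obtain \<alpha> where \<alpha>: "\<alpha> < d" "x' = q \<alpha>" using \<open>x' \<in>
              ?U\<close> by blast
          have "{..<d} = insert 0 {1..<d}" using \<open>b < d\<close> by auto
          then have "(\<Sum>a<d. D a * x' ^ a) = D 0 + (\<Sum>a\<in>{1..<d}. D a * x' ^ a)" by simp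
          also have "(\<Sum>a\<in>{1..<d}. D a * x' ^ a) =
              (\<Sum>a\<in>{1..<d}. (\<Sum>b<d. c (?t (pair_exp (a, b))) * q \<beta> ^ b) * q \<alpha> ^ a)"
            by (intro sum.cong) (auto simp: D_def \<alpha>)
          also have "D 0 + \<dots> = 0" using z1[OF \<alpha>(1) \<beta>(1)] by (simp add: D_def add.commute)
          finally show ?thesis .
        qed
        then have "D a = 0" using power_sum_vanish[OF U, of D a] \<open>a \<in> _\<close> by simp
        then show ?thesis using \<open>a \<in> _\<close> \<beta> by (simp add: D_def)
      qed
      then show ?thesis
        using power_sum_vanish[OF U, of "\<lambda>b. c (?t (pair_exp (a, b)))" b] \<open>b < d\<close> by simp
    qed
    have chains: "c (?t e) = 0" if "e \<in> chain_fam d N 2" for e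
    proof (rule chain_fam_vanish[OF U v(1) _ that, of "\<lambda>e. c (?t e)"])
      fix z :: "nat \<Rightarrow> 'k" and \<alpha>' \<beta>' assume z: "\<alpha>' \<in> ?U" "\<beta>'
          \<in> ?U" "\<And>j. z j = \<alpha>' \<or> z j = \<beta>'"
      obtain \<alpha> \<beta> where ab: "\<alpha> < d" "\<beta> < d" "\<alpha>' = q \<alpha>" "\<beta>' =
          q \<beta>" using z(1,2) by blast
      define V where "V = vt ` {j \<in> {2..N}. z j = \<beta>'}"
      let ?\<chi> = "two_point n \<alpha> \<beta> (colouring ?cs V)"
      \<comment> \<open>The first coordinate is whatever the colouring forces; the chain terms start
        at the second coordinate and do not see it.\<close>
      let ?z = "z(1 := q (?\<chi> (vt 1)))"
      have "?\<chi> \<in> Zset d n ?cs" using ab proper_colouring[OF nf] by (intro Zset_I)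
      moreover have "q (?\<chi> (vt j)) = ?z j" if j: "j \<in> {1..N}" for j
      proof (cases "j = 1")
        case False
        then have j2: "j \<in> {2..N}" using j by simp
        have "vt j \<in> V \<longleftrightarrow> z j = \<beta>'"
        proof
          assume "vt j \<in> V"
          then obtain i where i: "i \<in> {2..N}" "z i = \<beta>'" "vt j = vt i" unfolding V_def by blast
          then have "j = i" using inj_onD[OF v(2) i(3)] j by simp
          then show "z j = \<beta>'" using i by simp
        qed (use j2 V_def in blast)
        then have "q (?\<chi> (vt j)) = z j"
          using vin[OF j] vend[OF j2] z(3)[of j] ab by (auto simp: two_point_apply colouring_end)
        then show ?thesis using False by simp
      qed simp
      ultimately have "(\<Sum>a\<in>{1..<d}. \<Sum>b<d. c (?t (pair_exp (a, b))) * (?z 1 ^ a * ?z 2 ^ b)) +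
            (\<Sum>e\<in>chain_fam d N 2. c (?t e) * (\<Prod>j = 2..N. ?z j ^ e j)) = 0"
        by (intro split)
      moreover have "(\<Sum>a\<in>{1..<d}. \<Sum>b<d. c (?t (pair_exp (a, b))) * (?z 1 ^ a * ?z 2 ^ b)) = 0"
        by (intro sum.neutral ballI) (simp add: pairs)
      moreover have "(\<Prod>j = 2..N. ?z j ^ e j) = (\<Prod>j = 2..N. z j ^ e j)" for e
        by (intro prod.cong) auto
      ultimately show "(\<Sum>e\<in>chain_fam d N 2. c (?t e) * (\<Prod>j = 2..N. z j ^ e j)) = 0" by simp
    qed
    show ?thesis
      using r chains pairs unfolding E pair_fam_def by auto
  qed
qed

subsection \<open>Interpolation\<close>

text \<open>Gaussian elimination: solve one equation for the unknown \<open>p\<close> and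
  substitute, which removes one point and one unknown.\<close>

lemma homogeneous_system_nontrivial:
  fixes f :: "'e \<Rightarrow> 'z \<Rightarrow> 'k::field"
  assumes "finite Z" "finite E" "card Z < card E"
  shows "\<exists>c. (\<exists>r\<in>E. c r \<noteq> 0) \<and> (\<forall>x\<in>Z. (\<Sum>r\<in>E. c r * f
      r x) = 0)"
  using assms
proof (induction Z arbitrary: E f rule: finite_induct)
  case empty
  then obtain r where "r \<in> E" by fastforce
  then show ?case by (intro exI[of _ "\<lambda>_. 1"]) auto
next
  case (insert z Z)
  have cZ: "card Z < card E - 1" using insert by simp
  show ?case
  proof (cases "\<forall>r\<in>E. f r z = 0")
    case True
    have "card Z < card E" using cZ by simp
    from insert.IH[OF insert.prems(1) this, of f] obtain c where
      "\<exists>r\<in>E. c r \<noteq> 0" "\<forall>x\<in>Z. (\<Sum>r\<in>E. c r * f r x) = 0" by blast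
    moreover have "(\<Sum>r\<in>E. c r * f r z) = 0" using True by simp
    ultimately show ?thesis by blast
  next
    case False
    then obtain p where p: "p \<in> E" "f p z \<noteq> 0" by blast
    let ?E = "E - {p}"
    define g where "g r x = f r x - f r z / f p z * f p x" for r x
    have "finite ?E" "card Z < card ?E" using insert.prems p cZ by simp_all
    from insert.IH[OF this, of g] obtain c where
      c: "\<exists>r\<in>?E. c r \<noteq> 0" "\<forall>x\<in>Z. (\<Sum>r\<in>?E. c r * g r x) = 0" by blast
    define c' where "c' = c(p := - (\<Sum>r\<in>?E. c r * (f r z / f p z)))"
    have e: "(\<Sum>r\<in>E. c' r * f r x) = (\<Sum>r\<in>?E. c r * g r x)" for x
    proof -
      have "(\<Sum>r\<in>E. c' r * f r x) = c' p * f p x + (\<Sum>r\<in>?E. c' r * f r x)"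
        using insert.prems(1) p(1) by (rule sum.remove)
      also have "(\<Sum>r\<in>?E. c' r * f r x) = (\<Sum>r\<in>?E. c r * f r x)"
        by (intro sum.cong) (auto simp: c'_def)
      also have "c' p * f p x = - (\<Sum>r\<in>?E. c r * (f r z / f p z) * f p x)"
        by (simp add: c'_def sum_distrib_right)
      finally show ?thesis
        by (simp add: g_def right_diff_distrib sum_subtractf mult.assoc)
    qed
    have "g r z = 0" for r using p(2) by (simp add: g_def)
    then have "\<forall>x\<in>insert z Z. (\<Sum>r\<in>E. c' r * f r x) = 0" using c(2) by (simp add: e)
    moreover have "\<exists>r\<in>E. c' r \<noteq> 0" using c(1) by (auto simp: c'_def)
    ultimately show ?thesis by blast
  qed
qed

text \<open>With the target \<open>h\<close> adjoined there are more functions than points, so a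
  dependence exists, and by \<open>ind\<close> it involves \<open>h\<close>. Dividing by the
  coefficient of \<open>h\<close> requires a field.\<close>

lemma interpolation:
  fixes f :: "'e \<Rightarrow> 'z \<Rightarrow> 'k::field"
  assumes "finite Z" "finite E" "card Z \<le> card E"
    and ind: "\<And>c r. \<lbrakk>\<And>x. x \<in> Z \<Longrightarrow> (\<Sum>r\<in>E. c r * f r x) = 0;
        r \<in> E\<rbrakk> \<Longrightarrow> c r = 0"
  shows "\<exists>m. \<forall>x\<in>Z. (\<Sum>r\<in>E. m r * f r x) = h x"
proof -
  define F where "F = case_option h f"
  let ?E = "insert None (Some ` E)"
  have "card ?E = Suc (card E)" using assms(2) by (simp add: card_image)
  then have "finite ?E" "card Z < card ?E" using assms by simp_all
  from homogeneous_system_nontrivial[OF assms(1) this, of F] obtain c where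
    c: "\<exists>r\<in>?E. c r \<noteq> 0" "\<forall>x\<in>Z. (\<Sum>r\<in>?E. c r * F r x) = 0" by blast
  have s: "(\<Sum>r\<in>E. c (Some r) * f r x) = - c None * h x" if "x \<in> Z" for x
  proof -
    have "0 = (\<Sum>r\<in>?E. c r * F r x)" using c(2) that by simp
    also have "\<dots> = c None * h x + (\<Sum>r\<in>E. c (Some r) * f r x)"
      using assms(2) by (simp add: F_def sum.reindex)
    finally show ?thesis by (simp add: eq_neg_iff_add_eq_0 add.commute)
  qed
  have n: "c None \<noteq> 0"
  proof
    assume "c None = 0"
    then have "c (Some r) = 0" if "r \<in> E" for r
      using ind[of "\<lambda>r. c (Some r)", OF _ that] s by simp
    then show False using c(1) \<open>c None = 0\<close> by blast
  qed
  show ?thesis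
  proof (intro exI ballI)
    fix x assume "x \<in> Z"
    have "(\<Sum>r\<in>E. - c (Some r) / c None * f r x) = - (\<Sum>r\<in>E. c (Some r) * f r x) / c None"
      by (simp add: sum_divide_distrib sum_negf)
    also have "\<dots> = h x" using s[OF \<open>x \<in> Z\<close>] n by simp
    finally show "(\<Sum>r\<in>E. - c (Some r) / c None * f r x) = h x" .
  qed
qed

subsection \<open>Roots of unity\<close>

lemma cst_add: "cst (a + b) = cst a + cst b"
  by (simp add: cst_def single_add)

lemma cst_mult: "cst (a * b) = cst a * cst b"
  by (simp add: cst_def mult_single)

lemma cst_0 [simp]: "cst 0 = 0"
  by (simp add: cst_def)

lemma cst_1 [simp]: "cst 1 = 1"
  by (simp add: cst_def)

lemma cst_minus: "cst (- a) = - cst a"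
  by (simp add: cst_def single_uminus)

lemma cst_power: "cst (a ^ k) = cst a ^ k"
  by (induction k) (simp_all add: cst_mult)

lemma cst_sum: "cst (sum f A) = (\<Sum>x\<in>A. cst (f x))"
  by (induction A rule: infinite_finite_induct) (simp_all add: cst_add)

lemma inj_cst: "inj cst"
  by (rule injI) (metis cst_def lookup_single_eq)

lemma uu_nonzero: "uu \<noteq> 0"
  by (metis uu_def lookup_single_eq lookup_zero zero_neq_one)

definition zeta :: "nat \<Rightarrow> nat \<Rightarrow> complex" where
  "zeta d a = cis (2 * pi * real a / real d)"

lemma zeta_power: "1 \<le> d \<Longrightarrow> zeta d a ^ d = 1"
  by (simp add: zeta_def DeMoivre cis_multiple_2pi)

lemma zeta_nonzero [simp]: "zeta d a \<noteq> 0"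
  by (simp add: zeta_def)

lemma inj_on_zeta: "1 \<le> d \<Longrightarrow> inj_on (zeta d) {..<d}"
  using bij_betw_roots_unity[of d] unfolding zeta_def bij_betw_def by simp

lemma inj_on_cst_zeta: "1 \<le> d \<Longrightarrow> inj_on (\<lambda>a. cst (zeta d a)) {..<d}"
  using comp_inj_on[OF inj_on_zeta inj_on_subset[OF inj_cst subset_UNIV], of d] by (simp add: comp_def)

lemma root_sum:
  fixes x y :: complex
  assumes "x ^ d = 1" "y ^ d = 1" "1 \<le> d"
  shows "(\<Sum>s<d. x ^ s * inverse y ^ s) = (if x = y then of_nat d else 0)"
proof -
  have y: "y \<noteq> 0" using assms(2,3) by (cases "y = 0") (simp_all add: power_0_left)
  have e: "x ^ s * inverse y ^ s = (x / y) ^ s" for s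
    by (simp add: divide_inverse power_mult_distrib)
  show ?thesis
  proof (cases "x = y")
    case True
    then show ?thesis unfolding e using y by simp
  next
    case False
    then have "x / y \<noteq> 1" using y by simp
    then have "(\<Sum>s<d. (x / y) ^ s) = ((x / y) ^ d - 1) / (x / y - 1)" by (rule geometric_sum)
    then show ?thesis using False assms by (simp add: e power_divide)
  qed
qed

text \<open>The exponent \<open>(d - s) mod d\<close> encodes an inverse power within
  \<open>0..<d\<close>; the reduction matters only at \<open>s = 0\<close>.\<close>

lemma power_complement:
  fixes y :: complex
  assumes "y ^ d = 1" "s < d"
  shows "y ^ ((d - s) mod d) = inverse y ^ s"
proof (cases "s = 0")
  case False
  then have "y ^ ((d - s) mod d) * y ^ s = 1"
    using assms by (simp flip: power_add)
  then have "inverse (y ^ s) = y ^ ((d - s) mod d)"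
    by (intro inverse_unique) (simp add: mult.commute)
  then show ?thesis by (simp add: power_inverse)
qed simp

subsection \<open>Representations on functions of two-coloured states\<close>

text \<open>The Hecke generator on two neighbouring tensor factors of dimension two, in coordinates:
  \<open>-1\<close> on equal colours, and on the two mixed states a matrix with eigenvalues
  \<open>v\<close> and \<open>-1\<close>.\<close>

definition gact :: "laurent \<Rightarrow> nat \<Rightarrow> ((nat \<Rightarrow> bool) \<Rightarrow>
    laurent) \<Rightarrow> (nat \<Rightarrow> bool) \<Rightarrow> laurent" where
  "gact v i f y = (if y i = y (Suc i) then - f y
     else if y i then f (flip i y) else v * f (flip i y) + (v - 1) * f y)"

definition tact :: "nat \<Rightarrow> nat \<Rightarrow> nat \<Rightarrow> nat \<Rightarrow> ((nat
    \<Rightarrow> bool) \<Rightarrow> laurent) \<Rightarrow> (nat \<Rightarrow> bool) \<Rightarrow>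
        laurent" where
  "tact d \<alpha> \<beta> j f y = cst (zeta d (if y j then \<beta> else \<alpha>)) * f y"

text \<open>For equal eigenvalues e_i acts as the identity, which gives the parameter
  \<open>uu\<close>. Otherwise e_i vanishes on differing neighbours, where the generator must
  therefore square to one.\<close>

definition hpar :: "nat \<Rightarrow> nat \<Rightarrow> laurent" where
  "hpar \<alpha> \<beta> = (if \<alpha> = \<beta> then uu else 1)"

definition act :: "nat \<Rightarrow> nat \<Rightarrow> nat \<Rightarrow> gen \<Rightarrow> ((nat
    \<Rightarrow> bool) \<Rightarrow> laurent) \<Rightarrow> (nat \<Rightarrow> bool) \<Rightarrow>
        laurent" where
  "act d \<alpha> \<beta> x = (case x of G i \<Rightarrow> gact (hpar \<alpha> \<beta>) i | T j
      \<Rightarrow> tact d \<alpha> \<beta> j)"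

text \<open>The leftmost letter is the outermost operator. Its value at \<open>y\<close> uses the
  inner function at \<open>y\<close> and at a flip of \<open>y\<close>, so the letters move the
  state from left to right, as in \<open>run\<close>.\<close>

definition actw :: "nat \<Rightarrow> nat \<Rightarrow> nat \<Rightarrow> gen list \<Rightarrow> ((nat
    \<Rightarrow> bool) \<Rightarrow> laurent) \<Rightarrow> (nat \<Rightarrow> bool) \<Rightarrow>
        laurent" where
  "actw d \<alpha> \<beta> w f = foldr (act d \<alpha> \<beta>) w f"

lemma actw_Nil [simp]: "actw d \<alpha> \<beta> [] f = f"
  by (simp add: actw_def)

lemma actw_Cons [simp]: "actw d \<alpha> \<beta> (x # w) f = act d \<alpha> \<beta> x (actw d \<alpha>
    \<beta> w f)"
  by (simp add: actw_def)

lemma actw_append: "actw d \<alpha> \<beta> (u @ w) f = actw d \<alpha> \<beta> u (actw d \<alpha> \<beta> w f)"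
  by (simp add: actw_def)

lemma act_sum: "act d \<alpha> \<beta> x (\<lambda>y. \<Sum>k\<in>A. c k * F k y) = (\<lambda>y.
    \<Sum>k\<in>A. c k * act d \<alpha> \<beta> x (F k) y)"
proof (cases x)
  case (G i)
  have "(\<Sum>k\<in>A. c k * (hpar \<alpha> \<beta> * F k z + (hpar \<alpha> \<beta> - 1) * F k y)) =
    hpar \<alpha> \<beta> * (\<Sum>k\<in>A. c k * F k z) + (hpar \<alpha> \<beta> - 1) * (\<Sum>k\<in>A.
        c k * F k y)" for y z
    unfolding sum_distrib_left by (simp add: sum.distrib[symmetric] algebra_simps)
  then show ?thesis by (auto simp: G act_def gact_def fun_eq_iff sum_negf)
next
  case (T j)
  show ?thesis
    unfolding T act_def tact_def gen.case fun_eq_iff sum_distrib_left by (simp add: mult.left_commute)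
qed

lemma actw_sum: "actw d \<alpha> \<beta> w (\<lambda>y. \<Sum>k\<in>A. c k * F k y) = (\<lambda>y.
    \<Sum>k\<in>A. c k * actw d \<alpha> \<beta> w (F k) y)"
  by (induction w) (simp_all add: act_sum)

lemma actw_zero: "actw d \<alpha> \<beta> w (\<lambda>_. 0) = (\<lambda>_. 0)"
  using actw_sum[where A = "{}" and d = d and \<alpha> = \<alpha> and \<beta> = \<beta> and w = w] by simp

section \<open>Evaluating elements of the free algebra\<close>

definition fsupp :: "elt \<Rightarrow> bool" where
  "fsupp p \<longleftrightarrow> finite {w. p w \<noteq> 0}"

text \<open>A sum over an infinite support defaults to zero; the algebraic laws are therefore stated
  for elements of finite support.\<close>

definition Phi :: "nat \<Rightarrow> nat \<Rightarrow> nat \<Rightarrow> elt \<Rightarrow> ((nat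
    \<Rightarrow> bool) \<Rightarrow> laurent) \<Rightarrow> (nat \<Rightarrow> bool) \<Rightarrow>
        laurent" where
  "Phi d \<alpha> \<beta> p f y = (\<Sum>w | p w \<noteq> 0. p w * actw d \<alpha> \<beta> w f y)"

lemma Phi_superset:
  assumes "finite A" "{w. p w \<noteq> 0} \<subseteq> A"
  shows "Phi d \<alpha> \<beta> p f y = (\<Sum>w\<in>A. p w * actw d \<alpha> \<beta> w f y)"
  unfolding Phi_def using assms by (intro sum.mono_neutral_left) auto

lemma fsupp_wd [simp]: "fsupp (wd w)"
  unfolding fsupp_def wd_def mono_def by (rule finite_subset[of _ "{w}"]) auto

lemma Phi_wd: "Phi d \<alpha> \<beta> (wd w) f y = actw d \<alpha> \<beta> w f y"
  using Phi_superset[of "{w}" "wd w" d \<alpha> \<beta> f y] by (auto simp: wd_def mono_def)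

lemma fsupp_ncsub [simp]: "fsupp p \<Longrightarrow> fsupp q \<Longrightarrow> fsupp (ncsub p q)"
  unfolding fsupp_def ncsub_def
  by (rule finite_subset[of _ "{w. p w \<noteq> 0} \<union> {w. q w \<noteq> 0}"]) auto

lemma fsupp_ncadd [simp]: "fsupp p \<Longrightarrow> fsupp q \<Longrightarrow> fsupp (ncadd p q)"
  unfolding fsupp_def ncadd_def
  by (rule finite_subset[of _ "{w. p w \<noteq> 0} \<union> {w. q w \<noteq> 0}"]) auto

lemma fsupp_ncsmult [simp]: "fsupp p \<Longrightarrow> fsupp (ncsmult c p)"
  unfolding fsupp_def ncsmult_def by (erule finite_subset[rotated]) auto

lemma fsupp_ncsum [simp]:
  assumes "\<And>j. j \<in> J \<Longrightarrow> fsupp (F j)"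
  shows "fsupp (ncsum F J)"
proof (cases "finite J")
  case True
  have "{w. ncsum F J w \<noteq> 0} \<subseteq> (\<Union>j\<in>J. {w. F j w \<noteq> 0})"
    by (auto simp: ncsum_def intro: sum.not_neutral_contains_not_neutral)
  moreover have "finite (\<Union>j\<in>J. {w. F j w \<noteq> 0})" using True assms by (simp add: fsupp_def)
  ultimately show ?thesis unfolding fsupp_def by (rule finite_subset)
qed (simp add: ncsum_def fsupp_def)

lemma Phi_ncsub:
  assumes "fsupp p" "fsupp q"
  shows "Phi d \<alpha> \<beta> (ncsub p q) f y = Phi d \<alpha> \<beta> p f y - Phi d \<alpha> \<beta> q f y"
proof -
  let ?A = "{w. p w \<noteq> 0} \<union> {w. q w \<noteq> 0}"
  have "finite ?A" using assms by (simp add: fsupp_def)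
  then have "Phi d \<alpha> \<beta> x f y = (\<Sum>w\<in>?A. x w * actw d \<alpha> \<beta> w f y)"
    if "x = p \<or> x = q \<or> x = ncsub p q" for x
    using that by (intro Phi_superset) (auto simp: ncsub_def)
  then show ?thesis by (simp add: ncsub_def left_diff_distrib sum_subtractf)
qed

lemma Phi_ncadd:
  assumes "fsupp p" "fsupp q"
  shows "Phi d \<alpha> \<beta> (ncadd p q) f y = Phi d \<alpha> \<beta> p f y + Phi d \<alpha> \<beta> q f y"
proof -
  let ?A = "{w. p w \<noteq> 0} \<union> {w. q w \<noteq> 0}"
  have "finite ?A" using assms by (simp add: fsupp_def)
  then have "Phi d \<alpha> \<beta> x f y = (\<Sum>w\<in>?A. x w * actw d \<alpha> \<beta> w f y)"
    if "x = p \<or> x = q \<or> x = ncadd p q" for x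
    using that by (intro Phi_superset) (auto simp: ncadd_def)
  then show ?thesis by (simp add: ncadd_def distrib_right sum.distrib)
qed

lemma Phi_ncsmult:
  assumes "fsupp p"
  shows "Phi d \<alpha> \<beta> (ncsmult c p) f y = c * Phi d \<alpha> \<beta> p f y"
proof -
  let ?A = "{w. p w \<noteq> 0}"
  have "finite ?A" using assms by (simp add: fsupp_def)
  then have "Phi d \<alpha> \<beta> x f y = (\<Sum>w\<in>?A. x w * actw d \<alpha> \<beta> w f y)"
    if "x = p \<or> x = ncsmult c p" for x
    using that by (intro Phi_superset) (auto simp: ncsmult_def)
  then show ?thesis by (simp add: ncsmult_def sum_distrib_left mult.assoc)
qed

lemma Phi_ncsum:
  assumes "finite J" "\<And>j. j \<in> J \<Longrightarrow> fsupp (F j)"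
  shows "Phi d \<alpha> \<beta> (ncsum F J) f y = (\<Sum>j\<in>J. Phi d \<alpha> \<beta> (F j) f y)"
  using assms
proof (induction J rule: finite_induct)
  case empty
  then show ?case by (simp add: ncsum_def Phi_def)
next
  case (insert j J)
  have "ncsum F (insert j J) = ncadd (F j) (ncsum F J)"
    using insert.hyps by (simp add: ncsum_def ncadd_def fun_eq_iff)
  then show ?case using insert by (simp add: Phi_ncadd)
qed

text \<open>The cut positions of \<open>w\<close> correspond to its factorisations into two words,
  and products outside the supports vanish. In this form \<open>ncmult\<close> can be compared with
  composition of operators and with the product of the monoid algebra.\<close>

lemma ncmult_pairs:
  assumes "finite A" "finite B" "{w. p w \<noteq> 0} \<subseteq> A" "{w. q w \<noteq> 0} \<subseteq> B"
  shows "ncmult p q w = (\<Sum>(u, v) | (u, v) \<in> A \<times> B \<and> u @ v = w. p u * q v)"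
proof -
  let ?S = "(\<lambda>k. (take k w, drop k w)) ` {0..length w}"
  have inj: "inj_on (\<lambda>k. (take k w, drop k w)) {0..length w}"
    by (rule inj_onI) (metis atLeastAtMost_iff length_take min.absorb2 prod.inject)
  have "ncmult p q w = (\<Sum>(u, v)\<in>?S. p u * q v)"
    unfolding ncmult_def by (simp add: sum.reindex[OF inj])
  also have "\<dots> = (\<Sum>(u, v) | (u, v) \<in> A \<times> B \<and> u @ v = w. p u * q v)"
  proof (rule sum.mono_neutral_cong)
    show "finite {(u, v). (u, v) \<in> A \<times> B \<and> u @ v = w}"
      by (rule finite_subset[of _ "A \<times> B"]) (use assms in auto)
    fix x assume x: "x \<in> ?S - {(u, v). (u, v) \<in> A \<times> B \<and> u @ v = w}"
    then obtain k where "x = (take k w, drop k w)" by blast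
    then show "(case x of (u, v) \<Rightarrow> p u * q v) = 0" using x assms by auto
  next
    fix x assume x: "x \<in> {(u, v). (u, v) \<in> A \<times> B \<and> u @ v = w} - ?S"
    then obtain u v where uv: "x = (u, v)" "u @ v = w" by blast
    then have "x = (take (length u) w, drop (length u) w)" "length u \<in> {0..length w}" by auto
    then have "x \<in> ?S" by (rule image_eqI)
    then show "(case x of (u, v) \<Rightarrow> p u * q v) = 0" using x by blast
  qed simp_all
  finally show ?thesis .
qed

lemma ncmult_support:
  assumes "fsupp p" "fsupp q"
  shows "{w. ncmult p q w \<noteq> 0} \<subseteq> (\<lambda>(u, v). u @ v) ` ({w. p w \<noteq> 0}
      \<times> {w. q w \<noteq> 0})"
proof
  fix w assume "w \<in> {w. ncmult p q w \<noteq> 0}"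
  then have "(\<Sum>k\<in>{0..length w}. p (take k w) * q (drop k w)) \<noteq> 0" by (simp add: ncmult_def)
  then obtain k where "p (take k w) * q (drop k w) \<noteq> 0"
    by (rule sum.not_neutral_contains_not_neutral)
  then have "(take k w, drop k w) \<in> {w. p w \<noteq> 0} \<times> {w. q w \<noteq> 0}" by auto
  then show "w \<in> (\<lambda>(u, v). u @ v) ` ({w. p w \<noteq> 0} \<times> {w. q w \<noteq> 0})"
    by (rule image_eqI[rotated]) simp
qed

lemma fsupp_ncmult [simp]: "fsupp p \<Longrightarrow> fsupp q \<Longrightarrow> fsupp (ncmult p q)"
  unfolding fsupp_def by (rule finite_subset[OF ncmult_support]) (simp_all add: fsupp_def)

lemma Phi_ncmult:
  assumes "fsupp p" "fsupp q"
  shows "Phi d \<alpha> \<beta> (ncmult p q) f y = Phi d \<alpha> \<beta> p (Phi d \<alpha> \<beta> q f) y"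
proof -
  let ?A = "{w. p w \<noteq> 0}" and ?B = "{w. q w \<noteq> 0}"
  let ?C = "(\<lambda>(u, v). u @ v) ` (?A \<times> ?B)"
  have fin: "finite ?A" "finite ?B" using assms by (simp_all add: fsupp_def)
  have "Phi d \<alpha> \<beta> (ncmult p q) f y = (\<Sum>w\<in>?C. ncmult p q w * actw d \<alpha> \<beta>
      w f y)"
    using fin by (intro Phi_superset ncmult_support assms) simp
  also have "\<dots> = (\<Sum>w\<in>?C. \<Sum>x | x \<in> ?A \<times> ?B \<and> (case x of (u, v)
      \<Rightarrow> u @ v) = w.
      case x of (u, v) \<Rightarrow> p u * q v * actw d \<alpha> \<beta> (u @ v) f y)"
  proof (intro sum.cong refl)
    fix w
    have "ncmult p q w = (\<Sum>x | x \<in> ?A \<times> ?B \<and> (case x of (u, v) \<Rightarrow> u @ v)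
        = w. case x of (u, v) \<Rightarrow> p u * q v)"
      unfolding ncmult_pairs[OF fin order_refl order_refl] by (intro sum.cong) auto
    then show "ncmult p q w * actw d \<alpha> \<beta> w f y =
      (\<Sum>x | x \<in> ?A \<times> ?B \<and> (case x of (u, v) \<Rightarrow> u @ v) = w.
        case x of (u, v) \<Rightarrow> p u * q v * actw d \<alpha> \<beta> (u @ v) f y)"
      unfolding sum_distrib_right by (auto intro!: sum.cong simp: sum_distrib_right)
  qed
  also have "\<dots> = (\<Sum>x\<in>?A \<times> ?B. case x of (u, v) \<Rightarrow> p u * q v * actw d
      \<alpha> \<beta> (u @ v) f y)"
    using fin by (intro sum.image_gen[symmetric]) simp
  also have "\<dots> = (\<Sum>u\<in>?A. \<Sum>v\<in>?B. p u * q v * actw d \<alpha> \<beta> u (actw d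
      \<alpha> \<beta> v f) y)"
    by (simp add: sum.cartesian_product actw_append)
  also have "\<dots> = (\<Sum>u\<in>?A. p u * actw d \<alpha> \<beta> u (\<lambda>y. \<Sum>v\<in>?B. q v
      * actw d \<alpha> \<beta> v f y) y)"
    unfolding actw_sum by (simp add: sum_distrib_left mult.assoc)
  also have "\<dots> = Phi d \<alpha> \<beta> p (Phi d \<alpha> \<beta> q f) y"
    unfolding Phi_def ..
  finally show ?thesis .
qed

lemma act_G [simp]: "act d \<alpha> \<beta> (G i) = gact (hpar \<alpha> \<beta>) i"
  by (simp add: act_def)

lemma act_T [simp]: "act d \<alpha> \<beta> (T j) = tact d \<alpha> \<beta> j"
  by (simp add: act_def)

lemma actw_replicate_T:
  "actw d \<alpha> \<beta> (replicate k (T j)) f y = cst (zeta d (if y j then \<beta> else \<alpha>)) ^ k * f y"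
  by (induction k) (simp_all add: tact_def mult.assoc)

section \<open>Checking the defining relations\<close>

lemma flip_commute: "Suc i < j \<Longrightarrow> flip i (flip j y) = flip j (flip i y)"
  by (auto simp: flip_apply fun_eq_iff)

lemma gact_commute:
  assumes "Suc i < j"
  shows "gact v i (gact v j f) y = gact v j (gact v i f) y"
proof -
  have "flip j y i = y i" "flip j y (Suc i) = y (Suc i)" "flip i y j = y j" "flip i y (Suc j) = y (Suc j)"
    using assms by (auto simp: flip_apply)
  then show ?thesis
    by (simp add: gact_def flip_commute[OF assms] algebra_simps)
qed

text \<open>Naming a state by its values at three neighbouring positions reduces the three-letter
  relations to eight colour patterns.\<close>

definition upd3 :: "(nat \<Rightarrow> bool) \<Rightarrow> nat \<Rightarrow> bool \<Rightarrow> bool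
    \<Rightarrow> bool \<Rightarrow> nat \<Rightarrow> bool" where
  "upd3 y i a b c = y(i := a, Suc i := b, Suc (Suc i) := c)"

lemma gact_upd3:
  "gact v i f (upd3 y i a b c) = (if a = b then - f (upd3 y i a b c)
     else if a then f (upd3 y i b a c) else v * f (upd3 y i b a c) + (v - 1) * f (upd3 y i a b c))"
  "gact v (Suc i) f (upd3 y i a b c) = (if b = c then - f (upd3 y i a b c)
     else if b then f (upd3 y i a c b) else v * f (upd3 y i a c b) + (v - 1) * f (upd3 y i a b c))"
proof -
  have fl: "flip i (upd3 y i a b c) = upd3 y i b a c" "flip (Suc i) (upd3 y i a b c) = upd3 y i a c b"
    for a b c by (auto simp: flip_apply upd3_def fun_eq_iff)
  have ev: "upd3 y i a b c i = a" "upd3 y i a b c (Suc i) = b" "upd3 y i a b c (Suc (Suc i)) = c"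
    for a b c by (simp_all add: upd3_def)
  show
    "gact v i f (upd3 y i a b c) = (if a = b then - f (upd3 y i a b c)
     else if a then f (upd3 y i b a c) else v * f (upd3 y i b a c) + (v - 1) * f (upd3 y i a b c))"
    "gact v (Suc i) f (upd3 y i a b c) = (if b = c then - f (upd3 y i a b c)
     else if b then f (upd3 y i a c b) else v * f (upd3 y i a c b) + (v - 1) * f (upd3 y i a b c))"
    by (simp_all only: gact_def fl ev)
qed

lemma upd3_self: "y = upd3 y i (y i) (y (Suc i)) (y (Suc (Suc i)))"
  by (simp add: upd3_def)

lemma gact_braid:
  "gact v i (gact v (Suc i) (gact v i f)) y = gact v (Suc i) (gact v i (gact v (Suc i) f)) y"
proof -
  have "gact v i (gact v (Suc i) (gact v i f)) (upd3 y i a b c) =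
      gact v (Suc i) (gact v i (gact v (Suc i) f)) (upd3 y i a b c)" for a b c
    by (cases a; cases b; cases c) (simp_all add: gact_upd3 algebra_simps)
  then show ?thesis using upd3_self by metis
qed

text \<open>Conceptually this is the vanishing of the third exterior power of a two-dimensional
  space, in its Hecke deformation; the proof computes all colour patterns.\<close>

lemma gact_TL:
  "gact v i (gact v (Suc i) (gact v i f)) y + gact v i (gact v (Suc i) f) y
    + gact v (Suc i) (gact v i f) y + gact v i f y + gact v (Suc i) f y + f y = 0"
proof -
  have "gact v i (gact v (Suc i) (gact v i f)) (upd3 y i a b c) + gact v i (gact v (Suc i) f) (upd3 y i a b c)
    + gact v (Suc i) (gact v i f) (upd3 y i a b c) + gact v i f (upd3 y i a b c)
    + gact v (Suc i) f (upd3 y i a b c) + f (upd3 y i a b c) = 0" for a b c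
    by (cases a; cases b; cases c) (simp_all add: gact_upd3 algebra_simps)
  then show ?thesis using upd3_self by metis
qed

text \<open>For equal eigenvalues \<open>tact\<close> is a scalar. For distinct ones the parameter
  is one, and the diagonal term of \<open>gact\<close> on differing neighbours, which would not
  intertwine the two positions, disappears.\<close>

lemma gact_tact:
  "tact d \<alpha> \<beta> j (gact (hpar \<alpha> \<beta>) i f) y = gact (hpar \<alpha> \<beta>) i (tact
      d \<alpha> \<beta> (sw i j) f) y"
proof (cases "y i = y (Suc i)")
  case True
  then have "y (sw i j) = y j" by (auto simp: sw_def)
  then show ?thesis using True by (simp add: gact_def tact_def)
next
  case False
  have "flip i y (sw i j) = y j" by (auto simp: flip_apply sw_def)
  then show ?thesis
    using False by (cases "\<alpha> = \<beta>") (simp_all add: gact_def tact_def hpar_def algebra_simps)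
qed

text \<open>The first branch covers the states on which e_i acts as the identity; on equal
  neighbours the generator is \<open>-1\<close> and the two extra terms cancel.\<close>

lemma gact_square:
  "gact (hpar \<alpha> \<beta>) i (gact (hpar \<alpha> \<beta>) i f) y =
    (if \<alpha> = \<beta> \<or> y i = y (Suc i) then f y + (uu - 1) * f y + (uu - 1) * gact (hpar
        \<alpha> \<beta>) i f y else f y)"
proof (cases "y i = y (Suc i)")
  case True
  then show ?thesis by (simp add: gact_def)
next
  case False
  have "flip i y i = y (Suc i)" "flip i y (Suc i) = y i" by (auto simp: flip_apply)
  then show ?thesis
    using False by (cases "y i"; cases "\<alpha> = \<beta>") (simp_all add: gact_def hpar_def algebra_simps)
qed

lemma e_coeff:
  assumes "1 \<le> d" "a < d" "b < d"
  shows "cst (1 / of_nat d) * (\<Sum>s\<in>{0..<d}. cst (zeta d a) ^ s * cst (zeta d b) ^ ((d - s) mod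
      d)) = of_bool (a = b)"
proof -
  have "(\<Sum>s\<in>{0..<d}. zeta d a ^ s * zeta d b ^ ((d - s) mod d)) = (\<Sum>s<d. zeta d a ^ s *
      inverse (zeta d b) ^ s)"
    by (intro sum.cong) (auto simp: power_complement zeta_power assms)
  also have "\<dots> = (if zeta d a = zeta d b then of_nat d else 0)"
    by (intro root_sum zeta_power assms)
  also have "zeta d a = zeta d b \<longleftrightarrow> a = b"
    using inj_on_zeta[OF assms(1)] assms by (simp add: inj_on_eq_iff)
  finally have "1 / of_nat d * (\<Sum>s\<in>{0..<d}. zeta d a ^ s * zeta d b ^ ((d - s) mod d)) = of_bool
      (a = b)"
    using assms(1) by simp
  then have "cst (1 / of_nat d * (\<Sum>s\<in>{0..<d}. zeta d a ^ s * zeta d b ^ ((d - s) mod d))) =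
      of_bool (a = b)"
    by (simp add: of_bool_def split: if_splits)
  then show ?thesis by (simp only: cst_mult cst_sum cst_power)
qed

lemma fsupp_e_el [simp]: "fsupp (e_el d i)"
  by (simp add: e_el_def)

lemma Phi_e_el:
  assumes "1 \<le> d" "\<alpha> < d" "\<beta> < d"
  shows "Phi d \<alpha> \<beta> (e_el d i) f y = of_bool (\<alpha> = \<beta> \<or> y i = y (Suc i)) * f y"
proof -
  let ?a = "if y i then \<beta> else \<alpha>" and ?b = "if y (Suc i) then \<beta> else \<alpha>"
  have "Phi d \<alpha> \<beta> (e_el d i) f y = cst (1 / of_nat d) * (\<Sum>s\<in>{0..<d}.
      cst (zeta d ?a) ^ s * (cst (zeta d ?b) ^ ((d - s) mod d) * f y))"
    unfolding e_el_def by (simp add: Phi_ncsmult Phi_ncsum Phi_wd actw_append actw_replicate_T)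
  also have "\<dots> = cst (1 / of_nat d) * (\<Sum>s\<in>{0..<d}. cst (zeta d ?a) ^ s * cst (zeta d ?b) ^
      ((d - s) mod d)) * f y"
    by (simp only: mult.assoc sum_distrib_right)
  also have "\<dots> = of_bool (?a = ?b) * f y"
    using e_coeff[OF assms(1), of ?a ?b] assms by simp
  also have "?a = ?b \<longleftrightarrow> \<alpha> = \<beta> \<or> y i = y (Suc i)" by auto
  finally show ?thesis .
qed

lemma Phi_Y_rels:
  assumes d: "1 \<le> d" "\<alpha> < d" "\<beta> < d" and x: "x \<in> Y_rels d n"
  shows "fsupp x \<and> (\<forall>f y. Phi d \<alpha> \<beta> x f y = 0)"
proof -
  consider (far) i j where "x = ncsub (wd [G i, G j]) (wd [G j, G i])" "i + 1 < j \<or> j + 1 < i"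
    | (braid) i where "x = ncsub (wd [G i, G (i+1), G i]) (wd [G (i+1), G i, G (i+1)])"
    | (tt) i j where "x = ncsub (wd [T i, T j]) (wd [T j, T i])"
    | (tg) i j where "x = ncsub (wd [T j, G i]) (wd [G i, T (sw i j)])"
    | (td) j where "x = ncsub (wd (replicate d (T j))) (wd [])"
    | (quad) i where "x = ncsub (wd [G i, G i]) (ncadd (wd []) (ncadd (ncsmult (uu - 1) (e_el d i))
          (ncsmult (uu - 1) (ncmult (e_el d i) (wd [G i])))))"
    using x unfolding Y_rels_def Un_iff mem_Collect_eq by blast
  then show ?thesis
  proof cases
    case far
    then show ?thesis using gact_commute[of i j] gact_commute[of j i] by (auto simp: Phi_ncsub Phi_wd)
  next
    case braid
    then show ?thesis by (simp add: Phi_ncsub Phi_wd gact_braid)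
  next
    case tt
    then show ?thesis by (simp add: Phi_ncsub Phi_wd tact_def mult.left_commute)
  next
    case tg
    then show ?thesis by (simp add: Phi_ncsub Phi_wd gact_tact)
  next
    case td
    have "cst (zeta d a) ^ d = 1" for a using zeta_power[OF d(1)] by (metis cst_1 cst_power)
    then show ?thesis using td by (simp add: Phi_ncsub Phi_wd actw_replicate_T)
  next
    case quad
    have "Phi d \<alpha> \<beta> (ncadd (wd []) (ncadd (ncsmult (uu - 1) (e_el d i))
          (ncsmult (uu - 1) (ncmult (e_el d i) (wd [G i]))))) f y =
        gact (hpar \<alpha> \<beta>) i (gact (hpar \<alpha> \<beta>) i f) y" for f y
    proof -
      have "Phi d \<alpha> \<beta> (wd [G i]) f = gact (hpar \<alpha> \<beta>) i f" by (rule ext) (simp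
          add: Phi_wd)
      then have "Phi d \<alpha> \<beta> (ncadd (wd []) (ncadd (ncsmult (uu - 1) (e_el d i))
          (ncsmult (uu - 1) (ncmult (e_el d i) (wd [G i]))))) f y =
          f y + ((uu - 1) * (of_bool (\<alpha> = \<beta> \<or> y i = y (Suc i)) * f y) +
            (uu - 1) * (of_bool (\<alpha> = \<beta> \<or> y i = y (Suc i)) * gact (hpar \<alpha> \<beta>)
                i f y))"
        by (simp add: Phi_ncadd Phi_ncsmult Phi_ncmult Phi_wd Phi_e_el[OF d])
      then show ?thesis unfolding gact_square by (simp add: add.assoc)
    qed
    then show ?thesis using quad by (simp add: Phi_ncsub Phi_wd)
  qed
qed

lemma Phi_TL_rels:
  assumes "x \<in> TL_rels n"
  shows "fsupp x \<and> (\<forall>f y. Phi d \<alpha> \<beta> x f y = 0)"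
proof -
  obtain i where x: "x = ncsum wd {[G i, G (i+1), G i], [G i, G (i+1)], [G (i+1), G i], [G i], [G (i+1)], []}"
    using assms unfolding TL_rels_def by blast
  have "Phi d \<alpha> \<beta> x f y = 0" for f y
    using gact_TL[of "hpar \<alpha> \<beta>" i f y] unfolding x
    by (subst Phi_ncsum) (simp_all add: Phi_wd add.assoc)
  then show ?thesis unfolding x by simp
qed

lemma Phi_ideal:
  assumes d: "1 \<le> d" "\<alpha> < d" "\<beta> < d" and x: "x \<in> YTL_ideal d n"
  shows "fsupp x \<and> (\<forall>f y. Phi d \<alpha> \<beta> x f y = 0)"
  using x unfolding YTL_ideal_def
proof induction
  case (gen r)
  then show ?case using Phi_Y_rels[OF d] Phi_TL_rels by blast
next
  case zero
  then show ?case by (simp add: fsupp_def Phi_def)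
next
  case (add x y)
  then show ?case by (simp add: Phi_ncadd)
next
  case (lmult x p)
  then have p: "fsupp p" by (simp add: freealg_def fsupp_def)
  have "Phi d \<alpha> \<beta> x f = (\<lambda>_. 0)" for f using lmult by (simp add: fun_eq_iff)
  moreover have "Phi d \<alpha> \<beta> p (\<lambda>_. 0) y = 0" for y by (simp add: Phi_def actw_zero)
  ultimately show ?case using lmult p by (simp add: Phi_ncmult)
next
  case (rmult x p)
  then have p: "fsupp p" by (simp add: freealg_def fsupp_def)
  then show ?case using rmult by (simp add: Phi_ncmult)
qed

subsection \<open>Linear independence\<close>

text \<open>The value at \<open>y\<close> after a letter depends only on the values at
  \<open>y\<close> and at its flip, so a nonzero result needs a path of swaps and stays into the
  support of \<open>f\<close>.\<close>

lemma gact_word_support: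
  assumes "actw d \<alpha> \<beta> (map G w) f y \<noteq> 0"
  shows "\<exists>x. reach y w x \<and> f x \<noteq> 0"
  using assms
proof (induction w arbitrary: y)
  case Nil
  then show ?case using reach_Nil by auto
next
  case (Cons a w)
  let ?h = "actw d \<alpha> \<beta> (map G w) f"
  have "?h y \<noteq> 0 \<or> ?h (flip a y) \<noteq> 0"
    using Cons.prems by (auto simp: gact_def split: if_splits)
  then show ?case using Cons.IH reach_swap reach_stay by blast
qed

lemma hpar_nonzero: "hpar \<alpha> \<beta> \<noteq> 0"
  using uu_nonzero by (simp add: hpar_def)

text \<open>Of the two branches at a letter the staying one dies: the rest of the word has one
  occurrence of that letter too few to reach the required height. The swapping branch has
  coefficient one or the parameter, both nonzero in a domain.\<close>

lemma gact_word_proper: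
  assumes "proper y w" "0 \<notin> set w" "\<And>s. \<bar>height (run y w) s - height y s\<bar> = int
      (count (mset w) s)"
  shows "actw d \<alpha> \<beta> (map G w) (\<lambda>z. of_bool (z = run y w)) y \<noteq> 0"
  using assms
proof (induction w arbitrary: y)
  case Nil
  then show ?case by simp
next
  case (Cons a w)
  let ?f = "\<lambda>z. of_bool (z = run y (a # w)) :: laurent"
  let ?h = "actw d \<alpha> \<beta> (map G w) ?f"
  have a: "1 \<le> a" and w: "0 \<notin> set w" using Cons.prems(2) by (auto simp: Suc_le_eq)
  have pr: "y a \<noteq> y (Suc a)" "proper (flip a y) w" using Cons.prems(1) by auto
  have stay: "?h y = 0"
  proof (rule ccontr)
    assume "?h y \<noteq> 0"
    from gact_word_support[OF this] have "reach y w (run y (a # w))" by auto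
    from height_reach_le[OF this w, of a] Cons.prems(3)[of a] show False by simp
  qed
  have r: "reach z u (run z u)" for z and u :: "nat list"
    by (induction u arbitrary: z) (auto intro: reach_Nil reach_swap)
  have "\<bar>height (run (flip a y) w) s - height (flip a y) s\<bar> = int (count (mset w) s)" for s
    using height_reach_le[OF r w, of "flip a y" s] Cons.prems(3)[of s] height_flip[OF a, of y s]
    by (cases "s = a") (auto simp: of_bool_def split: if_splits)
  from Cons.IH[OF pr(2) w this] have "?h (flip a y) \<noteq> 0" by simp
  then show ?case using stay pr(1) hpar_nonzero by (simp add: gact_def)
qed

lemma actw_tword:
  "actw d \<alpha> \<beta> (tword n r) f y = monom_at (\<lambda>a. cst (zeta d a)) n r (two_point n
      \<alpha> \<beta> y) * f y"
proof -
  have "actw d \<alpha> \<beta> (concat (map (\<lambda>j. replicate (r ! (j - 1)) (T j)) js)) f y =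
     (\<Prod>j\<leftarrow>js. cst (zeta d (if y j then \<beta> else \<alpha>)) ^ (r ! (j - 1))) * f y" for js
    by (induction js arbitrary: f) (simp_all add: actw_append actw_replicate_T mult.assoc)
  moreover have "(\<Prod>j\<leftarrow>[1..<n + 1]. cst (zeta d (if y j then \<beta> else \<alpha>)) ^ (r
      ! (j - 1))) =
      monom_at (\<lambda>a. cst (zeta d a)) n r (two_point n \<alpha> \<beta> y)"
  proof -
    have s: "set [1..<n + 1] = {1..n}" by auto
    have "(\<Prod>j\<leftarrow>[1..<n + 1]. cst (zeta d (if y j then \<beta> else \<alpha>)) ^ (r ! (j - 1))) =
        (\<Prod>j\<in>set [1..<n + 1]. cst (zeta d (if y j then \<beta> else \<alpha>)) ^ (r ! (j - 1)))"
      by (rule prod.distinct_set_conv_list[OF distinct_upt, symmetric])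
    then show ?thesis unfolding monom_at_def s by (simp add: two_point_apply)
  qed
  ultimately show ?thesis unfolding tword_def by simp
qed

text \<open>Words are treated from the longest down. At a point of the current word, take the
  indicator of the state to which the word leads: longer words already have zero coefficients, and
  other words of at most this length do not reach that state. So the coefficient polynomial vanishes
  at every point of the word.\<close>

theorem Svec_independent:
  assumes d: "1 \<le> d" and n: "1 \<le> n" and fin: "finite (Sidx d n)"
    and mem: "ncsum (\<lambda>j. ncsmult (c j) (Svec n j)) (Sidx d n) \<in> YTL_ideal d n"
    and j: "j \<in> Sidx d n"
  shows "c j = 0"
proof -
  define P where "P ik \<chi> = (\<Sum>r\<in>Eset d n ik. c (ik, r) * monom_at (\<lambda>a. cst (zeta d
      a)) n r \<chi>)" for ik \<chi>
  have Sig: "Sidx d n = Sigma (Tn n) (Eset d n)" by (auto simp: Sidx_def)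
  have rel: "(\<Sum>ik\<in>Tn n. P ik (two_point n \<alpha> \<beta> y) * actw d \<alpha> \<beta> (gword
      ik) f y) = 0"
    if ab: "\<alpha> < d" "\<beta> < d" for \<alpha> \<beta> y f
  proof -
    have "0 = Phi d \<alpha> \<beta> (ncsum (\<lambda>j. ncsmult (c j) (Svec n j)) (Sidx d n)) f y"
      using Phi_ideal[OF d ab mem] by simp
    also have "\<dots> = (\<Sum>(ik, r)\<in>Sidx d n. c (ik, r) * actw d \<alpha> \<beta> (tword n r @
        gword ik) f y)"
      using fin
      by (subst Phi_ncsum) (auto simp: Phi_ncsmult Phi_wd Svec_def wd_def[symmetric] intro!: sum.cong)
    also have "\<dots> = (\<Sum>ik\<in>Tn n. \<Sum>r\<in>Eset d n ik. c (ik, r) * actw d \<alpha> \<beta>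
        (tword n r @ gword ik) f y)"
      unfolding Sig using finite_Tn finite_Eset[OF _ n] by (intro sum.Sigma[symmetric]) auto
    also have "\<dots> = (\<Sum>ik\<in>Tn n. P ik (two_point n \<alpha> \<beta> y) * actw d \<alpha>
        \<beta> (gword ik) f y)"
      unfolding P_def by (simp add: sum_distrib_right actw_append actw_tword mult.assoc)
    finally show ?thesis by simp
  qed
  have main: "\<forall>r\<in>Eset d n ik. c (ik, r) = 0" if "ik \<in> Tn n" for ik
    using that
  proof (induction "Max (insert 0 ((\<lambda>ik. length (gword ik)) ` Tn n)) - length (gword ik)"
      arbitrary: ik rule: less_induct)
    case less
    let ?M = "Max (insert 0 ((\<lambda>ik. length (gword ik)) ` Tn n))"
    let ?cs = "cyc ik"
    note T = less.prems
    note nf = nf_cyc(1)[OF T]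
    have long: "P ik' \<chi> = 0" if T': "ik' \<in> Tn n" and gt: "length (gword ik) < length (gword
        ik')" for ik' \<chi>
    proof -
      have "length (gword ik') \<le> ?M" using T' finite_Tn by (intro Max_ge) auto
      then have "?M - length (gword ik') < ?M - length (gword ik)" using gt by linarith
      from less.hyps[OF this T'] show ?thesis by (simp add: P_def)
    qed
    have "P ik \<chi> = 0" if Z: "\<chi> \<in> Zset d n ?cs" for \<chi>
    proof -
      obtain \<alpha> \<beta> y where ab: "\<alpha> < d" "\<beta> < d" and pr: "proper y (nfword ?cs)"
        and \<chi>: "\<chi> = two_point n \<alpha> \<beta> y" using Z unfolding Zset_def by blast
      define x where "x = run y (nfword ?cs)"
      define f where "f = (\<lambda>z. of_bool (z = x) :: laurent)"
      have pos: "0 \<notin> set (nfword ?cs)"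
        using letters_pos[OF nf] by (force simp: set_nfword)
      have "actw d \<alpha> \<beta> (gword ik) f y \<noteq> 0"
        unfolding gword_cyc[OF T] f_def x_def
        using height_nfword[OF nf pr] by (intro gact_word_proper pr pos) auto
      moreover have rest: "P ik' \<chi> * actw d \<alpha> \<beta> (gword ik') f y = 0" if T': "ik' \<in>
          Tn n - {ik}" for ik'
      proof (cases "length (gword ik) < length (gword ik')")
        case True
        then show ?thesis using long T' by simp
      next
        case False
        show ?thesis
        proof (rule ccontr)
          assume "P ik' \<chi> * actw d \<alpha> \<beta> (gword ik') f y \<noteq> 0"
          then have "actw d \<alpha> \<beta> (map G (nfword (cyc ik'))) f y \<noteq> 0"
            using gword_cyc[of ik' n] T' by auto
          from gact_word_support[OF this] have "reach y (nfword (cyc ik')) x"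
            by (auto simp: f_def)
          then have "cyc ik' = ?cs"
            using nf_unique[OF nf pr, of "cyc ik'"] nf_cyc(1)[of ik' n] T' False
              gword_cyc[OF T] gword_cyc[of ik' n] by (simp add: x_def)
          then show False using inj_on_cyc[of n] T T' by (auto dest: inj_onD)
        qed
      qed
      moreover have "(\<Sum>ik'\<in>Tn n. P ik' \<chi> * actw d \<alpha> \<beta> (gword ik') f y) =
          P ik \<chi> * actw d \<alpha> \<beta> (gword ik) f y + (\<Sum>ik'\<in>Tn n - {ik}. P ik' \<chi>
              * actw d \<alpha> \<beta> (gword ik') f y)"
        using finite_Tn T by (rule sum.remove)
      moreover have "(\<Sum>ik'\<in>Tn n - {ik}. P ik' \<chi> * actw d \<alpha> \<beta> (gword ik') f y) = 0"
        using rest by (rule sum.neutral[OF ballI])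
      moreover have "(\<Sum>ik'\<in>Tn n. P ik' \<chi> * actw d \<alpha> \<beta> (gword ik') f y) = 0"
        using rel[OF ab, of y f] by (simp only: \<chi>)
      ultimately show ?thesis by simp
    qed
    then show ?case
      using Eset_vanish[OF T n inj_on_cst_zeta[OF d], of "\<lambda>r. c (ik, r)"] unfolding P_def by blast
  qed
  obtain ik r where "j = (ik, r)" by (cases j)
  then show ?thesis using j main by (auto simp: Sidx_def)
qed

subsection \<open>Calculations modulo a two-sided ideal\<close>

text \<open>Calculations stay in the ring itself, with congruence modulo \<open>J\<close> in place
  of equality in a quotient.\<close>

locale two_sided_ideal =
  fixes J :: "'a::ring_1 set"
  assumes J_zero: "0 \<in> J"
    and J_add: "x \<in> J \<Longrightarrow> y \<in> J \<Longrightarrow> x + y \<in> J"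
    and J_lmult: "x \<in> J \<Longrightarrow> p * x \<in> J"
    and J_rmult: "x \<in> J \<Longrightarrow> x * p \<in> J"
begin

definition eqv :: "'a \<Rightarrow> 'a \<Rightarrow> bool" (infix "\<approx>" 50) where
  "x \<approx> y \<longleftrightarrow> x - y \<in> J"

lemma J_uminus: "x \<in> J \<Longrightarrow> - x \<in> J"
  using J_lmult[of x "- 1"] by simp

lemma J_sum: "(\<And>k. k \<in> A \<Longrightarrow> f k \<in> J) \<Longrightarrow> sum f A \<in> J"
  by (induction A rule: infinite_finite_induct) (simp_all add: J_zero J_add)

lemma eqv_refl [simp]: "x \<approx> x"
  by (simp add: eqv_def J_zero)

lemma eqv_sym: "x \<approx> y \<Longrightarrow> y \<approx> x"
  unfolding eqv_def using J_uminus[of "x - y"] by simp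

lemma eqv_trans [trans]: "x \<approx> y \<Longrightarrow> y \<approx> z \<Longrightarrow> x \<approx> z"
  unfolding eqv_def using J_add[of "x - y" "y - z"] by simp

lemma eqv_add: "x \<approx> x' \<Longrightarrow> y \<approx> y' \<Longrightarrow> x + y \<approx> x' + y'"
  unfolding eqv_def using J_add[of "x - x'" "y - y'"] by (simp add: algebra_simps)

lemma eqv_uminus: "x \<approx> x' \<Longrightarrow> - x \<approx> - x'"
  unfolding eqv_def using J_uminus[of "x - x'"] by simp

lemma eqv_lmult: "x \<approx> x' \<Longrightarrow> p * x \<approx> p * x'"
  unfolding eqv_def using J_lmult[of "x - x'" p] by (simp add: algebra_simps)

lemma eqv_rmult: "x \<approx> x' \<Longrightarrow> x * p \<approx> x' * p"
  unfolding eqv_def using J_rmult[of "x - x'" p] by (simp add: algebra_simps)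

lemma eqv_sum: "(\<And>k. k \<in> A \<Longrightarrow> f k \<approx> h k) \<Longrightarrow> sum f A
    \<approx> sum h A"
  unfolding eqv_def sum_subtractf[symmetric] by (rule J_sum)

lemma eqv_zero: "x \<approx> 0 \<longleftrightarrow> x \<in> J"
  by (simp add: eqv_def)

lemma J_eqv: "x \<approx> y \<Longrightarrow> y \<in> J \<Longrightarrow> x \<in> J"
  unfolding eqv_def using J_add[of "x - y" y] by simp

end

primrec gpart :: "gen list \<Rightarrow> nat list" where
  "gpart [] = []"
| "gpart (x # w) = (case x of G i \<Rightarrow> i # gpart w | T j \<Rightarrow> gpart w)"

lemma gpart_append: "gpart (u @ w) = gpart u @ gpart w"
  by (induction u) (auto split: gen.split)

lemma gpart_T [simp]: "gpart (map T js) = []" "gpart (replicate k (T j)) = []"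
  by (induction js, simp_all) (induction k, simp_all)

lemma gpart_G [simp]: "gpart (map G w) = w"
  by (induction w) simp_all

text \<open>The presentation is imposed only modulo \<open>J\<close>, whereas the scalars \<kappa>
  form an honest central homomorphism; the instance used later is the monoid algebra of
  words.\<close>

locale ytl = two_sided_ideal J for J :: "'a::ring_1 set" +
  fixes \<kappa> :: "laurent \<Rightarrow> 'a" and g t :: "nat \<Rightarrow> 'a" and d n :: nat
  assumes d1: "1 \<le> d"
    and \<kappa>_add: "\<kappa> (a + b) = \<kappa> a + \<kappa> b"
    and \<kappa>_mult: "\<kappa> (a * b) = \<kappa> a * \<kappa> b"
    and \<kappa>_one: "\<kappa> 1 = 1"
    and \<kappa>_central: "\<kappa> a * x = x * \<kappa> a"
    and rel_far: "\<lbrakk>1 \<le> i; Suc i < j; j < n\<rbrakk> \<Longrightarrow> g i * g j \<approx> g j * g i"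
    and rel_braid: "\<lbrakk>1 \<le> i; Suc i < n\<rbrakk> \<Longrightarrow> g i * g (Suc i) * g i
        \<approx> g (Suc i) * g i * g (Suc i)"
    and rel_tt: "\<lbrakk>i \<in> {1..n}; j \<in> {1..n}\<rbrakk> \<Longrightarrow> t i * t j \<approx> t
        j * t i"
    and rel_tg: "\<lbrakk>i \<in> {1..<n}; j \<in> {1..n}\<rbrakk> \<Longrightarrow> t j * g i \<approx>
        g i * t (sw i j)"
    and rel_td: "j \<in> {1..n} \<Longrightarrow> t j ^ d \<approx> 1"
    and rel_quad: "i \<in> {1..<n} \<Longrightarrow> g i * g i \<approx> 1 + \<kappa> (uu - 1) *
        (\<kappa> (cst (1 / of_nat d)) * (\<Sum>s\<in>{0..<d}. t i ^ s * t (Suc i) ^ ((d - s) mod d))) +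
            \<kappa> (uu - 1) *
        (\<kappa> (cst (1 / of_nat d)) * (\<Sum>s\<in>{0..<d}. t i ^ s * t (Suc i) ^ ((d - s) mod d)) * g i)"
    and rel_TL: "\<lbrakk>1 \<le> i; Suc i < n\<rbrakk> \<Longrightarrow>
        g i * g (Suc i) * g i + g i * g (Suc i) + g (Suc i) * g i + g i + g (Suc i) + 1 \<in> J"
begin

declare \<kappa>_one [simp]

lemma \<kappa>_zero [simp]: "\<kappa> 0 = 0"
  using \<kappa>_add[of 0 0] by simp

lemma \<kappa>_uminus: "\<kappa> (- a) = - \<kappa> a"
  using \<kappa>_add[of a "- a"] by (simp add: eq_neg_iff_add_eq_0 add.commute)

lemma \<kappa>_sum: "\<kappa> (sum f A) = (\<Sum>x\<in>A. \<kappa> (f x))"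
  by (induction A rule: infinite_finite_induct) (simp_all add: \<kappa>_add)

abbreviation z :: "complex \<Rightarrow> 'a" where "z c \<equiv> \<kappa> (cst c)"

lemma z_mult: "z (a * b) = z a * z b"
  by (simp add: cst_mult \<kappa>_mult)

text \<open>Distinct complex constants differ by a unit, also inside the Laurent ring, so an element
  with two eigenvalues vanishes modulo \<open>J\<close>.\<close>

lemma J_of_eigen:
  assumes "z a * x \<approx> z b * x" "a \<noteq> b"
  shows "x \<in> J"
proof -
  have "cst (a - b) = cst a - cst b" using cst_add[of a "- b"] by (simp add: cst_minus)
  then have "z (a - b) = z a - z b" using \<kappa>_add[of "cst a" "- cst b"] by (simp add: \<kappa>_uminus)
  then have "z (a - b) * x \<in> J" using assms(1) by (simp add: eqv_def left_diff_distrib)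
  then have "z (1 / (a - b)) * (z (a - b) * x) \<in> J" by (rule J_lmult)
  moreover have "z (1 / (a - b)) * (z (a - b) * x) = x"
    using assms(2) by (simp add: mult.assoc[symmetric] z_mult[symmetric])
  ultimately show ?thesis by simp
qed

definition val :: "gen \<Rightarrow> 'a" where
  "val x = (case x of G i \<Rightarrow> g i | T j \<Rightarrow> t j)"

definition vp :: "gen list \<Rightarrow> 'a" where
  "vp w = prod_list (map val w)"

definition gp :: "nat list \<Rightarrow> 'a" where
  "gp w = prod_list (map g w)"

definition tp :: "nat list \<Rightarrow> 'a" where
  "tp js = prod_list (map t js)"

lemma vp_simps [simp]: "vp [] = 1" "vp (x # w) = val x * vp w" "vp (u @ w) = vp u * vp w"
  by (simp_all add: vp_def)

lemma gp_simps [simp]: "gp [] = 1" "gp (a # w) = g a * gp w" "gp (u @ w) = gp u * gp w"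
  by (simp_all add: gp_def)

lemma tp_simps [simp]: "tp [] = 1" "tp (a # w) = t a * tp w" "tp (u @ w) = tp u * tp w"
  by (simp_all add: tp_def)

lemma vp_map_G: "vp (map G w) = gp w" and vp_map_T: "vp (map T js) = tp js"
  by (simp_all add: vp_def gp_def tp_def val_def comp_def)

lemma vp_replicate_T: "vp (replicate k (T j)) = t j ^ k"
  by (induction k) (simp_all add: val_def)

subsection \<open>Weight idempotents\<close>

definition idem :: "nat \<Rightarrow> nat \<Rightarrow> 'a" where
  "idem j a = z (1 / of_nat d) * (\<Sum>s<d. z (inverse (zeta d a) ^ s) * t j ^ s)"

lemma t_power_commute:
  assumes "i \<in> {1..n}" "j \<in> {1..n}"
  shows "t i * t j ^ s \<approx> t j ^ s * t i"
proof (induction s)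
  case (Suc s)
  have "t i * t j ^ Suc s = t i * t j * t j ^ s" by (simp add: mult.assoc)
  also have "\<dots> \<approx> t j * t i * t j ^ s" by (intro eqv_rmult rel_tt assms)
  also have "t j * t i * t j ^ s = t j * (t i * t j ^ s)" by (simp add: mult.assoc)
  also have "\<dots> \<approx> t j * (t j ^ s * t i)" by (intro eqv_lmult Suc)
  also have "t j * (t j ^ s * t i) = t j ^ Suc s * t i" by (simp add: mult.assoc)
  finally show ?case .
qed simp

lemma idem_commute:
  assumes "i \<in> {1..n}" "j \<in> {1..n}"
  shows "t i * idem j a \<approx> idem j a * t i"
proof -
  have "t i * idem j a = z (1 / of_nat d) * (\<Sum>s<d. z (inverse (zeta d a) ^ s) * (t i * t j ^ s))"
    unfolding idem_def
    by (simp add: mult.assoc[symmetric] \<kappa>_central[of _ "t i"] sum_distrib_left)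
  also have "\<dots> \<approx> z (1 / of_nat d) * (\<Sum>s<d. z (inverse (zeta d a) ^ s) * (t j ^ s * t i))"
    by (intro eqv_lmult eqv_sum t_power_commute assms)
  also have "\<dots> = idem j a * t i"
    unfolding idem_def by (simp add: mult.assoc sum_distrib_right)
  finally show ?thesis .
qed

text \<open>Multiplication by \<open>t j\<close> shifts the Fourier sum by one place; the term that
  leaves and the one that enters agree because \<open>t j ^ d\<close> is congruent to one.\<close>

lemma idem_eigen:
  assumes "j \<in> {1..n}"
  shows "t j * idem j a \<approx> z (zeta d a) * idem j a"
proof -
  let ?w = "zeta d a"
  define f where "f s = z (inverse ?w ^ s) * t j ^ s" for s
  have shift: "t j * f s = z ?w * f (Suc s)" for s
  proof -
    have "?w * inverse ?w ^ Suc s = inverse ?w ^ s" by (simp add: mult.assoc[symmetric])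
    then have "z ?w * f (Suc s) = z (inverse ?w ^ s) * t j ^ Suc s"
      unfolding f_def mult.assoc[symmetric] z_mult[symmetric] by (simp only:)
    also have "\<dots> = z (inverse ?w ^ s) * t j * t j ^ s" by (simp add: mult.assoc)
    also have "\<dots> = t j * f s" by (simp add: f_def \<kappa>_central[of _ "t j"] mult.assoc)
    finally show ?thesis by simp
  qed
  have "f d \<approx> f 0"
  proof -
    have "inverse ?w ^ d = 1" using zeta_power[OF d1] by (simp add: power_inverse)
    then show ?thesis using rel_td[OF assms] by (simp add: f_def)
  qed
  then have "(\<Sum>s<d. f (Suc s)) \<approx> (\<Sum>s<d. f s)"
  proof -
    have "f 0 + (\<Sum>s<d. f (Suc s)) = (\<Sum>s<d. f s) + f d"
      by (simp only: sum.lessThan_Suc_shift[symmetric] sum.lessThan_Suc)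
    then have "(\<Sum>s<d. f (Suc s)) - (\<Sum>s<d. f s) = f d - f 0"
      by (metis add_diff_cancel_left' add_diff_eq diff_diff_eq2 diff_add_eq diff_diff_add add.commute)
    then show ?thesis using \<open>f d \<approx> f 0\<close> by (simp add: eqv_def)
  qed
  note * = this
  have "t j * idem j a = z (1 / of_nat d) * (\<Sum>s<d. t j * f s)"
    unfolding idem_def f_def
    by (simp add: mult.assoc[symmetric] \<kappa>_central[of _ "t j"] sum_distrib_left)
  also have "\<dots> = z (1 / of_nat d) * (z ?w * (\<Sum>s<d. f (Suc s)))"
    by (simp add: shift sum_distrib_left)
  also have "\<dots> \<approx> z (1 / of_nat d) * (z ?w * (\<Sum>s<d. f s))"
    by (intro eqv_lmult *)
  also have "\<dots> = z ?w * idem j a"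
    unfolding idem_def f_def by (simp add: mult.assoc[symmetric] \<kappa>_central[of _ "z ?w"])
  finally show ?thesis .
qed

text \<open>An identity of the ring, not a congruence: by orthogonality the sum over
  \<open>a\<close> keeps only the coefficient of \<open>t j ^ 0\<close>, where
  \<open>zeta d a ^ s\<close> is symmetric in \<open>a\<close> and \<open>s\<close>.\<close>

lemma sum_idem: "(\<Sum>a<d. idem j a) = 1"
proof -
  have e: "zeta d a ^ s = zeta d s ^ a" for a s
    by (simp add: zeta_def DeMoivre mult_ac)
  have zs: "(1 / of_nat d) * (\<Sum>a<d. inverse (zeta d a) ^ s) = of_bool (s = 0)" if "s < d" for s
  proof -
    have "(\<Sum>a<d. inverse (zeta d a) ^ s) = (\<Sum>a<d. 1 ^ a * inverse (zeta d s) ^ a)"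
      by (simp add: power_inverse e)
    also have "\<dots> = (if 1 = zeta d s then of_nat d else 0)"
      by (intro root_sum zeta_power d1) simp
    also have "1 = zeta d s \<longleftrightarrow> s = 0"
    proof -
      have "zeta d 0 = 1" by (simp add: zeta_def)
      then have "1 = zeta d s \<longleftrightarrow> zeta d 0 = zeta d s" by simp
      also have "\<dots> \<longleftrightarrow> 0 = s"
        using inj_on_zeta[OF d1] d1 that by (intro inj_on_eq_iff) auto
      finally show ?thesis by auto
    qed
    finally show ?thesis using d1 by simp
  qed
  have "(\<Sum>a<d. idem j a) = (\<Sum>a<d. \<Sum>s<d. z (1 / of_nat d * inverse (zeta d a) ^ s) * t j ^ s)"
    by (simp only: idem_def sum_distrib_left mult.assoc[symmetric] z_mult[symmetric])
  also have "\<dots> = (\<Sum>s<d. \<Sum>a<d. z (1 / of_nat d * inverse (zeta d a) ^ s) * t j ^ s)"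
    by (rule sum.swap)
  also have "\<dots> = (\<Sum>s<d. z (1 / of_nat d * (\<Sum>a<d. inverse (zeta d a) ^ s)) * t j ^ s)"
    unfolding sum_distrib_left cst_sum \<kappa>_sum sum_distrib_right ..
  also have "\<dots> = (\<Sum>s<d. if s = 0 then 1 else 0)"
    by (intro sum.cong refl) (simp only: zs lessThan_iff, simp)
  also have "\<dots> = 1" using d1 by simp
  finally show ?thesis .
qed

primrec EE :: "nat \<Rightarrow> (nat \<Rightarrow> nat) \<Rightarrow> 'a" where
  "EE 0 \<chi> = 1"
| "EE (Suc k) \<chi> = EE k \<chi> * idem (Suc k) (\<chi> (Suc k))"

lemma EE_commute:
  assumes "j \<in> {1..n}" "k \<le> n"
  shows "t j * EE k \<chi> \<approx> EE k \<chi> * t j"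
  using assms(2)
proof (induction k)
  case (Suc k)
  have "t j * EE (Suc k) \<chi> = t j * EE k \<chi> * idem (Suc k) (\<chi> (Suc k))" by (simp add: mult.assoc)
  also have "\<dots> \<approx> EE k \<chi> * t j * idem (Suc k) (\<chi> (Suc k))"
    using Suc by (intro eqv_rmult) simp
  also have "EE k \<chi> * t j * idem (Suc k) (\<chi> (Suc k)) = EE k \<chi> * (t j * idem (Suc k)
      (\<chi> (Suc k)))"
    by (simp add: mult.assoc)
  also have "\<dots> \<approx> EE k \<chi> * (idem (Suc k) (\<chi> (Suc k)) * t j)"
    using Suc.prems by (intro eqv_lmult idem_commute assms(1)) simp
  also have "EE k \<chi> * (idem (Suc k) (\<chi> (Suc k)) * t j) = EE (Suc k) \<chi> * t j" by (simp add:
      mult.assoc)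
  finally show ?case .
qed simp

lemma EE_eigen:
  assumes "j \<in> {1..k}" "k \<le> n"
  shows "t j * EE k \<chi> \<approx> z (zeta d (\<chi> j)) * EE k \<chi>"
  using assms
proof (induction k)
  case (Suc k)
  show ?case
  proof (cases "j = Suc k")
    case True
    have "t j * EE (Suc k) \<chi> = t j * EE k \<chi> * idem j (\<chi> j)" by (simp add: mult.assoc True)
    also have "\<dots> \<approx> EE k \<chi> * t j * idem j (\<chi> j)"
      using Suc.prems by (intro eqv_rmult EE_commute) simp_all
    also have "EE k \<chi> * t j * idem j (\<chi> j) = EE k \<chi> * (t j * idem j (\<chi> j))" by (simp
        add: mult.assoc)
    also have "\<dots> \<approx> EE k \<chi> * (z (zeta d (\<chi> j)) * idem j (\<chi> j))"
      using Suc.prems by (intro eqv_lmult idem_eigen) simp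
    also have "\<dots> = z (zeta d (\<chi> j)) * EE (Suc k) \<chi>"
      by (simp add: True mult.assoc[symmetric] \<kappa>_central[of _ "EE k \<chi>"])
    finally show ?thesis .
  next
    case False
    then have "t j * EE k \<chi> \<approx> z (zeta d (\<chi> j)) * EE k \<chi>" using Suc by simp
    from eqv_rmult[OF this, of "idem (Suc k) (\<chi> (Suc k))"] show ?thesis by (simp add: mult.assoc)
  qed
qed simp

definition Ch :: "(nat \<Rightarrow> nat) set" where
  "Ch = {1..n} \<rightarrow>\<^sub>E {..<d}"

definition E :: "(nat \<Rightarrow> nat) \<Rightarrow> 'a" where
  "E = EE n"

lemma finite_Ch [simp]: "finite Ch"
  by (simp add: Ch_def finite_PiE)

lemma EE_cong: "(\<And>j. j \<in> {1..k} \<Longrightarrow> \<chi> j = \<psi> j) \<Longrightarrow> EE k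
    \<chi> = EE k \<psi>"
  by (induction k) simp_all

lemma sum_EE: "(\<Sum>\<chi>\<in>{1..k} \<rightarrow>\<^sub>E {..<d}. EE k \<chi>) = 1"
proof (induction k)
  case (Suc k)
  let ?P = "{1..k} \<rightarrow>\<^sub>E {..<d}"
  have s: "{1..Suc k} = insert (Suc k) {1..k}" by auto
  have inj: "inj_on (\<lambda>(y, h). h(Suc k := y)) ({..<d} \<times> ?P)"
    using inj_combinator[of "Suc k" "{1..k}" "\<lambda>_. {..<d}"] by simp
  have "(\<Sum>\<chi>\<in>{1..Suc k} \<rightarrow>\<^sub>E {..<d}. EE (Suc k) \<chi>) =
      (\<Sum>(a, h)\<in>{..<d} \<times> ?P. EE (Suc k) (h(Suc k := a)))"
    unfolding s PiE_insert_eq by (subst sum.reindex[OF inj]) (simp add: case_prod_unfold comp_def)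
  also have "\<dots> = (\<Sum>(a, h)\<in>{..<d} \<times> ?P. EE k h * idem (Suc k) a)"
  proof (intro sum.cong refl, clarify)
    fix a h
    have "EE k (h(Suc k := a)) = EE k h" by (rule EE_cong) auto
    then show "EE (Suc k) (h(Suc k := a)) = EE k h * idem (Suc k) a" by simp
  qed
  also have "\<dots> = (\<Sum>a<d. \<Sum>h\<in>?P. EE k h * idem (Suc k) a)"
    by (simp only: sum.cartesian_product)
  also have "\<dots> = (\<Sum>a<d. idem (Suc k) a)"
    unfolding sum_distrib_right[symmetric] Suc.IH by simp
  finally show ?case by (simp add: sum_idem)
qed (simp add: PiE_empty_domain)

lemma sum_E: "(\<Sum>\<chi>\<in>Ch. E \<chi>) = 1"
  unfolding Ch_def E_def by (rule sum_EE)

lemma t_E: "j \<in> {1..n} \<Longrightarrow> t j * E \<chi> \<approx> z (zeta d (\<chi> j)) * E \<chi>"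
  unfolding E_def by (rule EE_eigen) simp_all

lemma E_t: "j \<in> {1..n} \<Longrightarrow> E \<chi> * t j \<approx> z (zeta d (\<chi> j)) * E \<chi>"
  unfolding E_def using eqv_trans[OF eqv_sym[OF EE_commute] EE_eigen] by simp

lemma zeta_eq_iff: "a < d \<Longrightarrow> b < d \<Longrightarrow> zeta d a = zeta d b
    \<longleftrightarrow> a = b"
  using inj_on_zeta[OF d1] by (simp add: inj_on_eq_iff)

lemma Ch_less: "\<chi> \<in> Ch \<Longrightarrow> j \<in> {1..n} \<Longrightarrow> \<chi> j < d"
  unfolding Ch_def by (metis PiE_mem lessThan_iff)

text \<open>A \<open>t j\<close> inserted between the two idempotents can be absorbed on either
  side, with different eigenvalues.\<close>

lemma E_orthogonal:
  assumes "\<chi> \<in> Ch" "\<psi> \<in> Ch" "\<chi> \<noteq> \<psi>"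
  shows "E \<chi> * E \<psi> \<in> J"
proof -
  obtain j where j: "j \<in> {1..n}" "\<chi> j \<noteq> \<psi> j"
    using assms unfolding Ch_def by (meson PiE_ext)
  have "z (zeta d (\<chi> j)) * (E \<chi> * E \<psi>) \<approx> E \<chi> * t j * E \<psi>"
    using eqv_sym[OF eqv_rmult[OF E_t[OF j(1), of \<chi>], of "E \<psi>"]] by (simp add: mult.assoc)
  also have "E \<chi> * t j * E \<psi> = E \<chi> * (t j * E \<psi>)" by (simp add: mult.assoc)
  also have "\<dots> \<approx> E \<chi> * (z (zeta d (\<psi> j)) * E \<psi>)" by (intro eqv_lmult t_E j)
  also have "\<dots> = z (zeta d (\<psi> j)) * (E \<chi> * E \<psi>)"
    by (simp add: mult.assoc[symmetric] \<kappa>_central[of _ "E \<chi>"])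
  finally show ?thesis
    by (rule J_of_eigen) (use j assms zeta_eq_iff Ch_less in blast)
qed

lemma E_idem:
  assumes "\<chi> \<in> Ch"
  shows "E \<chi> * E \<chi> \<approx> E \<chi>"
proof -
  have "E \<chi> = (\<Sum>\<psi>\<in>Ch. E \<chi> * E \<psi>)" by (simp add: sum_distrib_left[symmetric] sum_E)
  also have "\<dots> = E \<chi> * E \<chi> + (\<Sum>\<psi>\<in>Ch - {\<chi>}. E \<chi> * E \<psi>)"
    using assms by (intro sum.remove) simp_all
  finally have "E \<chi> - E \<chi> * E \<chi> = (\<Sum>\<psi>\<in>Ch - {\<chi>}. E \<chi> * E \<psi>)"
      by (metis add_diff_cancel_left')
  moreover have "(\<Sum>\<psi>\<in>Ch - {\<chi>}. E \<chi> * E \<psi>) \<in> J"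
    using assms by (intro J_sum E_orthogonal) auto
  ultimately have "E \<chi> \<approx> E \<chi> * E \<chi>" by (simp add: eqv_def)
  then show ?thesis by (rule eqv_sym)
qed

lemma flip_Ch: "\<chi> \<in> Ch \<Longrightarrow> i \<in> {1..<n} \<Longrightarrow> flip i \<chi> \<in> Ch"
  unfolding Ch_def PiE_iff extensional_def by (auto simp: flip_apply)

text \<open>Moving \<open>t j\<close> through \<open>g i\<close> exchanges the indices
  \<open>i\<close> and \<open>Suc i\<close>, so \<open>g i\<close> between two idempotents survives
  only if their characters differ by the flip. Inserting the decomposition of one on the free side
  brings both sides to the same sandwich.\<close>

lemma E_g:
  assumes \<chi>: "\<chi> \<in> Ch" and i: "i \<in> {1..<n}"
  shows "E \<chi> * g i \<approx> g i * E (flip i \<chi>)"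
proof -
  have zero: "E \<phi> * g i * E \<psi> \<in> J" if ps: "\<phi> \<in> Ch" "\<psi> \<in> Ch" "\<psi>
      \<noteq> flip i \<phi>" for \<phi> \<psi>
  proof -
    obtain j where j: "j \<in> {1..n}" "\<psi> j \<noteq> flip i \<phi> j"
      using ps flip_Ch[OF ps(1) i] unfolding Ch_def by (meson PiE_ext)
    let ?j = "sw i j"
    have j': "?j \<in> {1..n}" "sw i ?j = j" "flip i \<phi> j = \<phi> ?j"
      using i j by (auto simp: sw_def flip_def)
    have "z (zeta d (\<phi> ?j)) * (E \<phi> * g i * E \<psi>) \<approx> E \<phi> * t ?j * (g i * E \<psi>)"
      using eqv_sym[OF eqv_rmult[OF E_t[OF j'(1), of \<phi>], of "g i * E \<psi>"]] by (simp add: mult.assoc)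
    also have "E \<phi> * t ?j * (g i * E \<psi>) = E \<phi> * ((t ?j * g i) * E \<psi>)" by (simp add:
        mult.assoc)
    also have "\<dots> \<approx> E \<phi> * ((g i * t j) * E \<psi>)"
      using rel_tg[OF i j'(1)] j'(2) by (intro eqv_lmult eqv_rmult) simp
    also have "E \<phi> * ((g i * t j) * E \<psi>) = E \<phi> * g i * (t j * E \<psi>)" by (simp add:
        mult.assoc)
    also have "\<dots> \<approx> E \<phi> * g i * (z (zeta d (\<psi> j)) * E \<psi>)" by (intro eqv_lmult t_E j)
    also have "\<dots> = z (zeta d (\<psi> j)) * (E \<phi> * g i * E \<psi>)"
      by (metis \<kappa>_central mult.assoc)
    finally show ?thesis
    proof (rule J_of_eigen)
      show "zeta d (\<phi> ?j) \<noteq> zeta d (\<psi> j)"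
        using j j' ps zeta_eq_iff Ch_less by metis
    qed
  qed
  let ?m = "E \<chi> * g i * E (flip i \<chi>)"
  have "E \<chi> * g i = (\<Sum>\<psi>\<in>Ch. E \<chi> * g i * E \<psi>)" by (simp add:
      sum_distrib_left[symmetric] sum_E)
  also have "\<dots> = ?m + (\<Sum>\<psi>\<in>Ch - {flip i \<chi>}. E \<chi> * g i * E \<psi>)"
    using flip_Ch[OF \<chi> i] by (intro sum.remove) simp_all
  finally have "E \<chi> * g i - ?m = (\<Sum>\<psi>\<in>Ch - {flip i \<chi>}. E \<chi> * g i * E \<psi>)"
    by (metis add_diff_cancel_left')
  moreover have "(\<Sum>\<psi>\<in>Ch - {flip i \<chi>}. E \<chi> * g i * E \<psi>) \<in> J"
    using \<chi> by (intro J_sum zero) auto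
  ultimately have 1: "E \<chi> * g i \<approx> ?m" by (simp add: eqv_def)
  have "g i * E (flip i \<chi>) = (\<Sum>\<psi>\<in>Ch. E \<psi> * (g i * E (flip i \<chi>)))"
    by (simp add: sum_distrib_right[symmetric] sum_E)
  also have "\<dots> = (\<Sum>\<psi>\<in>Ch. E \<psi> * g i * E (flip i \<chi>))" by (simp add: mult.assoc)
  also have "\<dots> = ?m + (\<Sum>\<psi>\<in>Ch - {\<chi>}. E \<psi> * g i * E (flip i \<chi>))"
    using \<chi> by (intro sum.remove) simp_all
  finally have "g i * E (flip i \<chi>) - ?m = (\<Sum>\<psi>\<in>Ch - {\<chi>}. E \<psi> * g i * E (flip
      i \<chi>))"
    by (metis add_diff_cancel_left')
  moreover have "(\<Sum>\<psi>\<in>Ch - {\<chi>}. E \<psi> * g i * E (flip i \<chi>)) \<in> J"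
  proof (rule J_sum)
    fix \<psi> assume \<psi>: "\<psi> \<in> Ch - {\<chi>}"
    have "flip i \<chi> \<noteq> flip i \<psi>"
    proof
      assume "flip i \<chi> = flip i \<psi>"
      then have "flip i (flip i \<chi>) = flip i (flip i \<psi>)" by simp
      then show False using \<psi> by simp
    qed
    then show "E \<psi> * g i * E (flip i \<chi>) \<in> J" using \<psi> flip_Ch[OF \<chi> i] by (intro
        zero) auto
  qed
  ultimately have 2: "g i * E (flip i \<chi>) \<approx> ?m" by (simp add: eqv_def)
  show ?thesis by (rule eqv_trans[OF 1 eqv_sym[OF 2]])
qed


lemma \<kappa>_left_commute: "x * (\<kappa> a * y) = \<kappa> a * (x * y)"
  by (metis \<kappa>_central mult.assoc)

lemma run_Ch: "\<chi> \<in> Ch \<Longrightarrow> set w \<subseteq> {1..<n} \<Longrightarrow> run \<chi> w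
    \<in> Ch"
  by (induction w arbitrary: \<chi>) (simp_all add: flip_Ch)

lemma E_gp:
  assumes "\<chi> \<in> Ch" "set w \<subseteq> {1..<n}"
  shows "E \<chi> * gp w \<approx> gp w * E (run \<chi> w)"
  using assms
proof (induction w arbitrary: \<chi>)
  case (Cons a w)
  have a: "a \<in> {1..<n}" and w: "set w \<subseteq> {1..<n}" using Cons.prems(2) by auto
  have "E \<chi> * gp (a # w) = E \<chi> * g a * gp w" by (simp add: mult.assoc)
  also have "\<dots> \<approx> g a * E (flip a \<chi>) * gp w" by (intro eqv_rmult E_g Cons.prems a)
  also have "g a * E (flip a \<chi>) * gp w = g a * (E (flip a \<chi>) * gp w)" by (simp add: mult.assoc)
  also have "\<dots> \<approx> g a * (gp w * E (run (flip a \<chi>) w))"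
    by (intro eqv_lmult Cons.IH flip_Ch Cons.prems a w)
  also have "\<dots> = gp (a # w) * E (run \<chi> (a # w))" by (simp add: mult.assoc)
  finally show ?case .
qed simp

lemma E_gp_E:
  assumes "\<chi> \<in> Ch" "set w \<subseteq> {1..<n}"
  shows "run \<chi> w \<noteq> \<chi> \<Longrightarrow> E \<chi> * gp w * E \<chi> \<in> J"
    and "run \<chi> w = \<chi> \<Longrightarrow> E \<chi> * gp w * E \<chi> \<approx> E \<chi> * gp w"
proof -
  have 1: "E \<chi> * gp w * E \<chi> \<approx> gp w * (E (run \<chi> w) * E \<chi>)"
    using eqv_rmult[OF E_gp[OF assms], of "E \<chi>"] by (simp add: mult.assoc)
  {
    assume "run \<chi> w \<noteq> \<chi>"
    then have "gp w * (E (run \<chi> w) * E \<chi>) \<in> J"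
      using assms by (intro J_lmult E_orthogonal run_Ch)
    then show "E \<chi> * gp w * E \<chi> \<in> J" by (rule J_eqv[OF 1])
  }
  {
    assume r: "run \<chi> w = \<chi>"
    have "gp w * (E (run \<chi> w) * E \<chi>) \<approx> gp w * E \<chi>" unfolding r by (intro eqv_lmult
        E_idem assms)
    moreover have "gp w * E \<chi> \<approx> E \<chi> * gp w" using eqv_sym[OF E_gp[OF assms]] r by simp
    ultimately show "E \<chi> * gp w * E \<chi> \<approx> E \<chi> * gp w" using 1 eqv_trans by blast
  }
qed

lemma E_t_power: "j \<in> {1..n} \<Longrightarrow> E \<chi> * t j ^ s \<approx> z (zeta d (\<chi> j) ^ s)
    * E \<chi>"
proof (induction s)
  case (Suc s)
  have "E \<chi> * t j ^ Suc s = E \<chi> * t j ^ s * t j" by (simp only: power_Suc2 mult.assoc)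
  also have "\<dots> \<approx> z (zeta d (\<chi> j) ^ s) * E \<chi> * t j" by (intro eqv_rmult Suc)
  also have "z (zeta d (\<chi> j) ^ s) * E \<chi> * t j = z (zeta d (\<chi> j) ^ s) * (E \<chi> * t j)"
      by (simp add: mult.assoc)
  also have "\<dots> \<approx> z (zeta d (\<chi> j) ^ s) * (z (zeta d (\<chi> j)) * E \<chi>)" by (intro
      eqv_lmult E_t Suc)
  also have "\<dots> = z (zeta d (\<chi> j) ^ Suc s) * E \<chi>" by (simp only: power_Suc2 z_mult mult.assoc)
  finally show ?case .
qed simp

section \<open>The quadratic and Temperley--Lieb relations on one idempotent\<close>

definition ee :: "nat \<Rightarrow> 'a" where
  "ee i = z (1 / of_nat d) * (\<Sum>s\<in>{0..<d}. t i ^ s * t (Suc i) ^ ((d - s) mod d))"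

lemma E_ee:
  assumes \<chi>: "\<chi> \<in> Ch" and i: "i \<in> {1..<n}" and ne: "\<chi> i \<noteq> \<chi> (Suc i)"
  shows "E \<chi> * ee i \<in> J"
proof -
  have i': "i \<in> {1..n}" "Suc i \<in> {1..n}" using i by auto
  let ?a = "zeta d (\<chi> i)" and ?b = "zeta d (\<chi> (Suc i))"
  have "E \<chi> * (t i ^ s * t (Suc i) ^ k) \<approx> z (?a ^ s * ?b ^ k) * E \<chi>" for s k
  proof -
    have "E \<chi> * (t i ^ s * t (Suc i) ^ k) = E \<chi> * t i ^ s * t (Suc i) ^ k" by (simp add: mult.assoc)
    also have "\<dots> \<approx> z (?a ^ s) * E \<chi> * t (Suc i) ^ k" by (intro eqv_rmult E_t_power i')
    also have "z (?a ^ s) * E \<chi> * t (Suc i) ^ k = z (?a ^ s) * (E \<chi> * t (Suc i) ^ k)" by (simp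
        add: mult.assoc)
    also have "\<dots> \<approx> z (?a ^ s) * (z (?b ^ k) * E \<chi>)" by (intro eqv_lmult E_t_power i')
    also have "\<dots> = z (?a ^ s * ?b ^ k) * E \<chi>" by (simp only: z_mult mult.assoc)
    finally show ?thesis .
  qed
  note * = this
  have 1: "E \<chi> * ee i = z (1 / of_nat d) * (\<Sum>s\<in>{0..<d}. E \<chi> * (t i ^ s * t (Suc i) ^
      ((d - s) mod d)))"
    unfolding sum_distrib_left[of "E \<chi>", symmetric] ee_def by (rule \<kappa>_left_commute)
  have "E \<chi> * ee i \<approx> z (1 / of_nat d) * (\<Sum>s\<in>{0..<d}. z (?a ^ s * ?b ^ ((d - s) mod
      d)) * E \<chi>)"
    unfolding 1 by (intro eqv_lmult eqv_sum *)
  moreover have "z (1 / of_nat d) * (\<Sum>s\<in>{0..<d}. z (?a ^ s * ?b ^ ((d - s) mod d)) * E \<chi>) =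
      \<kappa> (cst (1 / of_nat d) * (\<Sum>s\<in>{0..<d}. cst ?a ^ s * cst ?b ^ ((d - s) mod d))) * E \<chi>"
    by (simp add: \<kappa>_mult \<kappa>_sum sum_distrib_right cst_mult cst_power mult.assoc)
  moreover have "cst (1 / of_nat d) * (\<Sum>s\<in>{0..<d}. cst ?a ^ s * cst ?b ^ ((d - s) mod d)) = 0"
    using e_coeff[OF d1 Ch_less[OF \<chi> i'(1)] Ch_less[OF \<chi> i'(2)]] ne by simp
  ultimately show ?thesis by (simp only: \<kappa>_zero mult_zero_left eqv_zero)
qed

text \<open>On differing neighbours \<open>ee i\<close> is killed and the quadratic relation keeps
  only its constant term; \<open>g i\<close> becomes invertible there, which makes it possible to
  conjugate one idempotent into another.\<close>

lemma E_g_g: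
  assumes \<chi>: "\<chi> \<in> Ch" and i: "i \<in> {1..<n}" and ne: "\<chi> i \<noteq> \<chi> (Suc i)"
  shows "E \<chi> * (g i * g i) \<approx> E \<chi>"
proof -
  let ?x = "\<kappa> (uu - 1) * (E \<chi> * ee i) + \<kappa> (uu - 1) * (E \<chi> * ee i * g i)"
  have 1: "E \<chi> * (g i * g i) \<approx> E \<chi> * (1 + \<kappa> (uu - 1) * ee i + \<kappa> (uu - 1)
      * (ee i * g i))"
    using rel_quad[OF i] unfolding ee_def[symmetric] by (rule eqv_lmult)
  have 2: "E \<chi> * (1 + \<kappa> (uu - 1) * ee i + \<kappa> (uu - 1) * (ee i * g i)) = E \<chi> + ?x"
    by (simp only: distrib_left mult_1_right mult.assoc add.assoc \<kappa>_left_commute[of "E \<chi>"])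
  have "?x \<in> J"
    by (rule J_add[OF J_lmult[OF E_ee[OF assms]] J_lmult[OF J_rmult[OF E_ee[OF assms]]]])
  then have "E \<chi> + ?x \<approx> E \<chi>" by (simp add: eqv_def)
  then show ?thesis using 1 unfolding 2 by (rule eqv_trans[rotated])
qed

lemma TL_E:
  assumes \<chi>: "\<chi> \<in> Ch" and i: "1 \<le> i" "Suc i < n"
  shows "E \<chi> * gp [i, Suc i, i] * E \<chi> + E \<chi> * gp [i, Suc i] * E \<chi> + E \<chi> * gp
      [Suc i, i] * E \<chi>
     + E \<chi> * gp [i] * E \<chi> + E \<chi> * gp [Suc i] * E \<chi> + E \<chi> * gp [] * E \<chi> \<in> J"
  using J_rmult[OF J_lmult[OF rel_TL[OF i], of "E \<chi>"], of "E \<chi>"]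
  by (simp add: distrib_left distrib_right mult.assoc)

text \<open>Values at single positions that witness, in the next three lemmas, that a word changes
  the character.\<close>

lemma run3:
  "run \<chi> [i] (Suc i) = \<chi> i" "run \<chi> [Suc i] (Suc i) = \<chi> (Suc (Suc i))" "run \<chi>
      [Suc i] (Suc (Suc i)) = \<chi> (Suc i)"
  "run \<chi> [i, Suc i] i = \<chi> (Suc i)" "run \<chi> [i, Suc i] (Suc i) = \<chi> (Suc (Suc i))"
  "run \<chi> [Suc i, i] i = \<chi> (Suc (Suc i))" "run \<chi> [i, Suc i, i] i = \<chi> (Suc (Suc i))"
  "run \<chi> [i] i = \<chi> (Suc i)" "run \<chi> [Suc i, i] (Suc i) = \<chi> i" "run \<chi> [i, Suc i]
      (Suc (Suc i)) = \<chi> i"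
  by (simp_all add: flip_apply)

text \<open>With three different values all five nontrivial words move \<chi>, so the sandwiched
  relation reduces to the term of the empty word.\<close>

lemma E_three_adjacent:
  assumes \<chi>: "\<chi> \<in> Ch" and i: "1 \<le> i" "Suc i < n"
    and ne: "\<chi> i \<noteq> \<chi> (Suc i)" "\<chi> i \<noteq> \<chi> (Suc (Suc i))" "\<chi> (Suc i)
        \<noteq> \<chi> (Suc (Suc i))"
  shows "E \<chi> \<in> J"
proof -
  have "run \<chi> [i, Suc i, i] \<noteq> \<chi>" "run \<chi> [i, Suc i] \<noteq> \<chi>" "run \<chi>
      [Suc i, i] \<noteq> \<chi>"
      "run \<chi> [i] \<noteq> \<chi>" "run \<chi> [Suc i] \<noteq> \<chi>"
    using run3[of \<chi> i] ne by metis+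
  then have m: "E \<chi> * gp [i, Suc i, i] * E \<chi> \<in> J" "E \<chi> * gp [i, Suc i] * E \<chi> \<in> J"
    "E \<chi> * gp [Suc i, i] * E \<chi> \<in> J" "E \<chi> * gp [i] * E \<chi> \<in> J" "E \<chi> * gp
        [Suc i] * E \<chi> \<in> J"
    using \<chi> i by (intro E_gp_E(1); simp)+
  have "E \<chi> * gp [] * E \<chi> \<in> J"
    using J_add[OF TL_E[OF \<chi> i] J_uminus[OF J_add[OF J_add[OF J_add[OF J_add[OF m(1,2)] m(3)] m(4)] m(5)]]]
    by simp
  then show ?thesis using J_eqv[OF eqv_sym[OF E_idem[OF \<chi>]]] by simp
qed

text \<open>Only \<open>[]\<close> and \<open>[i]\<close> fix \<chi>, so the sandwiched relation
  reduces to these two terms.\<close>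

lemma E_adjacent_pair_right:
  assumes \<chi>: "\<chi> \<in> Ch" and i: "1 \<le> i" "Suc i < n"
    and ne: "\<chi> i = \<chi> (Suc i)" "\<chi> i \<noteq> \<chi> (Suc (Suc i))"
  shows "E \<chi> * g i \<approx> - E \<chi>"
proof -
  have "run \<chi> [i, Suc i, i] \<noteq> \<chi>" "run \<chi> [i, Suc i] \<noteq> \<chi>" "run \<chi>
      [Suc i, i] \<noteq> \<chi>" "run \<chi> [Suc i] \<noteq> \<chi>"
    using run3[of \<chi> i] ne by metis+
  then have m: "E \<chi> * gp [i, Suc i, i] * E \<chi> \<in> J" "E \<chi> * gp [i, Suc i] * E \<chi> \<in> J"
    "E \<chi> * gp [Suc i, i] * E \<chi> \<in> J" "E \<chi> * gp [Suc i] * E \<chi> \<in> J"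
    using \<chi> i by (intro E_gp_E(1); simp)+
  have "E \<chi> * gp [i] * E \<chi> + E \<chi> * gp [] * E \<chi> \<in> J"
    using J_add[OF TL_E[OF \<chi> i] J_uminus[OF J_add[OF J_add[OF J_add[OF m(1,2)] m(3)] m(4)]]]
    by (simp add: algebra_simps)
  moreover have "E \<chi> * gp [i] * E \<chi> \<approx> E \<chi> * gp [i]"
    using \<chi> i ne by (intro E_gp_E(2)) (simp_all add: flip_same)
  moreover have "E \<chi> * gp [] * E \<chi> \<approx> E \<chi>" using E_idem[OF \<chi>] by simp
  ultimately have "E \<chi> * gp [i] + E \<chi> \<in> J" using J_eqv eqv_sym eqv_add by blast
  then show ?thesis by (simp add: eqv_def)
qed

lemma E_adjacent_pair_left:
  assumes \<chi>: "\<chi> \<in> Ch" and i: "1 \<le> i" "Suc i < n"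
    and ne: "\<chi> (Suc i) = \<chi> (Suc (Suc i))" "\<chi> i \<noteq> \<chi> (Suc i)"
  shows "E \<chi> * g (Suc i) \<approx> - E \<chi>"
proof -
  have "run \<chi> [i, Suc i, i] \<noteq> \<chi>" "run \<chi> [i, Suc i] \<noteq> \<chi>" "run \<chi>
      [Suc i, i] \<noteq> \<chi>" "run \<chi> [i] \<noteq> \<chi>"
    using run3[of \<chi> i] ne by metis+
  then have m: "E \<chi> * gp [i, Suc i, i] * E \<chi> \<in> J" "E \<chi> * gp [i, Suc i] * E \<chi> \<in> J"
    "E \<chi> * gp [Suc i, i] * E \<chi> \<in> J" "E \<chi> * gp [i] * E \<chi> \<in> J"
    using \<chi> i by (intro E_gp_E(1); simp)+
  have "E \<chi> * gp [Suc i] * E \<chi> + E \<chi> * gp [] * E \<chi> \<in> J"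
    using J_add[OF TL_E[OF \<chi> i] J_uminus[OF J_add[OF J_add[OF J_add[OF m(1,2)] m(3)] m(4)]]]
    by (simp add: algebra_simps)
  moreover have "E \<chi> * gp [Suc i] * E \<chi> \<approx> E \<chi> * gp [Suc i]"
    using \<chi> i ne by (intro E_gp_E(2)) (simp_all add: flip_same)
  moreover have "E \<chi> * gp [] * E \<chi> \<approx> E \<chi>" using E_idem[OF \<chi>] by simp
  ultimately have "E \<chi> * gp [Suc i] + E \<chi> \<in> J" using J_eqv eqv_sym eqv_add by blast
  then show ?thesis by (simp add: eqv_def)
qed

lemma E_conjugate:
  assumes "\<chi> \<in> Ch" "m \<in> {1..<n}" "\<chi> m \<noteq> \<chi> (Suc m)"
  shows "E \<chi> \<approx> g m * E (flip m \<chi>) * g m"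
proof -
  have "E \<chi> \<approx> E \<chi> * g m * g m" using eqv_sym[OF E_g_g[OF assms]] by (simp add: mult.assoc)
  also have "\<dots> \<approx> g m * E (flip m \<chi>) * g m" by (intro eqv_rmult E_g assms)
  finally show ?thesis .
qed

text \<open>Bring the three positions together: an outer value moves one step towards the middle,
  either because its neighbour has the same value or by conjugation with the letter between the
  two.\<close>

lemma E_three_values:
  assumes "\<chi> \<in> Ch" "1 \<le> p" "p < q" "q < r" "r \<le> n" "\<chi> p \<noteq> \<chi> q" "\<chi>
      p \<noteq> \<chi> r" "\<chi> q \<noteq> \<chi> r"
  shows "E \<chi> \<in> J"
  using assms
proof (induction "r - p" arbitrary: p q r \<chi> rule: less_induct)
  case less
  have conj: "E \<chi> \<in> J" if "E (flip m \<chi>) \<in> J" "m \<in> {1..<n}" "\<chi> m \<noteq>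
      \<chi> (Suc m)" for m
    using J_eqv[OF E_conjugate[OF less.prems(1) that(2,3)]] J_rmult[OF J_lmult[OF that(1)]] by blast
  consider "q = Suc p" "r = Suc q" | "Suc p < q" | "q = Suc p" "Suc q < r" using less.prems by linarith
  then show ?case
  proof cases
    case 1
    then show ?thesis using less.prems by (intro E_three_adjacent[of \<chi> p]) auto
  next
    case 2
    show ?thesis
    proof (cases "\<chi> p = \<chi> (Suc p)")
      case True
      show ?thesis using less.prems 2 True by (intro less.hyps[of r "Suc p" \<chi> q]) auto
    next
      case False
      have v: "flip p \<chi> (Suc p) = \<chi> p" "flip p \<chi> q = \<chi> q" "flip p \<chi> r = \<chi> r"
        using 2 less.prems by (auto simp: flip_apply)
      have p: "p \<in> {1..<n}" using less.prems by auto
      have "E (flip p \<chi>) \<in> J"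
        using less.prems 2 v flip_Ch[OF less.prems(1) p] by (intro less.hyps[of r "Suc p" "flip p \<chi>"
            q]) auto
      then show ?thesis using p False by (rule conj)
    qed
  next
    case 3
    obtain m where m: "r = Suc m" using less.prems by (cases r) auto
    show ?thesis
    proof (cases "\<chi> m = \<chi> r")
      case True
      show ?thesis using less.prems 3 True m by (intro less.hyps[of m p \<chi> q]) auto
    next
      case False
      have v: "flip m \<chi> m = \<chi> r" "flip m \<chi> q = \<chi> q" "flip m \<chi> p = \<chi> p"
        using 3 less.prems m by (auto simp: flip_apply)
      have p: "m \<in> {1..<n}" using less.prems m 3 by auto
      have "E (flip m \<chi>) \<in> J"
        using less.prems 3 v m flip_Ch[OF less.prems(1) p] by (intro less.hyps[of m p "flip m \<chi>" q]) auto
      then show ?thesis using p False m by (intro conj) simp_all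
    qed
  qed
qed

lemma g_far:
  assumes "a \<in> {1..<n}" "b \<in> {1..<n}" "Suc a < b \<or> Suc b < a"
  shows "g a * g b \<approx> g b * g a"
  using assms rel_far[of a b] eqv_sym[OF rel_far[of b a]] by auto

text \<open>A position \<open>k\<close> of another value is brought next to the pair
  \<open>i\<close>, \<open>Suc i\<close>. If its inner neighbour has the value at \<open>i\<close>,
  conjugate by a letter far from \<open>i\<close>, which commutes with \<open>g i\<close>; otherwise
  that neighbour takes the role of \<open>k\<close>.\<close>

lemma E_nonconstant:
  assumes "\<chi> \<in> Ch" "i \<in> {1..<n}" "\<chi> i = \<chi> (Suc i)" "k \<in> {1..n}" "\<chi> k
      \<noteq> \<chi> i"
  shows "E \<chi> * g i \<approx> - E \<chi>"
  using assms
proof (induction "if i < k then k - i else i - k" arbitrary: k \<chi> rule: less_induct)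
  case less
  have conj: "E \<chi> * g i \<approx> - E \<chi>"
    if m: "m \<in> {1..<n}" "\<chi> m \<noteq> \<chi> (Suc m)" "Suc i < m \<or> Suc m < i"
      and IH: "E (flip m \<chi>) * g i \<approx> - E (flip m \<chi>)" for m
  proof -
    let ?E = "E (flip m \<chi>)"
    have "E \<chi> * g i \<approx> g m * ?E * g m * g i" by (intro eqv_rmult E_conjugate less.prems m)
    also have "g m * ?E * g m * g i = g m * ?E * (g m * g i)" by (simp add: mult.assoc)
    also have "\<dots> \<approx> g m * ?E * (g i * g m)" using m less.prems by (intro eqv_lmult g_far) auto
    also have "g m * ?E * (g i * g m) = g m * (?E * g i) * g m" by (simp add: mult.assoc)
    also have "\<dots> \<approx> g m * (- ?E) * g m" by (intro eqv_rmult eqv_lmult IH)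
    also have "g m * (- ?E) * g m = - (g m * ?E * g m)" by simp
    also have "\<dots> \<approx> - E \<chi>" by (intro eqv_uminus eqv_sym[OF E_conjugate] less.prems m)
    finally show ?thesis .
  qed
  have kne: "k \<noteq> i" "k \<noteq> Suc i" using less.prems by auto
  consider "k = Suc (Suc i)" | "Suc (Suc i) < k" | "Suc k = i" | "Suc k < i" using kne by linarith
  then show ?case
  proof cases
    case 1
    then show ?thesis using less.prems by (intro E_adjacent_pair_right) auto
  next
    case 2
    obtain m where m: "k = Suc m" using 2 by (cases k) auto
    show ?thesis
    proof (cases "\<chi> m = \<chi> i")
      case True
      have v: "flip m \<chi> i = \<chi> i" "flip m \<chi> (Suc i) = \<chi> (Suc i)" "flip m \<chi> m = \<chi> k"
        using 2 m by (auto simp: flip_apply)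
      have mn: "m \<in> {1..<n}" using less.prems m 2 by auto
      have "E (flip m \<chi>) * g i \<approx> - E (flip m \<chi>)"
        using less.prems v m 2 mn flip_Ch[OF less.prems(1) mn] by (intro less.hyps[of m "flip m \<chi>"]) auto
      then show ?thesis using mn True less.prems m 2 by (intro conj[of m]) auto
    next
      case False
      then show ?thesis using less.prems m 2 by (intro less.hyps[of m \<chi>]) auto
    qed
  next
    case 3
    then show ?thesis using less.prems E_adjacent_pair_left[of \<chi> k] by auto
  next
    case 4
    show ?thesis
    proof (cases "\<chi> (Suc k) = \<chi> i")
      case True
      have v: "flip k \<chi> i = \<chi> i" "flip k \<chi> (Suc i) = \<chi> (Suc i)" "flip k \<chi> (Suc
          k) = \<chi> k"
        using 4 by (auto simp: flip_apply)
      have kn: "k \<in> {1..<n}" using less.prems 4 by auto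
      have "E (flip k \<chi>) * g i \<approx> - E (flip k \<chi>)"
        using less.prems v 4 kn flip_Ch[OF less.prems(1) kn] by (intro less.hyps[of "Suc k" "flip k
            \<chi>"]) auto
      then show ?thesis using kn True less.prems 4 by (intro conj[of k]) auto
    next
      case False
      then show ?thesis using less.prems 4 by (intro less.hyps[of "Suc k" \<chi>]) auto
    qed
  qed
qed

text \<open>At the first letter that exchanges equal values, the idempotent pushed up to it turns
  the letter into \<open>-1\<close>; then it is moved back. The values stay non-constant on the way
  because letters only permute them.\<close>

lemma E_delete_letter:
  assumes "\<chi> \<in> Ch" "set w \<subseteq> {1..<n}" "\<not> proper \<chi> w" "j \<in> {1..n}" "k
      \<in> {1..n}" "\<chi> j \<noteq> \<chi> k"
  shows "\<exists>w'. length w' < length w \<and> set w' \<subseteq> {1..<n} \<and> E \<chi> * gp w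
      \<approx> - (E \<chi> * gp w')"
  using assms
proof (induction w arbitrary: \<chi> j k)
  case (Cons a w)
  have a: "a \<in> {1..<n}" and w: "set w \<subseteq> {1..<n}" using Cons.prems(2) by auto
  show ?case
  proof (cases "\<chi> a = \<chi> (Suc a)")
    case True
    have "\<chi> j \<noteq> \<chi> a \<or> \<chi> k \<noteq> \<chi> a" using Cons.prems by metis
    then have "E \<chi> * g a \<approx> - E \<chi>"
      using E_nonconstant[OF Cons.prems(1) a True] Cons.prems by blast
    from eqv_rmult[OF this, of "gp w"] have "E \<chi> * gp (a # w) \<approx> - (E \<chi> * gp w)"
      by (simp add: mult.assoc)
    then show ?thesis using w by (intro exI[of _ w]) simp
  next
    case False
    let ?\<chi> = "flip a \<chi>"
    have f: "?\<chi> \<in> Ch" using Cons.prems(1) a by (rule flip_Ch)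
    have j': "sw a j \<in> {1..n}" "sw a k \<in> {1..n}" "?\<chi> (sw a j) \<noteq> ?\<chi> (sw a k)"
      using Cons.prems a by (auto simp: sw_def flip_apply)
    have "\<not> proper ?\<chi> w" using Cons.prems(3) False by simp
    from Cons.IH[OF f w this j'] obtain w' where
      w': "length w' < length w" "set w' \<subseteq> {1..<n}" "E ?\<chi> * gp w \<approx> - (E ?\<chi> *
          gp w')" by blast
    have "E \<chi> * gp (a # w) = E \<chi> * g a * gp w" by (simp add: mult.assoc)
    also have "\<dots> \<approx> g a * E ?\<chi> * gp w" by (intro eqv_rmult E_g Cons.prems a)
    also have "g a * E ?\<chi> * gp w = g a * (E ?\<chi> * gp w)" by (simp add: mult.assoc)
    also have "\<dots> \<approx> g a * (- (E ?\<chi> * gp w'))" by (intro eqv_lmult w')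
    also have "\<dots> = - (g a * E ?\<chi> * gp w')" by (simp add: mult.assoc)
    also have "\<dots> \<approx> - (E \<chi> * g a * gp w')"
      by (intro eqv_uminus eqv_rmult eqv_sym[OF E_g] Cons.prems a)
    also have "- (E \<chi> * g a * gp w') = - (E \<chi> * gp (a # w'))" by (simp add: mult.assoc)
    finally show ?thesis using w' a by (intro exI[of _ "a # w'"]) auto
  qed
qed simp


subsection \<open>Spans modulo the ideal\<close>

inductive_set spn :: "'a set \<Rightarrow> 'a set" for B where
  spn_J: "x \<in> J \<Longrightarrow> x \<in> spn B"
| spn_base: "b \<in> B \<Longrightarrow> \<kappa> c * b \<in> spn B"
| spn_add: "x \<in> spn B \<Longrightarrow> y \<in> spn B \<Longrightarrow> x + y \<in> spn B"

lemma spn_mem: "b \<in> B \<Longrightarrow> b \<in> spn B"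
  using spn_base[of b B 1] by simp

lemma spn_eqv: "x \<approx> y \<Longrightarrow> y \<in> spn B \<Longrightarrow> x \<in> spn B"
proof -
  assume "x \<approx> y" "y \<in> spn B"
  then have "x - y \<in> spn B" by (intro spn_J) (simp only: eqv_def)
  then have "(x - y) + y \<in> spn B" using \<open>y \<in> spn B\<close> by (rule spn_add)
  then show ?thesis by simp
qed

lemma spn_scale: "x \<in> spn B \<Longrightarrow> \<kappa> c * x \<in> spn B"
proof (induction rule: spn.induct)
  case (spn_J x)
  then show ?case by (intro spn.spn_J J_lmult)
next
  case (spn_base b a)
  then show ?case using spn.spn_base[of b B "c * a"] by (simp add: \<kappa>_mult mult.assoc)
next
  case (spn_add x y)
  then show ?case by (simp add: distrib_left spn.spn_add)
qed

lemma spn_uminus: "x \<in> spn B \<Longrightarrow> - x \<in> spn B"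
  using spn_scale[of x B "- 1"] by (simp add: \<kappa>_uminus)

lemma spn_zero: "0 \<in> spn B"
  by (rule spn_J[OF J_zero])

lemma spn_sum: "(\<And>k. k \<in> A \<Longrightarrow> f k \<in> spn B) \<Longrightarrow> sum f A \<in> spn B"
  by (induction A rule: infinite_finite_induct) (simp_all add: spn_zero spn_add)

lemma spn_lmult: "(\<And>b. b \<in> B \<Longrightarrow> p * b \<in> spn C) \<Longrightarrow> x \<in> spn
    B \<Longrightarrow> p * x \<in> spn C"
proof (rotate_tac, induction rule: spn.induct)
  case (spn_J x)
  then show ?case by (intro spn.spn_J J_lmult)
next
  case (spn_base b a)
  then show ?case unfolding \<kappa>_left_commute by (intro spn_scale) blast
next
  case (spn_add x y)
  then show ?case by (simp add: distrib_left spn.spn_add)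
qed

lemma spn_subset: "(\<And>b. b \<in> B \<Longrightarrow> b \<in> spn C) \<Longrightarrow> x \<in> spn B
    \<Longrightarrow> x \<in> spn C"
  using spn_lmult[of B 1 C x] by simp

lemma spn_mult:
  assumes "\<And>b c. b \<in> B \<Longrightarrow> c \<in> C \<Longrightarrow> b * c \<in> spn D" "x \<in>
      spn B" "y \<in> spn C"
  shows "x * y \<in> spn D"
  using assms(2)
proof (induction rule: spn.induct)
  case (spn_J x)
  then show ?case by (intro spn.spn_J J_rmult)
next
  case (spn_base b a)
  have "b * y \<in> spn D" using assms(1)[OF spn_base] assms(3) by (rule spn_lmult)
  then show ?case unfolding mult.assoc by (rule spn_scale)
next
  case (spn_add x y)
  then show ?case by (simp add: distrib_right spn.spn_add)
qed

section \<open>The filtration by the number of \<open>G\<close> letters\<close>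

definition gset :: "gen set" where
  "gset = G ` {1..<n} \<union> T ` {1..n}"

text \<open>Letters \<open>T\<close> count for nothing, so a rewriting that loses a \<open>G\<close>
  letter lands in a smaller step whatever \<open>T\<close> letters it creates.\<close>

definition S :: "nat \<Rightarrow> 'a set" where
  "S L = spn {vp w | w. set w \<subseteq> gset \<and> length (gpart w) \<le> L}"

lemma S_vp: "set w \<subseteq> gset \<Longrightarrow> length (gpart w) \<le> L \<Longrightarrow> vp w \<in> S L"
  unfolding S_def by (rule spn_mem) blast

lemma S_mono: "L \<le> L' \<Longrightarrow> x \<in> S L \<Longrightarrow> x \<in> S L'"
  unfolding S_def by (erule spn_subset[rotated]) (auto intro!: spn_mem)

lemma S_mult: "x \<in> S a \<Longrightarrow> y \<in> S b \<Longrightarrow> x * y \<in> S (a + b)"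
  unfolding S_def
proof (erule (1) spn_mult[rotated], clarify)
  fix u w assume "set u \<subseteq> gset" "length (gpart u) \<le> a" "set w \<subseteq> gset" "length
      (gpart w) \<le> b"
  then have "vp (u @ w) \<in> S (a + b)" by (intro S_vp) (auto simp: gpart_append)
  then show "vp u * vp w \<in> spn {vp w |w. set w \<subseteq> gset \<and> length (gpart w) \<le> a + b}"
    by (simp add: S_def)
qed

lemma S_gp: "set w \<subseteq> {1..<n} \<Longrightarrow> gp w \<in> S (length w)"
  unfolding vp_map_G[symmetric] by (rule S_vp) (auto simp: gset_def)

lemma S_add: "x \<in> S L \<Longrightarrow> y \<in> S L \<Longrightarrow> x + y \<in> S L"
  unfolding S_def by (rule spn_add)

lemma S_scale: "x \<in> S L \<Longrightarrow> \<kappa> c * x \<in> S L"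
  unfolding S_def by (rule spn_scale)

lemma S_uminus: "x \<in> S L \<Longrightarrow> - x \<in> S L"
  unfolding S_def by (rule spn_uminus)

lemma S_sum: "(\<And>k. k \<in> A \<Longrightarrow> f k \<in> S L) \<Longrightarrow> sum f A \<in> S L"
  unfolding S_def by (rule spn_sum)

lemma S_eqv: "x \<approx> y \<Longrightarrow> y \<in> S L \<Longrightarrow> x \<in> S L"
  unfolding S_def by (rule spn_eqv)

lemma S_one: "1 \<in> S 0"
  using S_gp[of "[]"] by simp

lemma S_t_power: "j \<in> {1..n} \<Longrightarrow> t j ^ k \<in> S 0"
  unfolding vp_replicate_T[symmetric] by (rule S_vp) (auto simp: gset_def)

lemma S_mult_0: "x \<in> S 0 \<Longrightarrow> y \<in> S b \<Longrightarrow> x * y \<in> S b"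
  using S_mult[of x 0 y b] by simp

lemma S_square: "i \<in> {1..<n} \<Longrightarrow> g i * g i \<in> S 1"
proof -
  assume i: "i \<in> {1..<n}"
  have "ee i \<in> S 0"
    unfolding ee_def using i by (intro S_scale S_sum S_mult_0 S_t_power) auto
  moreover have "g i \<in> S 1" using S_gp[of "[i]"] i by simp
  ultimately have "1 + \<kappa> (uu - 1) * ee i + \<kappa> (uu - 1) * (ee i * g i) \<in> S 1"
    using S_mono[of 0 1] S_one by (intro S_add S_scale S_mult_0) simp_all
  then show ?thesis using rel_quad[OF i, folded ee_def] by (rule S_eqv[rotated])
qed

lemma S_TL:
  assumes "1 \<le> i" "Suc i < n"
  shows "g i * g (Suc i) * g i \<in> S 2" "g (Suc i) * g i * g (Suc i) \<in> S 2"
proof -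
  have w: "gp w \<in> S 2" if "set w \<subseteq> {i, Suc i}" "length w \<le> 2" for w
  proof -
    have "set w \<subseteq> {1..<n}" using that(1) assms by auto
    then show ?thesis by (rule S_mono[OF that(2) S_gp])
  qed
  have "g i * g (Suc i) * g i \<approx> - (gp [i, Suc i] + gp [Suc i, i] + gp [i] + gp [Suc i] + gp [])"
    using rel_TL[OF assms] by (simp add: eqv_def algebra_simps)
  moreover have "- (gp [i, Suc i] + gp [Suc i, i] + gp [i] + gp [Suc i] + gp []) \<in> S 2"
    by (intro S_uminus S_add w) simp_all
  ultimately show "g i * g (Suc i) * g i \<in> S 2" by (rule S_eqv)
  then show "g (Suc i) * g i * g (Suc i) \<in> S 2"
    by (rule S_eqv[OF eqv_sym[OF rel_braid[OF assms]]])
qed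

lemma S_context:
  assumes "x \<in> S k" "set u \<subseteq> {1..<n}" "set w \<subseteq> {1..<n}"
  shows "gp u * x * gp w \<in> S (length u + k + length w)"
  by (intro S_mult S_gp assms)

lemma S_context_left:
  assumes "x \<in> S k" "set u \<subseteq> {1..<n}"
  shows "gp u * x \<in> S (length u + k)"
  by (intro S_mult S_gp assms)

lemma gp_commute:
  assumes "l \<in> {1..<n}" "set w \<subseteq> {1..<n}" "\<And>a. a \<in> set w \<Longrightarrow> Suc a <
      l \<or> Suc l < a"
  shows "gp w * g l \<approx> g l * gp w"
  using assms(2,3)
proof (induction w)
  case (Cons a w)
  have "gp (a # w) * g l = g a * (gp w * g l)" by (simp add: mult.assoc)
  also have "\<dots> \<approx> g a * (g l * gp w)" using Cons by (intro eqv_lmult) auto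
  also have "g a * (g l * gp w) = g a * g l * gp w" by (simp add: mult.assoc)
  also have "\<dots> \<approx> g l * g a * gp w"
    using Cons.prems assms(1) by (intro eqv_rmult g_far) auto
  also have "\<dots> = g l * gp (a # w)" by (simp add: mult.assoc)
  finally show ?case .
qed simp

subsection \<open>Reduction to Jones normal form\<close>

lemma nf_snoc: "nf (cs @ [(b, i)]) \<longleftrightarrow> nf cs \<and> 1 \<le> b \<and> b \<le> i \<and>
    (\<forall>(b', i')\<in>set cs. b' < b \<and> i' < i)"
  by (auto simp: nf_def sorted_wrt_append)

lemma letters_snoc: "letters (cs @ [(b, i)]) = letters cs \<union> {b..i}"
  by (auto simp: letters_def)

lemma nfword_snoc: "nfword (cs @ [(b, i)]) = nfword cs @ rev [b..<Suc i]"
  by (simp add: nfword_def)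

text \<open>Compare the letter with the last run \<open>(b, i)\<close>. Above the run it starts a
  new one; inside, it moves left until a braid word appears; at the bottom it forms a square; just
  below, it prolongs the run if possible; further below it passes the run and the induction applies.
  The last clause bounds the new tops and bottoms, so that the run can be put back after the
  induction.\<close>

lemma nf_append_letter:
  assumes "nf cs" "letters cs \<subseteq> {1..<n}" "l \<in> {1..<n}"
  shows "gp (nfword cs) * g l \<in> S (length (nfword cs)) \<or>
    (\<exists>ds. nf ds \<and> letters ds \<subseteq> {1..<n} \<and> length (nfword ds) = Suc (length
        (nfword cs)) \<and>
      gp (nfword cs) * g l \<approx> gp (nfword ds) \<and>
      (\<forall>B I. (\<forall>(b, i)\<in>set cs. b < B \<and> i < I) \<and> l < B \<and> l < I
          \<longrightarrow> (\<forall>(b, i)\<in>set ds. b < B \<and> i < I)))"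
  using assms(1,2)
proof (induction cs rule: rev_induct)
  case Nil
  show ?case
    using assms(3) by (intro disjI2 exI[of _ "[(l, l)]"]) (simp add: nf_Cons letters_Cons nfword_Cons)
next
  case (snoc c cs)
  obtain b i where c: "c = (b, i)" by (cases c)
  have nf: "nf cs" "1 \<le> b" "b \<le> i" and bd: "\<And>b' i'. (b', i') \<in> set cs \<Longrightarrow>
      b' < b \<and> i' < i"
    using snoc.prems(1) by (auto simp: c nf_snoc)
  have lets: "letters cs \<subseteq> {1..<n}" "{b..i} \<subseteq> {1..<n}"
    using snoc.prems(2) by (auto simp: c letters_snoc)
  have i: "i \<in> {1..<n}" using lets(2) nf by auto
  let ?w = "nfword cs" and ?c = "rev [b..<Suc i]"
  have W: "nfword (cs @ [c]) = ?w @ ?c" by (simp only: c nfword_snoc)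
  have sw: "set ?w \<subseteq> {1..<n}" using lets(1) by (simp add: set_nfword)
  have sub: "set (rev [x..<y]) \<subseteq> {1..<n}" if "b \<le> x" "y \<le> Suc i" for x y
  proof
    fix a assume "a \<in> set (rev [x..<y])"
    then have "a \<in> {b..i}" using that by auto
    then show "a \<in> {1..<n}" using lets(2) by blast
  qed
  consider (gt) "i < l" | (mid) "b < l" "l \<le> i" | (eq) "l = b" | (adj) "Suc l = b" | (far) "Suc l < b"
    by linarith
  then show ?case
  proof cases
    case gt
    show ?thesis
    proof (intro disjI2 exI[of _ "(cs @ [c]) @ [(l, l)]"] conjI)
      show "nf ((cs @ [c]) @ [(l, l)])"
        unfolding nf_snoc[of "cs @ [c]"]
      proof (intro conjI ballI)
        fix p assume "p \<in> set (cs @ [c])"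
        then consider "p = (b, i)" | "p \<in> set cs" by (auto simp: c)
        then show "case p of (b', i') \<Rightarrow> b' < l \<and> i' < l"
        proof cases
          case 1
          then show ?thesis using gt nf by simp
        next
          case 2
          then show ?thesis using bd[of "fst p" "snd p"] gt nf by (simp add: split_beta)
        qed
      qed (use snoc.prems(1) assms(3) in simp_all)
      show "letters ((cs @ [c]) @ [(l, l)]) \<subseteq> {1..<n}"
        unfolding letters_snoc using snoc.prems(2) assms(3) by auto
    next
      have "nfword ((cs @ [c]) @ [(l, l)]) = nfword (cs @ [c]) @ [l]"
        unfolding nfword_snoc by simp
      then show "length (nfword ((cs @ [c]) @ [(l, l)])) = Suc (length (nfword (cs @ [c])))"
        "gp (nfword (cs @ [c])) * g l \<approx> gp (nfword ((cs @ [c]) @ [(l, l)]))"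
        by simp_all
      show "\<forall>B I. (\<forall>(b, i)\<in>set (cs @ [c]). b < B \<and> i < I) \<and> l < B \<and> l
          < I \<longrightarrow>
            (\<forall>(b, i)\<in>set ((cs @ [c]) @ [(l, l)]). b < B \<and> i < I)"
        by simp
    qed
  next
    case mid
    obtain m where m: "l = Suc m" "b \<le> m" using mid by (cases l) auto
    have "[b..<Suc i] = [b..<m] @ [m, l] @ [Suc l..<Suc i]"
    proof -
      have "[b..<Suc i] = [b..<m] @ [m..<Suc i]"
        using m mid upt_add_eq_append[of b m "Suc i - m"] by (simp del: upt_Suc)
      moreover have "[m..<Suc i] = m # [l..<Suc i]" using m mid by (simp add: upt_conv_Cons del: upt_Suc)
      moreover have "[l..<Suc i] = l # [Suc l..<Suc i]" using m mid by (simp add: upt_conv_Cons del: upt_Suc)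
      ultimately show ?thesis by simp
    qed
    \<comment> \<open>The letters below \<open>m\<close> commute with the appended \<open>l\<close>,
      which thus meets \<open>l m\<close> and completes a braid word.\<close>
    then have cyc: "?c = rev [Suc l..<Suc i] @ [l, m] @ rev [b..<m]" by simp
    have mn: "1 \<le> m" "Suc m < n" using m mid nf i by auto
    let ?u = "?w @ rev [Suc l..<Suc i]" and ?v = "rev [b..<m]"
    have "gp (nfword (cs @ [c])) * g l = gp ?u * g l * g m * (gp ?v * g l)"
      unfolding W cyc by (simp only: gp_simps mult.assoc mult_1_right mult_1_left)
    also have "\<dots> \<approx> gp ?u * g l * g m * (g l * gp ?v)"
      using m mid assms(3) sub by (intro eqv_lmult gp_commute) auto
    also have "gp ?u * g l * g m * (g l * gp ?v) = gp ?u * (g (Suc m) * g m * g (Suc m)) * gp ?v"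
      by (simp add: m(1) mult.assoc)
    finally have *: "gp (nfword (cs @ [c])) * g l \<approx> gp ?u * (g (Suc m) * g m * g (Suc m)) * gp ?v" .
    have "gp ?u * (g (Suc m) * g m * g (Suc m)) * gp ?v \<in> S (length ?u + 2 + length ?v)"
    proof (intro S_context S_TL mn)
      show "set ?u \<subseteq> {1..<n}" using sw sub[of "Suc l" "Suc i"] mid by (simp del: upt_Suc)
      show "set ?v \<subseteq> {1..<n}" using m mid by (intro sub) simp_all
    qed
    moreover have "length ?u + 2 + length ?v = length (nfword (cs @ [c]))"
      unfolding W cyc by simp
    ultimately show ?thesis using S_eqv[OF *] by simp
  next
    case eq
    have cyc: "?c = rev [Suc b..<Suc i] @ [b]"
      using nf by (simp add: upt_conv_Cons del: upt_Suc)
    let ?u = "?w @ rev [Suc b..<Suc i]"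
    have "gp (nfword (cs @ [c])) * g l = gp ?u * (g b * g b)"
      unfolding W cyc eq by (simp add: mult.assoc del: upt_Suc)
    also have "\<dots> \<in> S (length ?u + 1)"
    proof (intro S_context_left S_square)
      show "b \<in> {1..<n}" using eq assms(3) by simp
      show "set ?u \<subseteq> {1..<n}" using sw sub[of "Suc b" "Suc i"] by (simp del: upt_Suc)
    qed
    also have "length ?u + 1 = length (nfword (cs @ [c]))"
      unfolding W cyc by (simp del: upt_Suc)
    finally show ?thesis by blast
  next
    case adj
    show ?thesis
    \<comment> \<open>If the previous run already ends at \<open>l\<close>, prolonging would repeat
      a bottom; instead that earlier \<open>l\<close> commutes with the run down to \<open>b\<close>
      and a braid word appears.\<close>
    proof (cases "\<exists>cs' i'. cs = cs' @ [(l, i')]")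
      case True
      then obtain cs' i' where cs: "cs = cs' @ [(l, i')]" by blast
      have li': "l \<le> i'" "i' < i" using nf(1) bd[of l i'] by (auto simp: cs nf_snoc)
      have cyc: "?c = rev [Suc b..<Suc i] @ [b]"
        using nf by (simp add: upt_conv_Cons del: upt_Suc)
      have cw: "?w = (nfword cs' @ rev [Suc l..<Suc i']) @ [l]"
        unfolding cs nfword_snoc using li' by (simp add: upt_conv_Cons del: upt_Suc)
      let ?u = "nfword cs' @ rev [Suc l..<Suc i']" and ?v = "rev [Suc b..<Suc i]"
      have su: "set ?u \<subseteq> {1..<n}" using sw unfolding cw by (simp del: upt_Suc)
      have sv: "set ?v \<subseteq> {1..<n}" using sub[of "Suc b" "Suc i"] by (simp del: upt_Suc)
      have "gp (nfword (cs @ [c])) * g l = gp ?u * (g l * gp ?v) * (g b * g l)"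
        unfolding W cyc cw by (simp add: mult.assoc del: upt_Suc)
      also have "\<dots> \<approx> gp ?u * (gp ?v * g l) * (g b * g l)"
      proof (intro eqv_rmult eqv_lmult eqv_sym[OF gp_commute] assms(3) sv)
        fix a assume "a \<in> set ?v"
        then show "Suc a < l \<or> Suc l < a" using adj by auto
      qed
      also have "gp ?u * (gp ?v * g l) * (g b * g l) = gp (?u @ ?v) * (g l * g (Suc l) * g l)"
        by (simp add: adj[symmetric] mult.assoc del: upt_Suc)
      finally have *: "gp (nfword (cs @ [c])) * g l \<approx> gp (?u @ ?v) * (g l * g (Suc l) * g l)" .
      have "gp (?u @ ?v) * (g l * g (Suc l) * g l) \<in> S (length (?u @ ?v) + 2)"
      proof (intro S_context_left S_TL)
        show "1 \<le> l" "Suc l < n" using adj assms(3) nf i by auto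
        show "set (?u @ ?v) \<subseteq> {1..<n}" using su sv by (simp del: upt_Suc)
      qed
      moreover have "length (?u @ ?v) + 2 = length (nfword (cs @ [c]))"
        unfolding W cyc cw by (simp del: upt_Suc)
      ultimately show ?thesis using S_eqv[OF *] by simp
    next
      case False
      have below: "b' < l \<and> i' < i" if "(b', i') \<in> set cs" for b' i'
      proof -
        have "cs \<noteq> []" using that by auto
        then obtain cs' c' where c': "cs = cs' @ [c']" by (meson rev_exhaust)
        obtain b'' i'' where "c' = (b'', i'')" by (cases c')
        with c' have cs: "cs = cs' @ [(b'', i'')]" by simp
        then have "b'' < b" "b'' \<noteq> l" using bd[of b'' i''] False by auto
        then have "b'' < l" using adj by linarith
        moreover have "b' \<le> b''"
        proof (cases "(b', i') = (b'', i'')")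
          case False
          then have "(b', i') \<in> set cs'" using that cs by auto
          moreover have "\<forall>(b', i')\<in>set cs'. b' < b'' \<and> i' < i''" using nf(1) unfolding
              cs nf_snoc by blast
          ultimately show ?thesis by fastforce
        qed simp
        ultimately show ?thesis using bd[OF that] by linarith
      qed
      have cyc: "rev [l..<Suc i] = ?c @ [l]"
        using nf adj by (simp add: upt_conv_Cons[of l "Suc i"] del: upt_Suc)
      show ?thesis
      proof (intro disjI2 exI[of _ "cs @ [(l, i)]"] conjI)
        show "nf (cs @ [(l, i)])"
          unfolding nf_snoc
        proof (intro conjI)
          show "nf cs" "1 \<le> l" "l \<le> i" using nf adj assms(3) by simp_all
          show "\<forall>(b', i')\<in>set cs. b' < l \<and> i' < i" using below by blast
        qed
        show "letters (cs @ [(l, i)]) \<subseteq> {1..<n}"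
          unfolding letters_snoc using lets assms(3) i by auto
        show "length (nfword (cs @ [(l, i)])) = Suc (length (nfword (cs @ [c])))"
          unfolding W nfword_snoc cyc by (simp del: upt_Suc)
        show "gp (nfword (cs @ [c])) * g l \<approx> gp (nfword (cs @ [(l, i)]))"
          unfolding W nfword_snoc cyc by (simp add: mult.assoc del: upt_Suc)
        show "\<forall>B I. (\<forall>(b, i)\<in>set (cs @ [c]). b < B \<and> i < I) \<and> l < B \<and>
            l < I \<longrightarrow>
            (\<forall>(b, i)\<in>set (cs @ [(l, i)]). b < B \<and> i < I)"
        proof (intro allI impI)
          fix B I assume h: "(\<forall>(b, i)\<in>set (cs @ [c]). b < B \<and> i < I) \<and> l < B \<and> l < I"
          then have "i < I" by (simp add: c)
          then show "\<forall>(b, i)\<in>set (cs @ [(l, i)]). b < B \<and> i < I" using h by simp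
        qed
      qed
    qed
  next
    case far
    have com: "gp ?c * g l \<approx> g l * gp ?c"
    proof (rule gp_commute[OF assms(3) sub])
      fix a assume "a \<in> set ?c"
      then show "Suc a < l \<or> Suc l < a" using far by auto
    qed simp_all
    have "gp (nfword (cs @ [c])) * g l = gp ?w * (gp ?c * g l)" unfolding W by (simp only: gp_simps mult.assoc)
    also have "\<dots> \<approx> gp ?w * (g l * gp ?c)" by (rule eqv_lmult[OF com])
    also have "gp ?w * (g l * gp ?c) = gp ?w * g l * gp ?c" by (simp only: mult.assoc)
    finally have *: "gp (nfword (cs @ [c])) * g l \<approx> gp ?w * g l * gp ?c" .
    from snoc.IH[OF nf(1) lets(1)] show ?thesis
    proof
      assume "gp ?w * g l \<in> S (length ?w)"
      then have "gp ?w * g l * gp ?c \<in> S (length ?w + length ?c)"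
        by (intro S_mult S_gp sub) simp_all
      then show ?thesis using S_eqv[OF *] unfolding W by (simp del: upt_Suc)
    next
      assume "\<exists>ds. nf ds \<and> letters ds \<subseteq> {1..<n} \<and> length (nfword ds) = Suc
          (length ?w) \<and>
        gp ?w * g l \<approx> gp (nfword ds) \<and> (\<forall>B I. (\<forall>(b, i)\<in>set cs. b < B
            \<and> i < I) \<and> l < B \<and> l < I \<longrightarrow>
          (\<forall>(b, i)\<in>set ds. b < B \<and> i < I))"
      then obtain ds where ds: "nf ds" "letters ds \<subseteq> {1..<n}" "length (nfword ds) = Suc (length ?w)"
        "gp ?w * g l \<approx> gp (nfword ds)"
        and bnd': "\<forall>B I. (\<forall>(b, i)\<in>set cs. b < B \<and> i < I) \<and> l < B \<and> l <
            I \<longrightarrow>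
          (\<forall>(b, i)\<in>set ds. b < B \<and> i < I)" by (elim exE conjE)
      have bnd: "\<forall>(b, i)\<in>set ds. b < B \<and> i < I"
        if "\<forall>(b, i)\<in>set cs. b < B \<and> i < I" "l < B" "l < I" for B I
        using bnd'[rule_format, of B I] that by simp
      have dsb: "\<forall>(b', i')\<in>set ds. b' < b \<and> i' < i"
      proof (rule bnd)
        show "\<forall>(b', i')\<in>set cs. b' < b \<and> i' < i" using bd by blast
        show "l < b" "l < i" using far nf by linarith+
      qed
      show ?thesis
      proof (intro disjI2 exI[of _ "ds @ [c]"] conjI)
        show "nf (ds @ [c])" unfolding c nf_snoc by (intro conjI ds(1) nf dsb)
        show "letters (ds @ [c]) \<subseteq> {1..<n}" unfolding c letters_snoc using ds(2) lets(2) by blast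
        show "length (nfword (ds @ [c])) = Suc (length (nfword (cs @ [c])))"
          unfolding W unfolding c nfword_snoc using ds(3) by (simp del: upt_Suc)
        show "gp (nfword (cs @ [c])) * g l \<approx> gp (nfword (ds @ [c]))"
        proof -
          have "gp (nfword (ds @ [c])) = gp (nfword ds) * gp ?c"
            by (simp only: c nfword_snoc gp_simps)
          then show ?thesis using eqv_trans[OF * eqv_rmult[OF ds(4)]] by (simp only:)
        qed
        show "\<forall>B I. (\<forall>(b, i)\<in>set (cs @ [c]). b < B \<and> i < I) \<and> l < B \<and>
            l < I \<longrightarrow>
            (\<forall>(b, i)\<in>set (ds @ [c]). b < B \<and> i < I)"
        proof (intro allI impI)
          fix B I assume h: "(\<forall>(b, i)\<in>set (cs @ [c]). b < B \<and> i < I) \<and> l < B \<and> l < I"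
          then have "\<forall>(b, i)\<in>set ds. b < B \<and> i < I" by (intro bnd) simp_all
          then show "\<forall>(b, i)\<in>set (ds @ [c]). b < B \<and> i < I" using h by simp
        qed
      qed
    qed
  qed
qed

text \<open>Append the letters one at a time; a word that misses a normal form of its own length
  loses a letter. The clause \<open>w \<noteq> []\<close> keeps \<open>length w - 1\<close> from
  truncating.\<close>

lemma gp_reduce:
  assumes "set w \<subseteq> {1..<n}"
  shows "(w \<noteq> [] \<and> gp w \<in> S (length w - 1)) \<or>
    (\<exists>cs. nf cs \<and> letters cs \<subseteq> {1..<n} \<and> length (nfword cs) = length w \<and>
        gp w \<approx> gp (nfword cs))"
  using assms
proof (induction w rule: rev_induct)
  case Nil
  show ?case by (intro disjI2 exI[of _ "[]"]) simp
next
  case (snoc l w)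
  have l: "l \<in> {1..<n}" and w: "set w \<subseteq> {1..<n}" using snoc.prems by auto
  from snoc.IH[OF w] show ?case
  proof
    assume h: "w \<noteq> [] \<and> gp w \<in> S (length w - 1)"
    then have "gp w * gp [l] \<in> S (length w - 1 + length [l])"
      using l by (intro S_mult S_gp) auto
    moreover have "length w - 1 + length [l] = length w" using h by (cases w) simp_all
    ultimately show ?thesis by simp
  next
    assume "\<exists>cs. nf cs \<and> letters cs \<subseteq> {1..<n} \<and> length (nfword cs) = length w
        \<and> gp w \<approx> gp (nfword cs)"
    then obtain cs where cs: "nf cs" "letters cs \<subseteq> {1..<n}" "length (nfword cs) = length w"
      "gp w \<approx> gp (nfword cs)" by blast
    have 1: "gp (w @ [l]) \<approx> gp (nfword cs) * g l" using eqv_rmult[OF cs(4), of "g l"] by simp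
    from nf_append_letter[OF cs(1,2) l] show ?thesis
    proof
      assume "gp (nfword cs) * g l \<in> S (length (nfword cs))"
      then show ?thesis using S_eqv[OF 1] cs(3) by simp
    next
      assume "\<exists>ds. nf ds \<and> letters ds \<subseteq> {1..<n} \<and> length (nfword ds) = Suc
          (length (nfword cs)) \<and>
        gp (nfword cs) * g l \<approx> gp (nfword ds) \<and>
        (\<forall>B I. (\<forall>(b, i)\<in>set cs. b < B \<and> i < I) \<and> l < B \<and> l < I
            \<longrightarrow> (\<forall>(b, i)\<in>set ds. b < B \<and> i < I))"
      then obtain ds where ds: "nf ds" "letters ds \<subseteq> {1..<n}" "length (nfword ds) = Suc (length
          (nfword cs))"
        "gp (nfword cs) * g l \<approx> gp (nfword ds)" by (elim exE conjE)
      then show ?thesis using eqv_trans[OF 1 ds(4)] cs(3) by (intro disjI2 exI[of _ ds]) simp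
    qed
  qed
qed

end

text \<open>Properness sees only which values are equal, so a character with two distinct values may
  be replaced by a Boolean state.\<close>

lemma proper_two_point:
  assumes "\<And>s. s \<in> {1..n} \<Longrightarrow> \<chi> s = (if y s then \<beta> else \<alpha>)"
      "\<alpha> \<noteq> \<beta>" "set w \<subseteq> {1..<n}"
  shows "proper \<chi> w \<longleftrightarrow> proper y w"
  using assms(1,3)
proof (induction w arbitrary: \<chi> y)
  case (Cons a w)
  have a: "a \<in> {1..n}" "Suc a \<in> {1..n}" and w: "set w \<subseteq> {1..<n}" using Cons.prems(2) by auto
  have "flip a \<chi> s = (if flip a y s then \<beta> else \<alpha>)" if "s \<in> {1..n}" for s
    using Cons.prems(1)[OF a(1)] Cons.prems(1)[OF a(2)] Cons.prems(1)[OF that]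
    by (simp add: flip_apply)
  from Cons.IH[OF this w] show ?case
    using Cons.prems(1)[OF a(1)] Cons.prems(1)[OF a(2)] assms(2) by simp
qed simp

context ytl
begin

section \<open>Moving the \<open>T\<close> letters to the left\<close>

lemma g_tp:
  assumes "i \<in> {1..<n}" "set js \<subseteq> {1..n}"
  shows "\<exists>js'. set js' \<subseteq> {1..n} \<and> g i * tp js \<approx> tp js' * g i"
  using assms(2)
proof (induction js)
  case Nil
  show ?case by (intro exI[of _ "[]"]) simp
next
  case (Cons j js)
  then obtain js' where js': "set js' \<subseteq> {1..n}" "g i * tp js \<approx> tp js' * g i" by auto
  have j: "sw i j \<in> {1..n}" "sw i (sw i j) = j" using Cons.prems assms(1) by (auto simp: sw_def)
  have "g i * tp (j # js) = g i * t j * tp js" by (simp add: mult.assoc)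
  also have "\<dots> \<approx> t (sw i j) * g i * tp js"
    using eqv_sym[OF rel_tg[OF assms(1) j(1)]] j(2) by (intro eqv_rmult) simp
  also have "t (sw i j) * g i * tp js = t (sw i j) * (g i * tp js)" by (simp add: mult.assoc)
  also have "\<dots> \<approx> t (sw i j) * (tp js' * g i)" by (rule eqv_lmult[OF js'(2)])
  also have "\<dots> = tp (sw i j # js') * g i" by (simp add: mult.assoc)
  finally show ?case using js'(1) j(1) by (intro exI[of _ "sw i j # js'"]) simp
qed

lemma vp_normal:
  assumes "set w \<subseteq> gset"
  shows "set (gpart w) \<subseteq> {1..<n} \<and> (\<exists>js. set js \<subseteq> {1..n} \<and> vp w
      \<approx> tp js * gp (gpart w))"
  using assms
proof (induction w)
  case Nil
  show ?case by (intro conjI exI[of _ "[]"]) simp_all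
next
  case (Cons x w)
  then obtain js where js: "set (gpart w) \<subseteq> {1..<n}" "set js \<subseteq> {1..n}" "vp w
      \<approx> tp js * gp (gpart w)"
    by auto
  show ?case
  proof (cases x)
    case (G i)
    have i: "i \<in> {1..<n}" using Cons.prems by (auto simp: G gset_def)
    from g_tp[OF i js(2)] obtain js' where js': "set js' \<subseteq> {1..n}" "g i * tp js \<approx> tp
        js' * g i" by blast
    have "vp (x # w) \<approx> g i * (tp js * gp (gpart w))"
      using eqv_lmult[OF js(3), of "g i"] by (simp add: G val_def)
    moreover have "g i * (tp js * gp (gpart w)) \<approx> tp js' * gp (gpart (x # w))"
      using eqv_rmult[OF js'(2), of "gp (gpart w)"] by (simp add: G mult.assoc)
    ultimately have "vp (x # w) \<approx> tp js' * gp (gpart (x # w))" by (rule eqv_trans)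
    then show ?thesis using js' js(1) i by (auto simp: G)
  next
    case (T j)
    have j: "j \<in> {1..n}" using Cons.prems by (auto simp: T gset_def)
    have "vp (x # w) \<approx> tp (j # js) * gp (gpart (x # w))"
      using eqv_lmult[OF js(3), of "t j"] by (simp add: T val_def mult.assoc)
    moreover have "set (j # js) \<subseteq> {1..n}" using js(2) j by simp
    ultimately show ?thesis using js(1) unfolding T by (intro conjI exI[of _ "j # js"]) simp_all
  qed
qed

definition NF :: "nat \<Rightarrow> 'a set" where
  "NF L = {tp js * gp (nfword cs) | js cs. set js \<subseteq> {1..n} \<and> nf cs \<and> letters cs
      \<subseteq> {1..<n} \<and>
     length (nfword cs) \<le> L}"

lemma NF_I: "\<lbrakk>set js \<subseteq> {1..n}; nf cs; letters cs \<subseteq> {1..<n}; length (nfword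
    cs) \<le> L\<rbrakk> \<Longrightarrow>
    tp js * gp (nfword cs) \<in> NF L"
  unfolding NF_def by blast

lemma spn_NF_mono: "L \<le> L' \<Longrightarrow> x \<in> spn (NF L) \<Longrightarrow> x \<in> spn (NF L')"
proof (erule spn_subset[rotated])
  fix b assume "L \<le> L'" "b \<in> NF L"
  then show "b \<in> spn (NF L')" unfolding NF_def[of L] by (auto intro!: spn_mem NF_I)
qed

lemma tp_spn_NF: "set js \<subseteq> {1..n} \<Longrightarrow> x \<in> spn (NF L) \<Longrightarrow> tp js
    * x \<in> spn (NF L)"
proof (erule spn_lmult[rotated])
  fix b assume "set js \<subseteq> {1..n}" "b \<in> NF L"
  then obtain js' cs where b: "b = tp js' * gp (nfword cs)" "set js' \<subseteq> {1..n}" "nf cs"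
    "letters cs \<subseteq> {1..<n}" "length (nfword cs) \<le> L" unfolding NF_def by blast
  then have "tp (js @ js') * gp (nfword cs) \<in> spn (NF L)"
    using \<open>set js \<subseteq> _\<close> by (intro spn_mem NF_I) simp_all
  then show "tp js * b \<in> spn (NF L)" by (simp add: b(1) mult.assoc)
qed

text \<open>Once the \<open>T\<close> letters are separated, the \<open>G\<close> word is either
  congruent to a normal form or falls into a smaller step of the filtration.\<close>

theorem S_subset_NF: "x \<in> S L \<Longrightarrow> x \<in> spn (NF L)"
proof (induction L arbitrary: x rule: less_induct)
  case (less L)
  show ?case
  proof (rule spn_subset[OF _ less.prems[unfolded S_def]])
    fix b assume "b \<in> {vp w |w. set w \<subseteq> gset \<and> length (gpart w) \<le> L}"
    then obtain w where w: "b = vp w" "set w \<subseteq> gset" "length (gpart w) \<le> L" by blast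
    let ?v = "gpart w"
    from vp_normal[OF w(2)] obtain js where js: "set ?v \<subseteq> {1..<n}" "set js \<subseteq> {1..n}"
        "vp w \<approx> tp js * gp ?v"
      by blast
    have "gp ?v \<in> spn (NF L)"
    proof (cases "?v \<noteq> [] \<and> gp ?v \<in> S (length ?v - 1)")
      case True
      then have lt: "length ?v - 1 < L" using w(3) by (cases ?v) simp_all
      then show ?thesis
        using less.IH[OF lt] True spn_NF_mono[of "length ?v - 1" L] by simp
    next
      case False
      with gp_reduce[OF js(1)] have "\<exists>cs. nf cs \<and> letters cs \<subseteq> {1..<n} \<and>
          length (nfword cs) = length ?v \<and>
        gp ?v \<approx> gp (nfword cs)" by (simp only: simp_thms)
      then obtain cs where cs: "nf cs" "letters cs \<subseteq> {1..<n}" "length (nfword cs) = length ?v"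
        "gp ?v \<approx> gp (nfword cs)" by (elim exE conjE)
      have "tp [] * gp (nfword cs) \<in> spn (NF L)"
        using cs w(3) by (intro spn_mem NF_I) simp_all
      then show ?thesis using spn_eqv[OF cs(4)] by simp
    qed
    then have "tp js * gp ?v \<in> spn (NF L)" by (rule tp_spn_NF[OF js(2)])
    then show "b \<in> spn (NF L)" unfolding w(1) by (rule spn_eqv[OF js(3)])
  qed
qed

section \<open>From idempotents to the monomials of the exponent sets\<close>

lemma E_S: "E \<chi> \<in> S 0"
proof -
  have "EE k \<chi> \<in> S 0" if "k \<le> n" for k
    using that
  proof (induction k)
    case (Suc k)
    have "idem (Suc k) (\<chi> (Suc k)) \<in> S 0"
      unfolding idem_def using Suc.prems by (intro S_scale S_sum S_t_power) simp
    then show ?case using Suc by (simp add: S_mult_0)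
  qed (simp add: S_one)
  then show ?thesis by (simp add: E_def)
qed

lemma t_power_E: "j \<in> {1..n} \<Longrightarrow> t j ^ s * E \<chi> \<approx> z (zeta d (\<chi> j) ^ s)
    * E \<chi>"
proof (induction s)
  case (Suc s)
  have 1: "t j ^ Suc s * E \<chi> = t j * (t j ^ s * E \<chi>)" by (simp add: mult.assoc)
  have 2: "t j * (t j ^ s * E \<chi>) \<approx> t j * (z (zeta d (\<chi> j) ^ s) * E \<chi>)" by (intro
      eqv_lmult Suc)
  have 3: "t j * (z (zeta d (\<chi> j) ^ s) * E \<chi>) = z (zeta d (\<chi> j) ^ s) * (t j * E \<chi>)"
      by (rule \<kappa>_left_commute)
  have 4: "z (zeta d (\<chi> j) ^ s) * (t j * E \<chi>) \<approx> z (zeta d (\<chi> j) ^ s) * (z (zeta d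
      (\<chi> j)) * E \<chi>)"
    by (intro eqv_lmult t_E Suc)
  have 5: "z (zeta d (\<chi> j) ^ s) * (z (zeta d (\<chi> j)) * E \<chi>) = z (zeta d (\<chi> j) ^ Suc s)
      * E \<chi>"
    by (simp only: power_Suc2 z_mult mult.assoc)
  show ?case unfolding 1 5[symmetric] using 2 4 unfolding 3 by (rule eqv_trans)
qed simp

lemma tp_E: "set js \<subseteq> {1..n} \<Longrightarrow> \<exists>c. tp js * E \<chi> \<approx> z c * E \<chi>"
proof (induction js)
  case Nil
  show ?case by (intro exI[of _ 1]) simp
next
  case (Cons j js)
  then obtain c where c: "tp js * E \<chi> \<approx> z c * E \<chi>" by auto
  have "tp (j # js) * E \<chi> \<approx> t j * (z c * E \<chi>)" using eqv_lmult[OF c, of "t j"] by (simp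
      add: mult.assoc)
  moreover have "t j * (z c * E \<chi>) \<approx> z (c * zeta d (\<chi> j)) * E \<chi>"
    unfolding \<kappa>_left_commute[of "t j"] z_mult mult.assoc using Cons.prems by (intro eqv_lmult t_E) simp
  ultimately show ?case using eqv_trans by blast
qed

lemma tword_E: "vp (tword n r) * E \<chi> \<approx> z (monom_at (zeta d) n r \<chi>) * E \<chi>"
proof -
  have *: "vp (concat (map (\<lambda>j. replicate (r ! (j - 1)) (T j)) js)) * E \<chi> \<approx>
      z (\<Prod>j\<leftarrow>js. zeta d (\<chi> j) ^ (r ! (j - 1))) * E \<chi>" if "set js \<subseteq>
          {1..n}" for js
    using that
  proof (induction js)
    case (Cons j js)
    let ?P = "\<Prod>j\<leftarrow>js. zeta d (\<chi> j) ^ (r ! (j - 1))" and ?k = "r ! (j - 1)"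
    let ?W = "vp (concat (map (\<lambda>j. replicate (r ! (j - 1)) (T j)) js))"
    have "?W * E \<chi> \<approx> z ?P * E \<chi>" using Cons by simp
    then have "t j ^ ?k * (?W * E \<chi>) \<approx> t j ^ ?k * (z ?P * E \<chi>)" by (rule eqv_lmult)
    moreover have "t j ^ ?k * (z ?P * E \<chi>) \<approx> z ?P * (z (zeta d (\<chi> j) ^ ?k) * E \<chi>)"
      unfolding \<kappa>_left_commute[of "t j ^ ?k"] using Cons.prems by (intro eqv_lmult t_power_E) simp
    ultimately have "t j ^ ?k * (?W * E \<chi>) \<approx> z ?P * (z (zeta d (\<chi> j) ^ ?k) * E \<chi>)"
        by (rule eqv_trans)
    moreover have "z ?P * (z (zeta d (\<chi> j) ^ ?k) * E \<chi>) = z (zeta d (\<chi> j) ^ ?k * ?P) * E \<chi>"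
      unfolding mult.commute[of "zeta d (\<chi> j) ^ ?k" ?P] by (simp only: z_mult mult.assoc)
    ultimately show ?case by (simp add: vp_replicate_T mult.assoc)
  qed simp
  have s: "set [1..<n + 1] = {1..n}" by auto
  have "(\<Prod>j\<leftarrow>[1..<n + 1]. zeta d (\<chi> j) ^ (r ! (j - 1))) = (\<Prod>j\<in>set [1..<n +
      1]. zeta d (\<chi> j) ^ (r ! (j - 1)))"
    by (rule prod.distinct_set_conv_list[OF distinct_upt, symmetric])
  then show ?thesis
    using *[of "[1..<n + 1]"] s unfolding tword_def monom_at_def by (simp only: order_refl s)
qed

text \<open>Three values put the idempotent into \<open>J\<close>. A constant character is a point
  of every word, via equal colours. In the remaining case the two-colouring is not proper, and a
  letter can be deleted.\<close>

lemma E_outside_Zset: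
  assumes cs: "nf cs" "letters cs \<subseteq> {1..<n}" and \<chi>: "\<chi> \<in> Ch" "\<chi> \<notin>
      Zset d n cs"
  shows "E \<chi> * gp (nfword cs) \<in> J \<or> (\<exists>L<length (nfword cs). E \<chi> * gp (nfword
      cs) \<in> S L)"
proof (cases "\<exists>p\<in>{1..n}. \<exists>q\<in>{1..n}. \<exists>r\<in>{1..n}. \<chi> p \<noteq>
    \<chi> q \<and> \<chi> p \<noteq> \<chi> r \<and> \<chi> q \<noteq> \<chi> r")
  case True
  then obtain p q r where p: "p \<in> {1..n}" "q \<in> {1..n}" "r \<in> {1..n}"
    "\<chi> p \<noteq> \<chi> q" "\<chi> p \<noteq> \<chi> r" "\<chi> q \<noteq> \<chi> r" by blast
  have ne: "p \<noteq> q" "p \<noteq> r" "q \<noteq> r" using p by auto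
  have bd: "1 \<le> p" "1 \<le> q" "1 \<le> r" "p \<le> n" "q \<le> n" "r \<le> n" using p by auto
  note p' = p(4-6) p(4-6)[symmetric]
  consider "p < q" "q < r" | "p < r" "r < q" | "q < p" "p < r" | "q < r" "r < p" | "r < p" "p < q" | "r <
      q" "q < p"
    using ne by linarith
  then have "E \<chi> \<in> J"
  proof cases
    case 1
    show ?thesis by (rule E_three_values[OF \<chi>(1) bd(1) 1 bd(6)]) (rule p')+
  next
    case 2
    show ?thesis by (rule E_three_values[OF \<chi>(1) bd(1) 2 bd(5)]) (rule p')+
  next
    case 3
    show ?thesis by (rule E_three_values[OF \<chi>(1) bd(2) 3 bd(6)]) (rule p')+
  next
    case 4
    show ?thesis by (rule E_three_values[OF \<chi>(1) bd(2) 4 bd(4)]) (rule p')+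
  next
    case 5
    show ?thesis by (rule E_three_values[OF \<chi>(1) bd(3) 5 bd(5)]) (rule p')+
  next
    case 6
    show ?thesis by (rule E_three_values[OF \<chi>(1) bd(3) 6 bd(4)]) (rule p')+
  qed
  then show ?thesis by (intro disjI1 J_rmult)
next
  case few: False
  have ext: "\<chi> = two_point n \<alpha> \<beta> y" if "\<And>j. j \<in> {1..n} \<Longrightarrow>
      \<chi> j = (if y j then \<beta> else \<alpha>)" for \<alpha> \<beta> y
  proof (rule extensionalityI[of _ "{1..n}"])
    show "\<chi> \<in> extensional {1..n}" using \<chi>(1) unfolding Ch_def by (simp add: PiE_def)
    show "two_point n \<alpha> \<beta> y \<in> extensional {1..n}" unfolding two_point_def by (rule
        restrict_extensional)
    fix j assume "j \<in> {1..n}"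
    then show "\<chi> j = two_point n \<alpha> \<beta> y j" using that by (simp only: two_point_apply)
  qed
  have proper: "proper (colouring cs {}) (nfword cs)" by (rule proper_colouring[OF cs(1)])
  have "\<exists>j\<in>{1..n}. \<exists>k\<in>{1..n}. \<chi> j \<noteq> \<chi> k"
  proof (rule ccontr)
    assume c: "\<not> ?thesis"
    show False
    \<comment> \<open>For \<open>n = 0\<close> the empty character has no value to name; the colour
      \<open>0\<close> exists because \<open>d\<close> is positive.\<close>
    proof (cases "n = 0")
      case True
      then have "\<chi> = two_point n 0 0 (colouring cs {})" by (intro ext) simp
      then show False using \<chi>(2) d1 Zset_I[OF _ _ proper, of 0 d 0 n] by simp
    next
      case False
      then have "1 \<in> {1..n}" by simp
      note one = this
      have "\<chi> j = \<chi> 1" if "j \<in> {1..n}" for j using c one that by blast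
      then have eq: "\<chi> = two_point n (\<chi> 1) (\<chi> 1) (colouring cs {})"
        by (intro ext) (simp only: if_cancel)
      have "\<chi> \<in> Zset d n cs"
        by (subst eq) (rule Zset_I[OF Ch_less[OF \<chi>(1) one] Ch_less[OF \<chi>(1) one] proper])
      then show False using \<chi>(2) by contradiction
    qed
  qed
  then obtain j k where jk: "j \<in> {1..n}" "k \<in> {1..n}" "\<chi> j \<noteq> \<chi> k" by blast
  define y where "y s \<longleftrightarrow> \<chi> s = \<chi> k" for s
  have vals: "\<chi> s = (if y s then \<chi> k else \<chi> j)" if "s \<in> {1..n}" for s
  proof (cases "\<chi> s = \<chi> k")
    case False
    then have "\<chi> s = \<chi> j" using few jk that by blast
    then show ?thesis using False by (simp add: y_def)
  qed (simp add: y_def)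
  have w: "set (nfword cs) \<subseteq> {1..<n}" using cs(2) by (simp add: set_nfword)
  have "\<not> proper y (nfword cs)"
  proof
    assume "proper y (nfword cs)"
    from Zset_I[OF Ch_less[OF \<chi>(1) jk(1)] Ch_less[OF \<chi>(1) jk(2)] this, of n] ext[OF vals]
    show False using \<chi>(2) by simp
  qed
  then have "\<not> proper \<chi> (nfword cs)" 
    using proper_two_point[of n \<chi> y "\<chi> k" "\<chi> j" "nfword cs"] vals jk(3) w by simp
  from E_delete_letter[OF \<chi>(1) w this jk] obtain w' where
    w': "length w' < length (nfword cs)" "set w' \<subseteq> {1..<n}" "E \<chi> * gp (nfword cs)
        \<approx> - (E \<chi> * gp w')" by blast
  have "- (E \<chi> * gp w') \<in> S (length w')" by (intro S_uminus S_mult_0 E_S S_gp w')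
  then have "E \<chi> * gp (nfword cs) \<in> S (length w')" by (rule S_eqv[OF w'(3)])
  then show ?thesis using w'(1) by blast
qed

definition Bas :: "'a set" where
  "Bas = (\<lambda>(ik, r). vp (tword n r) * gp (nfword (cyc ik))) ` Sidx d n"

text \<open>Interpolation gives a combination of monomials that is one at a chosen point of the word
  and zero at the others. Multiplied by the word it yields the idempotent of that point times the
  word, up to idempotents outside \<open>Zset\<close>, which lead to shorter words. Summing over all
  characters recovers the word.\<close>

lemma NF_subset_Bas:
  assumes n: "1 \<le> n"
  shows "x \<in> spn (NF L) \<Longrightarrow> x \<in> spn Bas"
proof (induction L arbitrary: x rule: less_induct)
  case (less L)
  show ?case
  proof (rule spn_subset[OF _ less.prems])
    fix b assume "b \<in> NF L"
    then obtain js cs where b: "b = tp js * gp (nfword cs)" and js: "set js \<subseteq> {1..n}"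
      and cs: "nf cs" "letters cs \<subseteq> {1..<n}" "length (nfword cs) \<le> L" unfolding NF_def by blast
    have "{1..<n} \<subseteq> {1..n - 1}" by auto
    with cs(2) have "letters cs \<subseteq> {1..n - 1}" by (rule order_trans)
    from cyc_surj[OF cs(1) this] obtain ik where ik: "ik \<in> Tn n" "cyc ik = cs" by blast
    let ?w = "gp (nfword cs)" and ?Z = "Zset d n cs" and ?E = "Eset d n ik"
    have out: "E \<chi> * ?w \<in> spn Bas" if \<chi>: "\<chi> \<in> Ch" "\<chi> \<notin> ?Z" for \<chi>
      using E_outside_Zset[OF cs(1,2) \<chi>]
    proof
      assume "\<exists>L'<length (nfword cs). E \<chi> * ?w \<in> S L'"
      then obtain L' where L': "L' < length (nfword cs)" "E \<chi> * ?w \<in> S L'" by blast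
      then have "L' < L" using cs(3) by simp
      then show ?thesis by (rule less.IH) (rule S_subset_NF[OF L'(2)])
    qed (rule spn_J)
    have ZCh: "?Z \<subseteq> Ch"
    proof
      fix \<psi> assume "\<psi> \<in> ?Z"
      then obtain \<alpha> \<beta> y where "\<psi> = two_point n \<alpha> \<beta> y" "\<alpha> < d"
          "\<beta> < d" unfolding Zset_def by blast
      then show "\<psi> \<in> Ch" unfolding Ch_def two_point_def by (simp add: PiE_iff)
    qed
    have ins: "E \<chi> * ?w \<in> spn Bas" if \<chi>: "\<chi> \<in> ?Z" for \<chi>
    proof -
      let ?mon = "\<lambda>r. monom_at (zeta d) n r"
      have fin: "finite ?Z" "card ?Z \<le> card ?E"
        using card_Zset_le[OF ik(1) n d1] ik(2) by simp_all
      have "\<exists>m. \<forall>x\<in>?Z. (\<Sum>r\<in>?E. m r * ?mon r x) = of_bool (x = \<chi>)"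
      proof (rule interpolation)
        show "finite ?Z" "finite ?E" "card ?Z \<le> card ?E" by (fact fin finite_Eset[OF ik(1) n])+
        fix c r assume van: "\<And>x. x \<in> ?Z \<Longrightarrow> (\<Sum>r\<in>?E. c r * ?mon r x) = 0"
            and r: "r \<in> ?E"
        show "c r = 0"
        proof (rule Eset_vanish[OF ik(1) n inj_on_zeta[OF d1] _ r])
          fix \<psi> assume "\<psi> \<in> Zset d n (cyc ik)"
          then show "(\<Sum>r\<in>?E. c r * ?mon r \<psi>) = 0" unfolding ik(2) by (rule van)
        qed
      qed
      then obtain m where m: "\<forall>x\<in>?Z. (\<Sum>r\<in>?E. m r * ?mon r x) = of_bool (x = \<chi>)" ..
      \<comment> \<open>Outside the points of the word the combination takes uncontrolled values,
        but these only multiply terms already known to lie in the span.\<close>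
      define h where "h \<psi> = (\<Sum>r\<in>?E. m r * ?mon r \<psi>)" for \<psi>
      let ?x = "\<Sum>r\<in>?E. z (m r) * (vp (tword n r) * ?w)"
      have "?x \<in> spn Bas"
      proof (intro spn_sum spn_base)
        fix r assume "r \<in> ?E"
        then have "(ik, r) \<in> Sidx d n" using ik(1) by (simp add: Sidx_def)
        then show "vp (tword n r) * ?w \<in> Bas"
          unfolding Bas_def by (rule image_eqI[rotated]) (simp add: ik(2))
      qed
      have tw: "vp (tword n r) * ?w \<approx> (\<Sum>\<psi>\<in>Ch. z (?mon r \<psi>) * (E \<psi> * ?w))" for r
      proof -
        have "vp (tword n r) * ?w = vp (tword n r) * (\<Sum>\<psi>\<in>Ch. E \<psi>) * ?w"
          by (simp only: sum_E mult_1_right)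
        then have "vp (tword n r) * ?w = (\<Sum>\<psi>\<in>Ch. vp (tword n r) * E \<psi> * ?w)"
          by (simp only: sum_distrib_left sum_distrib_right)
        moreover have "(\<Sum>\<psi>\<in>Ch. vp (tword n r) * E \<psi> * ?w) \<approx>
            (\<Sum>\<psi>\<in>Ch. z (?mon r \<psi>) * E \<psi> * ?w)"
          by (intro eqv_sum eqv_rmult tword_E)
        ultimately show ?thesis by (simp only: mult.assoc)
      qed
      have 1: "?x \<approx> (\<Sum>r\<in>?E. z (m r) * (\<Sum>\<psi>\<in>Ch. z (?mon r \<psi>) * (E
          \<psi> * ?w)))"
        by (rule eqv_sum, rule eqv_lmult, rule tw)
      have 2: "(\<Sum>r\<in>?E. z (m r) * (\<Sum>\<psi>\<in>Ch. z (?mon r \<psi>) * (E \<psi> * ?w))) =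
          (\<Sum>\<psi>\<in>Ch. z (h \<psi>) * (E \<psi> * ?w))"
      proof -
        have "(\<Sum>r\<in>?E. z (m r) * (\<Sum>\<psi>\<in>Ch. z (?mon r \<psi>) * (E \<psi> * ?w))) =
            (\<Sum>r\<in>?E. \<Sum>\<psi>\<in>Ch. z (m r * ?mon r \<psi>) * (E \<psi> * ?w))"
          by (simp only: sum_distrib_left z_mult mult.assoc)
        also have "\<dots> = (\<Sum>\<psi>\<in>Ch. \<Sum>r\<in>?E. z (m r * ?mon r \<psi>) * (E \<psi> *
            ?w))" by (rule sum.swap)
        also have "\<dots> = (\<Sum>\<psi>\<in>Ch. z (h \<psi>) * (E \<psi> * ?w))"
          by (simp only: h_def cst_sum \<kappa>_sum sum_distrib_right)
        finally show ?thesis .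
      qed
      have 3: "(\<Sum>\<psi>\<in>Ch. z (h \<psi>) * (E \<psi> * ?w)) =
          E \<chi> * ?w + (\<Sum>\<psi>\<in>Ch - ?Z. z (h \<psi>) * (E \<psi> * ?w))"
      proof -
        have "(\<Sum>\<psi>\<in>?Z. z (h \<psi>) * (E \<psi> * ?w)) = (\<Sum>\<psi>\<in>?Z. if \<psi> =
            \<chi> then E \<psi> * ?w else 0)"
        proof (intro sum.cong refl)
          fix \<psi> assume "\<psi> \<in> ?Z"
          then have "h \<psi> = of_bool (\<psi> = \<chi>)" unfolding h_def by (rule m[rule_format])
          then show "z (h \<psi>) * (E \<psi> * ?w) = (if \<psi> = \<chi> then E \<psi> * ?w else 0)" by simp
        qed
        also have "\<dots> = E \<chi> * ?w" using fin(1) \<chi> by simp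
        finally have Zs: "(\<Sum>\<psi>\<in>?Z. z (h \<psi>) * (E \<psi> * ?w)) = E \<chi> * ?w" .
        have "(\<Sum>\<psi>\<in>Ch. z (h \<psi>) * (E \<psi> * ?w)) =
            (\<Sum>\<psi>\<in>Ch - ?Z. z (h \<psi>) * (E \<psi> * ?w)) + (\<Sum>\<psi>\<in>?Z. z (h
                \<psi>) * (E \<psi> * ?w))"
          by (rule sum.subset_diff[OF ZCh finite_Ch])
        then show ?thesis unfolding Zs by (simp only: add.commute)
      qed
      from 1 have "?x \<approx> E \<chi> * ?w + (\<Sum>\<psi>\<in>Ch - ?Z. z (h \<psi>) * (E \<psi> *
          ?w))" unfolding 2 3 .
      then have "E \<chi> * ?w + (\<Sum>\<psi>\<in>Ch - ?Z. z (h \<psi>) * (E \<psi> * ?w)) \<in> spn Bas"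
        using \<open>?x \<in> spn Bas\<close> by (rule spn_eqv[OF eqv_sym])
      moreover have "(\<Sum>\<psi>\<in>Ch - ?Z. z (h \<psi>) * (E \<psi> * ?w)) \<in> spn Bas"
        by (intro spn_sum spn_scale out) auto
      ultimately have "E \<chi> * ?w + (\<Sum>\<psi>\<in>Ch - ?Z. z (h \<psi>) * (E \<psi> * ?w)) +
          - (\<Sum>\<psi>\<in>Ch - ?Z. z (h \<psi>) * (E \<psi> * ?w)) \<in> spn Bas"
        by (rule spn_add[OF _ spn_uminus])
      then show ?thesis by simp
    qed
    have "tp js * E \<chi> * ?w \<in> spn Bas" if \<chi>: "\<chi> \<in> Ch" for \<chi>
    proof -
      obtain c where c: "tp js * E \<chi> \<approx> z c * E \<chi>" using tp_E[OF js] by blast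
      have "E \<chi> * ?w \<in> spn Bas" by (cases "\<chi> \<in> ?Z") (rule ins, assumption, rule out[OF
          \<chi>])
      then have "z c * E \<chi> * ?w \<in> spn Bas" unfolding mult.assoc by (rule spn_scale)
      then show ?thesis by (rule spn_eqv[OF eqv_rmult[OF c]])
    qed
    then have "(\<Sum>\<chi>\<in>Ch. tp js * E \<chi> * ?w) \<in> spn Bas" by (rule spn_sum)
    then have "tp js * (\<Sum>\<chi>\<in>Ch. E \<chi>) * ?w \<in> spn Bas"
      by (simp only: sum_distrib_left sum_distrib_right)
    then show "b \<in> spn Bas" unfolding b by (simp only: sum_E mult_1_right)
  qed
qed

theorem vp_in_span:
  assumes "1 \<le> n" "set w \<subseteq> gset"
  shows "vp w \<in> spn Bas"
  using NF_subset_Bas[OF assms(1) S_subset_NF[OF S_vp[OF assms(2) order_refl]]] .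

text \<open>The coefficients are collected along the derivation of membership; indexing by
  \<open>I\<close> rather than by the image lets \<open>f\<close> repeat values.\<close>

lemma spn_image_combination:
  assumes "finite I" "x \<in> spn (f ` I)"
  shows "\<exists>c. x - (\<Sum>i\<in>I. \<kappa> (c i) * f i) \<in> J"
proof -
  define comb where "comb c = (\<Sum>i\<in>I. \<kappa> (c i) * f i)" for c
  have comb_add: "comb (\<lambda>i. c i + c' i) = comb c + comb c'" for c c'
    by (simp only: comb_def \<kappa>_add distrib_right sum.distrib)
  define P where "P x \<longleftrightarrow> (\<exists>c. x - comb c \<in> J)" for x
  have P_J: "P x" if "x \<in> J" for x
    using that unfolding P_def by (intro exI[of _ "\<lambda>_. 0"]) (simp add: comb_def)
  have P_base: "P (\<kappa> a * f i)" if "i \<in> I" for a i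
  proof -
    have "comb (\<lambda>k. if k = i then a else 0) = (\<Sum>k\<in>I. if k = i then \<kappa> a * f k else 0)"
      unfolding comb_def by (intro sum.cong) auto
    also have "\<dots> = \<kappa> a * f i" using assms(1) that by simp
    finally have "\<kappa> a * f i - comb (\<lambda>k. if k = i then a else 0) \<in> J" by (simp add: J_zero)
    then show ?thesis unfolding P_def by (intro exI[of _ "\<lambda>k. if k = i then a else 0"])
  qed
  have P_add: "P (x + y)" if "P x" "P y" for x y
  proof -
    from that(1) obtain c where c: "x - comb c \<in> J" unfolding P_def ..
    from that(2) obtain c' where c': "y - comb c' \<in> J" unfolding P_def ..
    have "x + y - comb (\<lambda>i. c i + c' i) = (x - comb c) + (y - comb c')" unfolding comb_add by simp
    with J_add[OF c c'] have "x + y - comb (\<lambda>i. c i + c' i) \<in> J" by (simp only:)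
    then show ?thesis unfolding P_def by (intro exI[of _ "\<lambda>i. c i + c' i"])
  qed
  from assms(2) have "P x"
    by (induction rule: spn.induct) (blast intro: P_J P_base P_add)+
  then show ?thesis unfolding P_def comb_def .
qed

end

subsection \<open>The free algebra as a monoid algebra\<close>

text \<open>With concatenation as addition on words, finitely supported functions on words form the
  monoid algebra of the free monoid, which is a ring by the library.\<close>

instantiation list :: (type) monoid_add
begin

definition zero_list_def: "0 = []"

definition plus_list_def: "xs + ys = xs @ ys"

instance
  by standard (simp_all add: zero_list_def plus_list_def)

end

type_synonym fa = "gen list \<Rightarrow>\<^sub>0 laurent"

definition pm :: "gen list \<Rightarrow> fa" where
  "pm w = Poly_Mapping.single w 1"

definition kap :: "laurent \<Rightarrow> fa" where
  "kap c = Poly_Mapping.single [] c"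

text \<open>Words with a letter outside the alphabet are discarded, so that the preimage of the ideal
  is an ideal of the whole monoid algebra.\<close>

definition restr :: "nat \<Rightarrow> fa \<Rightarrow> elt" where
  "restr n p = (\<lambda>w. if set w \<subseteq> gens n then Poly_Mapping.lookup p w else 0)"

section \<open>Comparison with coefficient functions on words\<close>

lemma fa_decompose: "p = (\<Sum>w\<in>Poly_Mapping.keys p. Poly_Mapping.single w (Poly_Mapping.lookup p w))"
  by (rule poly_mapping_eqI) (simp add: lookup_sum lookup_single when_def in_keys_iff)

lemma kap_mult: "kap c * p = (\<Sum>w\<in>Poly_Mapping.keys p. Poly_Mapping.single w (c *
    Poly_Mapping.lookup p w))"
proof -
  have "kap c * p = kap c * (\<Sum>w\<in>Poly_Mapping.keys p. Poly_Mapping.single w (Poly_Mapping.lookup p w))"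
    using fa_decompose[of p] by simp
  then show ?thesis by (simp add: sum_distrib_left kap_def mult_single plus_list_def)
qed

lemma mult_kap: "p * kap c = (\<Sum>w\<in>Poly_Mapping.keys p. Poly_Mapping.single w (c *
    Poly_Mapping.lookup p w))"
proof -
  have "p * kap c = (\<Sum>w\<in>Poly_Mapping.keys p. Poly_Mapping.single w (Poly_Mapping.lookup p w)) * kap c"
    using fa_decompose[of p] by simp
  then show ?thesis by (simp add: sum_distrib_right kap_def mult_single plus_list_def mult.commute)
qed

lemma lookup_kap_mult: "Poly_Mapping.lookup (kap c * p) w = c * Poly_Mapping.lookup p w"
  unfolding kap_mult by (simp add: lookup_sum lookup_single when_def in_keys_iff)

lemma lookup_fa_mult:
  "Poly_Mapping.lookup (p * q) w = ncmult (Poly_Mapping.lookup p) (Poly_Mapping.lookup q) w"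
proof -
  let ?A = "Poly_Mapping.keys p" and ?B = "Poly_Mapping.keys q"
  let ?p = "Poly_Mapping.lookup p" and ?q = "Poly_Mapping.lookup q"
  have "p * q = (\<Sum>u\<in>?A. Poly_Mapping.single u (?p u)) * (\<Sum>v\<in>?B. Poly_Mapping.single v (?q v))"
    using fa_decompose[of p] fa_decompose[of q] by simp
  also have "\<dots> = (\<Sum>u\<in>?A. \<Sum>v\<in>?B. Poly_Mapping.single (u @ v) (?p u * ?q v))"
    by (simp add: sum_product mult_single plus_list_def)
  also have "\<dots> = (\<Sum>(u, v)\<in>?A \<times> ?B. Poly_Mapping.single (u @ v) (?p u * ?q v))"
    by (simp add: sum.cartesian_product)
  finally have "Poly_Mapping.lookup (p * q) w =
      (\<Sum>(u, v)\<in>?A \<times> ?B. if u @ v = w then ?p u * ?q v else 0)"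
    by (simp add: lookup_sum lookup_single when_def split_beta)
  also have "\<dots> = (\<Sum>x\<in>?A \<times> ?B. if (case x of (u, v) \<Rightarrow> u @ v = w) then
      (case x of (u, v) \<Rightarrow> ?p u * ?q v) else 0)"
    by (intro sum.cong) auto
  also have "\<dots> = (\<Sum>x\<in>{x \<in> ?A \<times> ?B. case x of (u, v) \<Rightarrow> u @ v = w}.
      case x of (u, v) \<Rightarrow> ?p u * ?q v)"
    by (intro sum.inter_filter[symmetric]) simp
  also have "{x \<in> ?A \<times> ?B. case x of (u, v) \<Rightarrow> u @ v = w} = {(u, v). (u, v) \<in>
      ?A \<times> ?B \<and> u @ v = w}"
    by auto
  also have "(\<Sum>(u, v) | (u, v) \<in> ?A \<times> ?B \<and> u @ v = w. ?p u * ?q v) = ncmult ?p ?q w"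
    by (intro ncmult_pairs[symmetric]) (auto simp: in_keys_iff)
  finally show ?thesis .
qed

text \<open>A product of two words lies over the alphabet exactly when both factors do, so
  discarding the other words is multiplicative.\<close>

lemma restr_mult: "restr n (p * q) = ncmult (restr n p) (restr n q)"
proof
  fix w
  show "restr n (p * q) w = ncmult (restr n p) (restr n q) w"
  proof (cases "set w \<subseteq> gens n")
    case True
    then have "set (take k w) \<subseteq> gens n" "set (drop k w) \<subseteq> gens n" for k
      using set_take_subset[of k w] set_drop_subset[of k w] by blast+
    then show ?thesis using True by (simp add: restr_def lookup_fa_mult ncmult_def)
  next
    case False
    have "restr n p (take k w) * restr n q (drop k w) = 0" for k
    proof -
      have "set w = set (take k w) \<union> set (drop k w)" by (metis append_take_drop_id set_append)
      then show ?thesis using False by (auto simp: restr_def)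
    qed
    then have "ncmult (restr n p) (restr n q) w = 0"
      unfolding ncmult_def by (intro sum.neutral ballI)
    then show ?thesis using False by (simp add: restr_def)
  qed
qed

lemma restr_add: "restr n (p + q) = ncadd (restr n p) (restr n q)"
  by (rule ext) (simp add: restr_def ncadd_def lookup_add)

lemma restr_diff: "restr n (p - q) = ncsub (restr n p) (restr n q)"
  by (rule ext) (simp add: restr_def ncsub_def lookup_minus)

lemma restr_sum: "restr n (\<Sum>k\<in>A. F k) = ncsum (\<lambda>k. restr n (F k)) A"
  by (rule ext) (simp add: restr_def ncsum_def lookup_sum)

lemma restr_scale: "restr n (kap c * p) = ncsmult c (restr n p)"
  by (rule ext) (simp add: restr_def ncsmult_def lookup_kap_mult)

lemma restr_pm: "set w \<subseteq> gens n \<Longrightarrow> restr n (pm w) = wd w"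
  by (rule ext) (auto simp: restr_def pm_def wd_def mono_def lookup_single when_def)

lemma restr_freealg: "restr n p \<in> freealg n"
proof -
  have "{w. restr n p w \<noteq> 0} \<subseteq> Poly_Mapping.keys p" by (auto simp: restr_def in_keys_iff)
  then have "finite {w. restr n p w \<noteq> 0}" by (rule finite_subset) simp
  then show ?thesis by (auto simp: freealg_def restr_def)
qed

lemma pm_append: "pm (u @ w) = pm u * pm w"
  by (simp add: pm_def mult_single plus_list_def)

lemma pm_Nil: "pm [] = 1"
  unfolding pm_def by (metis single_one zero_list_def)

lemma pm_replicate: "pm (replicate k x) = pm [x] ^ k"
proof (induction k)
  case (Suc k)
  have "pm (replicate (Suc k) x) = pm ([x] @ replicate k x)" by simp
  then show ?case using Suc by (simp only: pm_append power_Suc)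
qed (simp add: pm_Nil)

definition Jfa :: "nat \<Rightarrow> nat \<Rightarrow> fa set" where
  "Jfa d n = {p. restr n p \<in> YTL_ideal d n}"

lemma Jfa_relI: "r \<in> Y_rels d n \<union> TL_rels n \<Longrightarrow> restr n p = r \<Longrightarrow>
    p \<in> Jfa d n"
  unfolding Jfa_def YTL_ideal_def by (simp add: ideal_gen.gen)

lemma two_sided_ideal_Jfa: "two_sided_ideal (Jfa d n)"
proof
  have "restr n 0 = (\<lambda>_. 0)" by (rule ext) (simp add: restr_def)
  then show "0 \<in> Jfa d n"
    unfolding Jfa_def YTL_ideal_def mem_Collect_eq by (simp only: ideal_gen.zero)
  fix x y p assume "x \<in> Jfa d n"
  then show "p * x \<in> Jfa d n" "x * p \<in> Jfa d n"
    unfolding Jfa_def YTL_ideal_def mem_Collect_eq restr_mult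
    by (simp_all only: ideal_gen.lmult ideal_gen.rmult restr_freealg)
  assume "y \<in> Jfa d n"
  with \<open>x \<in> _\<close> show "x + y \<in> Jfa d n"
    unfolding Jfa_def YTL_ideal_def mem_Collect_eq restr_add by (rule ideal_gen.add)
qed

lemma gens_iff: "G i \<in> gens n \<longleftrightarrow> i \<in> {1..<n}" "T j \<in> gens n
    \<longleftrightarrow> j \<in> {1..n}" if "1 \<le> n"
  using that by (auto simp: gens_def)

lemma Y_rels_intros:
  "\<lbrakk>1 \<le> i; i \<le> n - 1; 1 \<le> j; j \<le> n - 1; i + 1 < j \<or> j + 1 < i\<rbrakk>
      \<Longrightarrow>
    ncsub (wd [G i, G j]) (wd [G j, G i]) \<in> Y_rels d n"
  "\<lbrakk>1 \<le> i; i + 2 \<le> n\<rbrakk> \<Longrightarrow>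
    ncsub (wd [G i, G (i+1), G i]) (wd [G (i+1), G i, G (i+1)]) \<in> Y_rels d n"
  "\<lbrakk>1 \<le> i; i \<le> n; 1 \<le> j; j \<le> n\<rbrakk> \<Longrightarrow> ncsub (wd [T i, T j])
      (wd [T j, T i]) \<in> Y_rels d n"
  "\<lbrakk>1 \<le> i; i \<le> n - 1; 1 \<le> j; j \<le> n\<rbrakk> \<Longrightarrow>
    ncsub (wd [T j, G i]) (wd [G i, T (sw i j)]) \<in> Y_rels d n"
  "\<lbrakk>1 \<le> j; j \<le> n\<rbrakk> \<Longrightarrow> ncsub (wd (replicate d (T j))) (wd []) \<in>
      Y_rels d n"
  "\<lbrakk>1 \<le> i; i \<le> n - 1\<rbrakk> \<Longrightarrow> ncsub (wd [G i, G i]) (ncadd (wd [])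
      (ncadd (ncsmult (uu - 1) (e_el d i))
        (ncsmult (uu - 1) (ncmult (e_el d i) (wd [G i]))))) \<in> Y_rels d n"
  unfolding Y_rels_def Un_iff mem_Collect_eq by blast+

lemma ytl_fa:
  assumes d: "1 \<le> d" and n: "1 \<le> n"
  shows "ytl (Jfa d n) kap (\<lambda>i. pm [G i]) (\<lambda>j. pm [T j]) d n"
proof -
  interpret two_sided_ideal "Jfa d n" by (rule two_sided_ideal_Jfa)
  note gi = gens_iff[OF n]
  have pm2: "pm [x, y] = pm [x] * pm [y]" and pm3: "pm [x, y, v] = pm [x] * pm [y] * pm [v]" for x y v
    using pm_append[of "[x]" "[y]"] pm_append[of "[x, y]" "[v]"] by simp_all
  show ?thesis
  proof
    fix a b :: laurent and x :: fa
    show "kap (a + b) = kap a + kap b" by (simp add: kap_def single_add)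
    show "kap (a * b) = kap a * kap b" by (simp add: kap_def mult_single plus_list_def)
    show "kap 1 = 1" using pm_Nil by (simp add: kap_def pm_def)
    show "kap a * x = x * kap a" unfolding kap_mult mult_kap ..
  next
    fix i j assume i: "1 \<le> i" "Suc i < j" "j < n"
    have "ncsub (wd [G i, G j]) (wd [G j, G i]) \<in> Y_rels d n"
      using i by (intro Y_rels_intros(1)) auto
    moreover have "restr n (pm [G i] * pm [G j] - pm [G j] * pm [G i]) = ncsub (wd [G i, G j]) (wd [G j, G i])"
      unfolding pm2[symmetric] restr_diff using i gi by (simp add: restr_pm)
    ultimately show "eqv (pm [G i] * pm [G j]) (pm [G j] * pm [G i])"
      unfolding eqv_def by (intro Jfa_relI[OF UnI1])
  next
    fix i assume i: "1 \<le> i" "Suc i < n"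
    have "ncsub (wd [G i, G (i+1), G i]) (wd [G (i+1), G i, G (i+1)]) \<in> Y_rels d n"
      using i by (intro Y_rels_intros(2)) auto
    moreover have "restr n (pm [G i] * pm [G (Suc i)] * pm [G i] - pm [G (Suc i)] * pm [G i] * pm [G (Suc i)]) =
        ncsub (wd [G i, G (i+1), G i]) (wd [G (i+1), G i, G (i+1)])"
      unfolding pm3[symmetric] restr_diff using i gi by (simp add: restr_pm)
    ultimately show "eqv (pm [G i] * pm [G (Suc i)] * pm [G i]) (pm [G (Suc i)] * pm [G i] * pm [G (Suc i)])"
      unfolding eqv_def by (intro Jfa_relI[OF UnI1])
  next
    fix i j assume i: "i \<in> {1..n}" "j \<in> {1..n}"
    have "ncsub (wd [T i, T j]) (wd [T j, T i]) \<in> Y_rels d n"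
      using i by (intro Y_rels_intros(3)) auto
    moreover have "restr n (pm [T i] * pm [T j] - pm [T j] * pm [T i]) = ncsub (wd [T i, T j]) (wd [T j, T i])"
      unfolding pm2[symmetric] restr_diff using i gi by (simp add: restr_pm)
    ultimately show "eqv (pm [T i] * pm [T j]) (pm [T j] * pm [T i])"
      unfolding eqv_def by (intro Jfa_relI[OF UnI1])
  next
    fix i j assume i: "i \<in> {1..<n}" "j \<in> {1..n}"
    have "ncsub (wd [T j, G i]) (wd [G i, T (sw i j)]) \<in> Y_rels d n"
      using i by (intro Y_rels_intros(4)) auto
    moreover have "sw i j \<in> {1..n}" using i by (auto simp: sw_def)
    then have "restr n (pm [T j] * pm [G i] - pm [G i] * pm [T (sw i j)]) = ncsub (wd [T j, G i]) (wd [G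
        i, T (sw i j)])"
      unfolding pm2[symmetric] restr_diff using i gi by (simp add: restr_pm)
    ultimately show "eqv (pm [T j] * pm [G i]) (pm [G i] * pm [T (sw i j)])"
      unfolding eqv_def by (intro Jfa_relI[OF UnI1])
  next
    fix j assume j: "j \<in> {1..n}"
    have "ncsub (wd (replicate d (T j))) (wd []) \<in> Y_rels d n"
      using j by (intro Y_rels_intros(5)) auto
    moreover have "restr n (pm [T j] ^ d - 1) = ncsub (wd (replicate d (T j))) (wd [])"
    proof -
      have "restr n (pm (replicate d (T j))) = wd (replicate d (T j))" "restr n (pm []) = wd []"
        using j gi(2)[of j] by (intro restr_pm; auto)+
      then show ?thesis by (simp only: pm_replicate pm_Nil restr_diff)
    qed
    ultimately show "eqv (pm [T j] ^ d) (1)"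
      unfolding eqv_def by (intro Jfa_relI[OF UnI1])
  next
    fix i assume i: "i \<in> {1..<n}"
    let ?s = "kap (cst (1 / of_nat d)) * (\<Sum>s\<in>{0..<d}. pm [T i] ^ s * pm [T (Suc i)] ^ ((d - s) mod d))"
    have e: "restr n ?s = e_el d i"
    proof -
      have "restr n (pm [T i] ^ s * pm [T (Suc i)] ^ k) = wd (replicate s (T i) @ replicate k (T (i +
          1)))" for s k
      proof -
        have "set (replicate s (T i) @ replicate k (T (i + 1))) \<subseteq> gens n"
          using i gi(2)[of i] gi(2)[of "i + 1"] by auto
        from restr_pm[OF this] show ?thesis by (simp only: pm_replicate pm_append Suc_eq_plus1)
      qed
      then show ?thesis unfolding e_el_def restr_scale restr_sum by simp
    qed
    have "ncsub (wd [G i, G i]) (ncadd (wd []) (ncadd (ncsmult (uu - 1) (e_el d i))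
        (ncsmult (uu - 1) (ncmult (e_el d i) (wd [G i]))))) \<in> Y_rels d n"
      using i by (intro Y_rels_intros(6)) auto
    moreover have "restr n (pm [G i] * pm [G i] - (1 + kap (uu - 1) * ?s + kap (uu - 1) * (?s * pm [G i]))) =
      ncsub (wd [G i, G i]) (ncadd (wd []) (ncadd (ncsmult (uu - 1) (e_el d i))
        (ncsmult (uu - 1) (ncmult (e_el d i) (wd [G i])))))"
    proof -
      have "restr n (pm [G i]) = wd [G i]" "restr n (pm [G i, G i]) = wd [G i, G i]" "restr n (pm []) = wd []"
        using i gi by (simp_all add: restr_pm)
      then have "restr n (pm [G i, G i] - (pm [] + (kap (uu - 1) * ?s + kap (uu - 1) * (?s * pm [G i])))) =
          ncsub (wd [G i, G i]) (ncadd (wd []) (ncadd (ncsmult (uu - 1) (e_el d i))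
            (ncsmult (uu - 1) (ncmult (e_el d i) (wd [G i])))))"
        by (simp only: restr_diff restr_add restr_scale[of n "uu - 1"] restr_mult[of n ?s] e)
      then show ?thesis by (simp only: pm2 pm_Nil add.assoc)
    qed
    ultimately show "eqv (pm [G i] * pm [G i]) (1 + kap (uu - 1) * ?s + kap (uu - 1) * (?s * pm [G i]))"
      unfolding eqv_def by (intro Jfa_relI[OF UnI1])
  next
    fix i assume i: "1 \<le> i" "Suc i < n"
    let ?W = "{[G i, G (i+1), G i], [G i, G (i+1)], [G (i+1), G i], [G i], [G (i+1)], []}"
    have "ncsum wd ?W \<in> TL_rels n"
      using i unfolding TL_rels_def by (intro CollectI exI[of _ i]) simp
    moreover have "restr n (\<Sum>w\<in>?W. pm w) = ncsum wd ?W"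
    proof -
      have "restr n (pm w) = wd w" if "w \<in> ?W" for w
        using that i gi by (intro restr_pm) auto
      then show ?thesis unfolding restr_sum ncsum_def by (intro ext sum.cong) simp_all
    qed
    moreover have "(\<Sum>w\<in>?W. pm w) = pm [G i] * pm [G (Suc i)] * pm [G i] + pm [G i] * pm [G (Suc i)] +
        pm [G (Suc i)] * pm [G i] + pm [G i] + pm [G (Suc i)] + 1"
    proof -
      have "(\<Sum>w\<in>?W. pm w) = pm [G i, G (i+1), G i] + (pm [G i, G (i+1)] + (pm [G (i+1), G i] +
          (pm [G i] + (pm [G (i+1)] + pm []))))" by simp
      then show ?thesis by (simp only: pm2 pm3 pm_Nil add.assoc Suc_eq_plus1)
    qed
    ultimately show "pm [G i] * pm [G (Suc i)] * pm [G i] + pm [G i] * pm [G (Suc i)] +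
        pm [G (Suc i)] * pm [G i] + pm [G i] + pm [G (Suc i)] + 1 \<in> Jfa d n"
      by (intro Jfa_relI[OF UnI2]) (simp_all only:)
  qed (use d in simp)
qed

subsection \<open>The basis theorem\<close>

lemma finite_Sidx: "1 \<le> n \<Longrightarrow> finite (Sidx d n)"
proof -
  assume n: "1 \<le> n"
  have "Sidx d n = Sigma (Tn n) (Eset d n)" by (auto simp: Sidx_def)
  then show ?thesis using finite_SigmaI[OF finite_Tn finite_Eset[OF _ n]] by simp
qed

text \<open>An element of the free algebra has only words over the alphabet and is the restriction
  of an element of the monoid algebra; the spanning result there is carried back by
  \<open>restr\<close>.\<close>

lemma Svec_spans:
  assumes d: "1 \<le> d" and n: "1 \<le> n" and p: "p \<in> freealg n"
  shows "\<exists>c. ncsub p (ncsum (\<lambda>j. ncsmult (c j) (Svec n j)) (Sidx d n)) \<in> YTL_ideal d n"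
proof -
  interpret ytl "Jfa d n" kap "\<lambda>i. pm [G i]" "\<lambda>j. pm [T j]" d n by (rule ytl_fa[OF d n])
  have vp: "vp w = pm w" for w
  proof (induction w)
    case (Cons x w)
    have "val x = pm [x]" by (cases x) (simp_all add: val_def)
    moreover have "pm (x # w) = pm [x] * pm w" using pm_append[of "[x]" w] by simp
    ultimately show ?case using Cons by simp
  qed (simp add: pm_Nil)
  have gset: "gset = gens n"
    using n unfolding gset_def gens_def by auto
  have fin: "finite {w. p w \<noteq> 0}" and sup: "\<And>w. p w \<noteq> 0 \<Longrightarrow> set w
      \<subseteq> gens n"
    using p by (auto simp: freealg_def)
  define q where "q = Abs_poly_mapping p"
  have lq: "Poly_Mapping.lookup q = p" unfolding q_def using fin by simp
  have rq: "restr n q = p"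
    unfolding restr_def lq using sup by (intro ext) auto
  have "q = (\<Sum>w\<in>Poly_Mapping.keys q. kap (p w) * pm w)"
    using fa_decompose[of q] by (simp add: lq kap_def pm_def mult_single plus_list_def)
  also have "\<dots> \<in> spn Bas"
  proof (intro spn_sum spn_scale)
    fix w assume "w \<in> Poly_Mapping.keys q"
    then have "set w \<subseteq> gset" using sup[of w] by (simp add: in_keys_iff lq gset)
    from vp_in_span[OF n this] show "pm w \<in> spn Bas" by (simp only: vp)
  qed
  finally have "q \<in> spn Bas" .
  from spn_image_combination[OF finite_Sidx[OF n] this[unfolded Bas_def]] obtain c where
    c: "q - (\<Sum>j\<in>Sidx d n. kap (c j) * (case j of (ik, r) \<Rightarrow> vp (tword n r) * gp
        (nfword (cyc ik)))) \<in> Jfa d n" ..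
  have sv: "restr n (case j of (ik, r) \<Rightarrow> vp (tword n r) * gp (nfword (cyc ik))) = Svec n j"
    if j: "j \<in> Sidx d n" for j
  proof -
    obtain ik r where ik: "j = (ik, r)" "ik \<in> Tn n" using j by (auto simp: Sidx_def)
    have "vp (tword n r) * gp (nfword (cyc ik)) = pm (tword n r @ gword ik)"
      by (simp only: vp_map_G[symmetric] vp pm_append gword_cyc[OF ik(2)])
    moreover have "set (tword n r @ gword ik) \<subseteq> gens n"
    proof -
      have "letters (cyc ik) \<subseteq> {1..n - 1}" by (rule nf_cyc(2)[OF ik(2)])
      then have "set (gword ik) \<subseteq> gens n"
        unfolding gword_cyc[OF ik(2)] set_map set_nfword by (auto simp: gens_def)
      moreover have "set (tword n r) \<subseteq> gens n"
        unfolding tword_def by (auto simp: gens_def)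
      ultimately show ?thesis by simp
    qed
    ultimately show ?thesis by (simp add: ik(1) restr_pm Svec_def wd_def)
  qed
  have "restr n (q - (\<Sum>j\<in>Sidx d n. kap (c j) * (case j of (ik, r) \<Rightarrow> vp (tword n r) *
      gp (nfword (cyc ik))))) =
      ncsub p (ncsum (\<lambda>j. ncsmult (c j) (Svec n j)) (Sidx d n))"
    unfolding restr_diff rq restr_sum restr_scale
    by (intro arg_cong[of _ _ "ncsub p"]) (auto simp: ncsum_def sv intro!: ext sum.cong)
  then show ?thesis using c unfolding Jfa_def by auto
qed

theorem theorem2:
  fixes d n :: nat
  assumes "d \<ge> 1" and "n \<ge> 3"
  shows "is_quot_basis (freealg n) (YTL_ideal d n) (Sidx d n) (Svec n) \<and>
    (\<forall>ik\<in>Tn n. int (card (Eset d n ik)) =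
        2 ^ (n - weight ik - 1) * int d ^ 2 - (2 ^ (n - weight ik - 1) - 1) * int d
        - (if weight ik = 0 then int d ^ 2 - int d else 0))"
proof
  have n: "1 \<le> n" using assms(2) by simp
  show "is_quot_basis (freealg n) (YTL_ideal d n) (Sidx d n) (Svec n)"
    unfolding is_quot_basis_def
    using finite_Sidx[OF n] Svec_spans[OF assms(1) n]
      Svec_independent[OF assms(1) n finite_Sidx[OF n]] by blast
  show "\<forall>ik\<in>Tn n. int (card (Eset d n ik)) =
        2 ^ (n - weight ik - 1) * int d ^ 2 - (2 ^ (n - weight ik - 1) - 1) * int d
        - (if weight ik = 0 then int d ^ 2 - int d else 0)"
    using card_Eset[OF _ n assms(1)] by blast
qed

end
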